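(* Let $\Omega\subset\mathbb R^d$ ($d\ge 2$) be a uniformly convex domain and let $\mathcal N_h=\mathcal N_h^0\cup\mathcal N_h^\partial$ be a nodal set whose interior part $\mathcal N_h^0$ is translation invariant. Let $f\in C(\overline\Omega)$, $g\in C(\partial\Omega)$, and let $u$ be the convex solution of $\det D^2u=f$ in $\Omega$, $u=g$ on $\partial\Omega$, with $\lambda I\le D^2u\le\Lambda I$ in $\Omega$ for constants $0<\lambda\le\Lambda$. Let $u_h$ be the convex nodal function with $u_h(x_i)=g(x_i)$ for all $x_i\in\mathcal N_h^\partial$ and $$|\partial u_h(x_i)|=f_i:=\int_\Omega f\phi_i\,dx\qquad\forall x_i\in\mathcal N_h^0,$$ where $\{\phi_i\}_{i=1}^n$ is a translation invariant basis of hat functions over a mesh $\mathcal T_h$ with nodes $\mathcal N_h$. If $f(x)\ge\lambda_F>0$ for all $x\in\Omega$ and $u\in C^{2,\alpha}(\overline\Omega)$ with $0<\alpha\le 1$, then $$\|u-\Gamma(u_h)\|_{L^\infty(\Omega_h)}\le C\,h^\alpha,$$ where $C=C(d,\Omega,\lambda,\Lambda,\lambda_F)\big(|u|_{C^{2,\alpha}(\overline\Omega)}+|u|_{W^2_\infty(\Omega)}\big)$.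
   Context: Nodes and mesh. $\mathcal N_h=\mathcal N_h^0\cup\mathcal N_h^\partial$ is a finite set with interior nodes $\mathcal N_h^0=\{x_i\}_{i=1}^n\subset\Omega$ and boundary nodes $\mathcal N_h^\partial=\{x_i\}_{i=n+1}^N\subset\partial\Omega$. $\mathcal T_h$ is a conforming simplicial mesh with vertex set $\mathcal N_h$, and $\Omega_h=\bigcup_{T\in\mathcal T_h}T\subset\overline\Omega$. With $h_T=\operatorname{diam}T$, $\rho_T$ the diameter of the largest ball inscribed in $T$, and $h_i=\max\{h_T:x_i\in T\}$, it is assumed throughout that $\mathcal N_h$ is quasi-uniform ($\gamma h\le h_i\le h$ for $1\le i\le n$, with $0<\gamma\le1$, $h>0$) and shape-regular ($h_T/\rho_T\le\sigma$ for all $T$). The constants $\gamma,\sigma$ are fixed, and generic constants may depend on them. Translation invariance. $\mathcal N_h^0$ is translation invariant if there is a basis $\{e_j\}_{j=1}^d$ of $\mathbb R^d$ with $|e_j|\le1$ such that $\mathcal N_h^0=\{h\sum_{j}k_je_j:k_j\in\mathbb Z\}\cap\Omega$; the boundary nodes are only required to satisfy $\partial\Omega\subset\bigcup_{x_i\in\mathcal N_h^\partial}B_{h/2}(x_i)$. The hat function $\phi_i$ is the continuous piecewise linear function over $\mathcal T_h$ equal to $1$ at $x_i$ and $0$ at all other nodes. The basis $\{\phi_i\}_{i=1}^n$ is translation invariant if $\phi_i(x+x_i)=\phi_j(x+x_j)$ for all $x\in\mathbb R^d$ whenever $x_i,x_j\in\mathcal N_h^0$ have distance $>h$ to $\partial\Omega_h$.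 Nodal functions. A nodal function is a map $u_h:\mathcal N_h\to\mathbb R$. It is convex if for every $x_i\in\mathcal N_h^0$ there is an affine $L$ with $L(x_i)=u_h(x_i)$ and $L\le u_h$ on $\mathcal N_h$. Its subdifferential at $x_i$ is $\partial u_h(x_i)=\{v\in\mathbb R^d:u_h(x_j)\ge u_h(x_i)+v\cdot(x_j-x_i)\ \forall x_j\in\mathcal N_h\}$, and $|\cdot|$ of a set is $d$-dimensional Lebesgue measure. Its convex envelope is $\Gamma(u_h)(x)=\sup\{L(x):L\text{ affine},\ L(x_i)\le u_h(x_i)\ \forall x_i\in\mathcal N_h\}$, $x\in\Omega_h$. $|u|_{C^{2,\alpha}}$ is the $\alpha$-Hölder seminorm of $D^2u$, and $|u|_{W^2_\infty}$ the $L^\infty$ norm of $D^2u$. *)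

theory Defs
  imports "HOL-Analysis.Analysis" "HOL-Probability.Essential_Supremum"
begin

section \<open>Function spaces and domains\<close>

definition gradient :: "(real^'n \<Rightarrow> real) \<Rightarrow> real^'n \<Rightarrow> real^'n" where
  "gradient u x = (\<chi> i. frechet_derivative u (at x) (axis i 1))"

definition hessian :: "(real^'n \<Rightarrow> real) \<Rightarrow> real^'n \<Rightarrow> real^'n^'n" where
  "hessian u x = matrix (frechet_derivative (gradient u) (at x))"

definition loewner_le :: "real^'n^'n \<Rightarrow> real^'n^'n \<Rightarrow> bool" where
  "loewner_le A B \<longleftrightarrow> (\<forall>v. v \<bullet> (A *v v) \<le> v \<bullet> (B *v v))"

(* Norms and seminorms take values in ereal, so that an infinite one is not
   silently replaced by a real default value. *)

definition Linf_norm :: "(real^'n) set \<Rightarrow> (real^'n \<Rightarrow> 'b::real_normed_vector) \<Rightarrow> ereal" where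
  "Linf_norm S F = esssup (lebesgue_on S) (\<lambda>x. ereal (norm (F x)))"

definition holder_seminorm ::
    "real \<Rightarrow> (real^'n) set \<Rightarrow> (real^'n \<Rightarrow> 'b::real_normed_vector) \<Rightarrow> ereal" where
  "holder_seminorm \<alpha> S F =
     (SUP (x, y) \<in> {(x, y). x \<in> S \<and> y \<in> S \<and> x \<noteq> y}.
        ereal (norm (F x - F y) / dist x y powr \<alpha>))"

definition W2inf_seminorm :: "(real^'n) set \<Rightarrow> (real^'n \<Rightarrow> real) \<Rightarrow> ereal" where
  "W2inf_seminorm \<Omega> u = Linf_norm \<Omega> (hessian u)"

(* The seminorm on the closure of Omega.  Derivatives are taken in the open set
   Omega only; for functions whose Hessian extends continuously to the closure,
   the supremum over Omega and that over the closure agree. *)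
definition C2_holder_seminorm :: "real \<Rightarrow> (real^'n) set \<Rightarrow> (real^'n \<Rightarrow> real) \<Rightarrow> ereal" where
  "C2_holder_seminorm \<alpha> \<Omega> u = holder_seminorm \<alpha> \<Omega> (hessian u)"

definition extends_continuously ::
    "(real^'n) set \<Rightarrow> (real^'n \<Rightarrow> 'b::topological_space) \<Rightarrow> bool" where
  "extends_continuously \<Omega> F \<longleftrightarrow>
     (\<exists>G. continuous_on (closure \<Omega>) G \<and> (\<forall>x\<in>\<Omega>. G x = F x))"

(* Membership of u in C^{2,alpha} of the closure of the open set Omega. *)
definition C2_holder :: "real \<Rightarrow> (real^'n) set \<Rightarrow> (real^'n \<Rightarrow> real) \<Rightarrow> bool" where
  "C2_holder \<alpha> \<Omega> u \<longleftrightarrow>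
     continuous_on (closure \<Omega>) u \<and>
     (\<forall>x\<in>\<Omega>. u differentiable (at x)) \<and>
     (\<forall>x\<in>\<Omega>. gradient u differentiable (at x)) \<and>
     extends_continuously \<Omega> (gradient u) \<and>
     extends_continuously \<Omega> (hessian u) \<and>
     C2_holder_seminorm \<alpha> \<Omega> u < \<infinity>"

(* Uniform convexity as the uniform enclosing ball condition: at every boundary
   point there is a touching ball of a fixed radius R that contains the domain.
   For C^2 boundaries this says that all principal curvatures are at least 1/R. *)
definition uniformly_convex_domain :: "(real^'n) set \<Rightarrow> bool" where
  "uniformly_convex_domain \<Omega> \<longleftrightarrow>
     open \<Omega> \<and> \<Omega> \<noteq> {} \<and> bounded \<Omega> \<and> convex \<Omega> \<and>
     (\<exists>R>0. \<forall>z\<in>frontier \<Omega>. \<exists>c. dist c z = R \<and> \<Omega> \<subseteq> cball c R)"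

definition convex_MA_solution ::
    "(real^'n) set \<Rightarrow> (real^'n \<Rightarrow> real) \<Rightarrow> (real^'n \<Rightarrow> real) \<Rightarrow> (real^'n \<Rightarrow> real) \<Rightarrow> bool" where
  "convex_MA_solution \<Omega> f g u \<longleftrightarrow>
     convex_on \<Omega> u \<and>
     (\<forall>x\<in>\<Omega>. det (hessian u x) = f x) \<and>
     (\<forall>x\<in>frontier \<Omega>. u x = g x)"


section \<open>Nodes and meshes\<close>

definition simplicial_mesh ::
    "(real^'n) set \<Rightarrow> (real^'n) set \<Rightarrow> (real^'n) set \<Rightarrow> (real^'n) set set \<Rightarrow> bool" where
  "simplicial_mesh \<Omega> N0 Nb \<T> \<longleftrightarrow>
     finite (N0 \<union> Nb) \<and> N0 \<subseteq> \<Omega> \<and> Nb \<subseteq> frontier \<Omega> \<and>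
     triangulation \<T> \<and>
     (\<forall>T\<in>\<T>. int CARD('n) simplex T) \<and>
     (\<Union>T\<in>\<T>. {x. x extreme_point_of T}) = N0 \<union> Nb \<and>
     \<Union>\<T> \<subseteq> closure \<Omega>"

(* diameter of the largest ball inscribed in T *)
definition inball_diameter :: "(real^'n) set \<Rightarrow> real" where
  "inball_diameter T = Sup {2 * r |r. 0 \<le> r \<and> (\<exists>c. cball c r \<subseteq> T)}"

definition local_size :: "(real^'n) set set \<Rightarrow> real^'n \<Rightarrow> real" where
  "local_size \<T> x = Max (diameter ` {T \<in> \<T>. x \<in> T})"

definition quasi_uniform :: "real \<Rightarrow> real \<Rightarrow> (real^'n) set \<Rightarrow> (real^'n) set set \<Rightarrow> bool" where
  "quasi_uniform \<gamma> h N0 \<T> \<longleftrightarrow> (\<forall>z\<in>N0. \<gamma> * h \<le> local_size \<T> z \<and> local_size \<T> z \<le> h)"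

definition shape_regular :: "real \<Rightarrow> (real^'n) set set \<Rightarrow> bool" where
  "shape_regular \<sigma> \<T> \<longleftrightarrow> (\<forall>T\<in>\<T>. diameter T / inball_diameter T \<le> \<sigma>)"

definition translation_invariant_nodes ::
    "(real^'n) set \<Rightarrow> real \<Rightarrow> (real^'n) set \<Rightarrow> (real^'n) set \<Rightarrow> bool" where
  "translation_invariant_nodes \<Omega> h N0 Nb \<longleftrightarrow>
     (\<exists>e :: 'n \<Rightarrow> real^'n.
        inj e \<and> independent (range e) \<and> (\<forall>j. norm (e j) \<le> 1) \<and>
        N0 = {h *\<^sub>R (\<Sum>j\<in>UNIV. of_int (k j) *\<^sub>R e j) |k :: 'n \<Rightarrow> int. True} \<inter> \<Omega>) \<and>
     frontier \<Omega> \<subseteq> (\<Union>z\<in>Nb. ball z (h / 2))"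

definition affine_fun :: "(real^'n \<Rightarrow> real) \<Rightarrow> bool" where
  "affine_fun L \<longleftrightarrow> (\<exists>a b. \<forall>x. L x = a \<bullet> x + b)"

(* A hat function is a function on the whole space, zero outside the mesh; the
   identity defining translation invariance and the integral over Omega both
   evaluate it there.  Its continuity on the whole space forces the node z to lie
   in the interior of the union of the mesh, as it should for an interior node. *)
definition hat_function ::
    "(real^'n) set set \<Rightarrow> (real^'n) set \<Rightarrow> real^'n \<Rightarrow> (real^'n \<Rightarrow> real) \<Rightarrow> bool" where
  "hat_function \<T> N z \<phi> \<longleftrightarrow>
     continuous_on UNIV \<phi> \<and>
     (\<forall>T\<in>\<T>. \<exists>L. affine_fun L \<and> (\<forall>x\<in>T. \<phi> x = L x)) \<and>
     (\<forall>y\<in>N. \<phi> y = (if y = z then 1 else 0)) \<and>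
     (\<forall>x. x \<notin> \<Union>\<T> \<longrightarrow> \<phi> x = 0)"

(* phi is indexed by the interior nodes themselves *)
definition translation_invariant_hat_basis ::
    "real \<Rightarrow> (real^'n) set \<Rightarrow> (real^'n) set \<Rightarrow> (real^'n) set set \<Rightarrow>
     (real^'n \<Rightarrow> real^'n \<Rightarrow> real) \<Rightarrow> bool" where
  "translation_invariant_hat_basis h N0 Nb \<T> \<phi> \<longleftrightarrow>
     (\<forall>z\<in>N0. hat_function \<T> (N0 \<union> Nb) z (\<phi> z)) \<and>
     (\<forall>y\<in>N0. \<forall>z\<in>N0.
        h < infdist y (frontier (\<Union>\<T>)) \<and> h < infdist z (frontier (\<Union>\<T>)) \<longrightarrow>
        (\<forall>x. \<phi> y (x + y) = \<phi> z (x + z)))"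


section \<open>Nodal functions\<close>

(* A nodal function is represented by a function on the whole space of which only
   the values at the nodes are used. *)

definition convex_nodal ::
    "(real^'n) set \<Rightarrow> (real^'n) set \<Rightarrow> (real^'n \<Rightarrow> real) \<Rightarrow> bool" where
  "convex_nodal N0 Nb uh \<longleftrightarrow>
     (\<forall>z\<in>N0. \<exists>L. affine_fun L \<and> L z = uh z \<and> (\<forall>y\<in>N0 \<union> Nb. L y \<le> uh y))"

definition nodal_subdifferential ::
    "(real^'n) set \<Rightarrow> (real^'n \<Rightarrow> real) \<Rightarrow> real^'n \<Rightarrow> (real^'n) set" where
  "nodal_subdifferential N uh z = {v. \<forall>y\<in>N. uh y \<ge> uh z + v \<bullet> (y - z)}"

definition convex_envelope ::
    "(real^'n) set \<Rightarrow> (real^'n \<Rightarrow> real) \<Rightarrow> real^'n \<Rightarrow> real" where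
  "convex_envelope N uh x = Sup {L x |L. affine_fun L \<and> (\<forall>y\<in>N. L y \<le> uh y)}"

definition discrete_MA_solution ::
    "(real^'n) set \<Rightarrow> (real^'n \<Rightarrow> real) \<Rightarrow> (real^'n \<Rightarrow> real) \<Rightarrow>
     (real^'n) set \<Rightarrow> (real^'n) set \<Rightarrow> (real^'n \<Rightarrow> real^'n \<Rightarrow> real) \<Rightarrow> (real^'n \<Rightarrow> real) \<Rightarrow> bool" where
  "discrete_MA_solution \<Omega> f g N0 Nb \<phi> uh \<longleftrightarrow>
     convex_nodal N0 Nb uh \<and>
     (\<forall>z\<in>Nb. uh z = g z) \<and>
     (\<forall>z\<in>N0. emeasure lebesgue (nodal_subdifferential (N0 \<union> Nb) uh z) =
        ennreal (LINT x:\<Omega>|lebesgue. f x * \<phi> z x))"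

end

theory Submission
  imports Defs
begin

text \<open>
  A nodal function lies below another one as soon as it does so at the boundary nodes and its
  nodal subdifferentials at the interior nodes are strictly larger in volume: at an interior maximum of
  the difference the subdifferentials are nested. So it suffices to perturb the solution into
  sub- and supersolutions.

  Far from the boundary, the nodal subdifferential of a quadratic polynomial is a translate of a
  cell cut out by the lattice. The translates of such a cell (in the metric of the quadratic form)
  tile the space, and so do the translates of a hat function, hence the volume of the cell is the
  determinant times the integral of the hat function. By Taylor's formula the solution is, in a ball of radius
  comparable to the mesh size, a quadratic polynomial up to a multiple of \<open>h powr \<alpha> * (dist x y)\<^sup>2\<close>, which
  is dominated by adding a multiple of \<open>h powr \<alpha>\<close> times a fixed quadratic.

  Near the boundary, the enclosing balls provide quadratic barriers vanishing at a given boundary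
  point, so that the error there is of order \<open>h\<close>. When the mesh size or the
  Hoelder seminorm times \<open>h powr \<alpha>\<close> is not small, a bound independent of the mesh suffices; from below it
  is Aleksandrov's estimate.
\<close>

section \<open>Volumes of lattice cells\<close>

definition discrete_subgroup :: "('a::real_normed_vector) set \<Rightarrow> bool" where
  "discrete_subgroup L \<longleftrightarrow> 0 \<in> L \<and> (\<forall>x\<in>L. \<forall>y\<in>L. x + y \<in> L) \<and> (\<forall>x\<in>L. - x \<in> L) \<and>
     (\<forall>r. finite (L \<inter> cball 0 r))"

lemma discrete_subgroupD:
  assumes "discrete_subgroup L"
  shows "0 \<in> L" "\<And>x y. x \<in> L \<Longrightarrow> y \<in> L \<Longrightarrow> x + y \<in> L" "\<And>x. x \<in> L \<Longrightarrow> - x \<in> L"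
    "\<And>x y. x \<in> L \<Longrightarrow> y \<in> L \<Longrightarrow> x - y \<in> L" "\<And>r. finite (L \<inter> cball 0 r)"
  using assms unfolding discrete_subgroup_def
  by (blast+, metis diff_conv_add_uminus, blast)

lemma countable_discrete_subgroup:
  assumes "discrete_subgroup L"
  shows "countable L"
proof -
  have "L = (\<Union>n::nat. L \<inter> cball 0 (real n))"
    using real_arch_simple by auto
  then show ?thesis
    using discrete_subgroupD(5)[OF assms] by (metis countable_UN countable_finite countableI_type)
qed

lemma nn_integral_lborel_translate:
  fixes F :: "'a::euclidean_space \<Rightarrow> ennreal"
  assumes "F \<in> borel_measurable borel"
  shows "(\<integral>\<^sup>+x. F (x + a) \<partial>lborel) = (\<integral>\<^sup>+x. F x \<partial>lborel)"
proof -
  have "(\<integral>\<^sup>+x. F x \<partial>lborel) = (\<integral>\<^sup>+x. F x \<partial>(distr lborel borel ((+) a)))"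
    by (simp add: lborel_distr_plus)
  also have "\<dots> = (\<integral>\<^sup>+x. F (a + x) \<partial>lborel)"
    using assms by (subst nn_integral_distr) auto
  finally show ?thesis by (simp add: add.commute)
qed

text \<open>Both integrals are compared with the lattice sum of the integrals of \<open>F x * G (x + l)\<close>, in
  which the sum over the lattice can be moved to either factor.\<close>
lemma packing_le_covering:
  fixes F G :: "'a::euclidean_space \<Rightarrow> ennreal"
  assumes L: "discrete_subgroup L"
    and F: "F \<in> borel_measurable borel" and G: "G \<in> borel_measurable borel"
    and packing: "\<And>x. (\<integral>\<^sup>+l. F (x + l) \<partial>count_space L) \<le> 1"
    and covering: "\<And>x. 1 \<le> (\<integral>\<^sup>+l. G (x + l) \<partial>count_space L)"
  shows "(\<integral>\<^sup>+x. F x \<partial>lborel) \<le> (\<integral>\<^sup>+x. G x \<partial>lborel)"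
proof -
  note cL = countable_discrete_subgroup[OF L]
  have "(\<integral>\<^sup>+x. F x \<partial>lborel) \<le> (\<integral>\<^sup>+x. F x * (\<integral>\<^sup>+l. G (x + l) \<partial>count_space L) \<partial>lborel)"
  proof (rule nn_integral_mono)
    fix x show "F x \<le> F x * (\<integral>\<^sup>+l. G (x + l) \<partial>count_space L)"
      using mult_left_mono[OF covering[of x], of "F x"] by simp
  qed
  also have "\<dots> = (\<integral>\<^sup>+x. (\<integral>\<^sup>+l. F x * G (x + l) \<partial>count_space L) \<partial>lborel)"
    by (simp add: nn_integral_cmult)
  also have "\<dots> = (\<integral>\<^sup>+l. (\<integral>\<^sup>+x. F x * G (x + l) \<partial>lborel) \<partial>count_space L)"
  proof (intro nn_integral_count_space_nn_integral cL)
    fix l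
    have "(\<lambda>x. F x * G (x + l)) \<in> borel_measurable borel" using F G by measurable
    then show "(\<lambda>x. F x * G (x + l)) \<in> borel_measurable lborel" by simp
  qed
  also have "\<dots> = (\<integral>\<^sup>+l. (\<integral>\<^sup>+x. F (x - l) * G x \<partial>lborel) \<partial>count_space L)"
  proof (rule nn_integral_cong)
    fix l
    have m: "(\<lambda>x. F (x - l) * G x) \<in> borel_measurable borel"
      using F G by measurable
    show "(\<integral>\<^sup>+x. F x * G (x + l) \<partial>lborel) = (\<integral>\<^sup>+x. F (x - l) * G x \<partial>lborel)"
      using nn_integral_lborel_translate[OF m, of l] by simp
  qed
  also have "\<dots> = (\<integral>\<^sup>+x. (\<integral>\<^sup>+l. F (x - l) * G x \<partial>count_space L) \<partial>lborel)"
  proof (intro nn_integral_count_space_nn_integral[symmetric] cL)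
    fix l
    have "(\<lambda>x. F (x - l) * G x) \<in> borel_measurable borel" using F G by measurable
    then show "(\<lambda>x. F (x - l) * G x) \<in> borel_measurable lborel" by simp
  qed
  also have "\<dots> = (\<integral>\<^sup>+x. (\<integral>\<^sup>+l. F (x - l) \<partial>count_space L) * G x \<partial>lborel)"
    by (simp add: nn_integral_multc)
  also have "\<dots> = (\<integral>\<^sup>+x. (\<integral>\<^sup>+l. F (x + l) \<partial>count_space L) * G x \<partial>lborel)"
  proof -
    have bij: "bij_betw uminus L L"
      by (rule bij_betwI[where g=uminus]) (use discrete_subgroupD[OF L] in auto)
    show ?thesis
      using nn_integral_bij_count_space[OF bij, of "\<lambda>l. F (_ + l)"] by simp
  qed
  also have "\<dots> \<le> (\<integral>\<^sup>+x. G x \<partial>lborel)"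
  proof (rule nn_integral_mono)
    fix x show "(\<integral>\<^sup>+l. F (x + l) \<partial>count_space L) * G x \<le> G x"
      using mult_right_mono[OF packing[of x], of "G x"] by simp
  qed
  finally show ?thesis .
qed

text \<open>The library states this for index types carrying a well-order; only the determinant of a
  shear used the order there.\<close>
lemma lmeasurable_linear_image_finite:
  fixes f :: "real^'n \<Rightarrow> real^'n"
  assumes "linear f" "S \<in> lmeasurable"
  shows "f ` S \<in> lmeasurable \<and> measure lebesgue (f ` S) = \<bar>det (matrix f)\<bar> * measure lebesgue S"
proof -
  have unimodular: "h ` T \<in> lmeasurable \<and> measure lebesgue (h ` T) = \<bar>det (matrix h)\<bar> * measure lebesgue T"
    if h: "linear h" "T \<in> lmeasurable" and im: "\<And>a b. measure lebesgue (h ` cbox a b) = measure lebesgue (cbox a b)"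
      and "\<bar>det (matrix h)\<bar> = 1" for h :: "real^'n \<Rightarrow> real^'n" and T
    using measure_linear_sufficient[OF h, of 1] im that(4) by simp
  have "\<forall>S\<in>lmeasurable. f ` S \<in> lmeasurable \<and>
      measure lebesgue (f ` S) = \<bar>det (matrix f)\<bar> * measure lebesgue S" (is "?P f")
  proof (rule induct_linear_elementary[OF \<open>linear f\<close>, where P = ?P])
    fix f g :: "real^'n \<Rightarrow> real^'n"
    assume "linear f" "linear g" "?P f" "?P g"
    then show "?P (f \<circ> g)"
      unfolding image_comp[symmetric] matrix_compose[OF \<open>linear g\<close> \<open>linear f\<close>]
      by (simp add: det_mul abs_mult)
  next
    fix f :: "real^'n \<Rightarrow> real^'n" and i
    assume lin: "linear f" and i: "\<And>x. f x $ i = 0"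
    have "\<not> surj f"
    proof
      assume "surj f"
      then obtain x where "f x = axis i 1" by (metis surjD)
      then show False using i[of x] by simp
    qed
    then have ni: "\<not> inj f" using lin linear_injective_imp_surjective by blast
    then have "det (matrix f) = 0" using det_nz_iff_inj[OF lin] by blast
    moreover have "negligible (f ` S)" for S
      using negligible_linear_singular_image[OF lin ni] .
    ultimately show "?P f"
      by (simp add: negligible_iff_measure)
  next
    fix c :: "'n \<Rightarrow> real"
    have "det (matrix (\<lambda>x::real^'n. \<chi> i. c i * x $ i)) = prod c UNIV"
      by (subst det_diagonal) (auto simp: matrix_def axis_def)
    then show "?P (\<lambda>x. \<chi> i. c i * x $ i)"
      by (simp add: measurable_stretch measure_stretch)
  next
    fix m n :: 'n assume "m \<noteq> n"
    let ?t = "Transposition.transpose m n"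
    let ?h = "\<lambda>x::real^'n. \<chi> i. x $ ?t i"
    have lin: "linear ?h" by (rule linearI) (simp_all add: vec_eq_iff)
    have "?h ` cbox a b = cbox (?h a) (?h b)" for a b
    proof -
      have "?h ` cbox a b = {x. ?h x \<in> cbox a b}"
        by (auto simp: image_iff vec_eq_iff intro!: exI[of _ "?h _"] bexI[of _ "?h _"])
      also have "\<dots> = cbox (?h a) (?h b)"
        by (auto simp: mem_box_cart) (metis transpose_involutory)+
      finally show ?thesis .
    qed
    moreover have "measure lebesgue (cbox (?h a) (?h b)) = measure lebesgue (cbox a b)" for a b
    proof -
      have "(\<forall>i. a $ ?t i \<le> b $ ?t i) \<longleftrightarrow> (\<forall>i. a $ i \<le> b $ i)"
        by (metis transpose_involutory)
      moreover have "(\<Prod>i\<in>UNIV. b $ ?t i - a $ ?t i) = (\<Prod>i\<in>UNIV. b $ i - a $ i)"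
        by (rule prod.reindex_bij_betw) (simp add: bij_transpose)
      ultimately show ?thesis
        by (simp add: content_cbox_if_cart interval_eq_empty_cart not_less[symmetric])
    qed
    moreover have "\<bar>det (matrix ?h)\<bar> = 1"
    proof -
      have "matrix ?h = (\<chi> i. (mat 1 :: real^'n^'n) $ ?t i)"
        by (auto simp: matrix_def mat_def axis_def vec_eq_iff)
      then show ?thesis
        by (simp add: det_permute_rows permutes_swap_id abs_mult flip: of_int_abs)
    qed
    ultimately show "?P ?h"
      by (intro ballI unimodular lin) simp_all
  next
    fix m n :: 'n assume mn: "m \<noteq> n"
    let ?h = "\<lambda>x::real^'n. \<chi> i. if i = m then x $ m + x $ n else x $ i"
    have lin: "linear ?h" by (rule linearI) (auto simp: vec_eq_iff algebra_simps)
    have "measure lebesgue (?h ` cbox a b) = measure lebesgue (cbox a b)" for a b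
    proof (cases "cbox a b = {}")
      case False
      then have ne: "cbox 0 (b - a) \<noteq> {}"
        by (simp add: interval_ne_empty_cart)
      have ab: "cbox a b = (+) a ` cbox 0 (b - a)"
        using cbox_translation[of a 0 "b - a"] by simp
      have "?h ` cbox a b = (+) (?h a) ` ?h ` cbox 0 (b - a)"
        unfolding ab image_image by (intro image_cong) (auto simp: vec_eq_iff)
      then have "measure lebesgue (?h ` cbox a b) = measure lebesgue (?h ` cbox 0 (b - a))"
        by (simp add: measure_translation)
      also have "\<dots> = measure lebesgue (cbox 0 (b - a))"
        by (rule measure_shear_interval[OF mn ne]) simp
      also have "\<dots> = measure lebesgue (cbox a b)"
        unfolding ab by (simp only: measure_translation)
      finally show ?thesis .
    qed simp
    moreover have "det (matrix ?h) = 1"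
    proof -
      have "matrix ?h = (\<chi> k. if k = m then row m (mat 1) + 1 *s row n (mat 1) else row k (mat 1))"
        by (auto simp: matrix_def mat_def axis_def row_def vec_eq_iff)
      then show ?thesis
        by (simp only: det_row_operation[OF mn] det_I)
    qed
    ultimately show "?P ?h"
      by (intro ballI unimodular lin) simp_all
  qed
  then show ?thesis using assms by blast
qed

lemmas measurable_linear_image_finite = lmeasurable_linear_image_finite[THEN conjunct1]
  and measure_linear_image_finite = lmeasurable_linear_image_finite[THEN conjunct2]

definition sym_matrix :: "real^'n^'n \<Rightarrow> bool" where
  "sym_matrix A \<longleftrightarrow> (\<forall>x y. x \<bullet> (A *v y) = y \<bullet> (A *v x))"

definition cell :: "(real^'n) set \<Rightarrow> real^'n^'n \<Rightarrow> (real^'n) set" where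
  "cell L A = {p. \<forall>l\<in>L. p \<bullet> l \<le> (l \<bullet> (A *v l)) / 2}"

definition open_cell :: "(real^'n) set \<Rightarrow> real^'n^'n \<Rightarrow> (real^'n) set" where
  "open_cell L A = {p. \<forall>l\<in>L - {0}. p \<bullet> l < (l \<bullet> (A *v l)) / 2}"

lemma quadratic_diff:
  fixes A :: "real^'n^'n"
  assumes "sym_matrix A"
  shows "(x - y) \<bullet> (A *v (x - y)) = x \<bullet> (A *v x) - 2 * ((A *v x) \<bullet> y) + y \<bullet> (A *v y)"
  using assms unfolding sym_matrix_def
  by (simp add: matrix_vector_mult_diff_distrib inner_diff_left inner_diff_right inner_commute algebra_simps)

lemma pos_def_inj:
  fixes A :: "real^'n^'n"
  assumes "0 < a" and "\<And>v. a * (v \<bullet> v) \<le> v \<bullet> (A *v v)"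
  shows "inj ((*v) A)"
proof (rule linear_injective_0[THEN iffD2, rule_format])
  fix x assume "A *v x = 0"
  then have "a * (x \<bullet> x) \<le> 0" using assms(2)[of x] by simp
  then show "x = 0" using assms(1) by (smt (verit) inner_gt_zero_iff mult_pos_pos)
qed simp

lemma pos_def_surj:
  fixes A :: "real^'n^'n"
  assumes "0 < a" and "\<And>v. a * (v \<bullet> v) \<le> v \<bullet> (A *v v)"
  shows "surj ((*v) A)"
  using linear_injective_imp_surjective[OF _ pos_def_inj[OF assms]] by simp

lemma continuous_on_matrix_vector_mult [continuous_intros]:
  fixes A :: "real^'n^'m"
  assumes "continuous_on S f"
  shows "continuous_on S (\<lambda>x. A *v f x)"
  using continuous_on_compose2[OF matrix_vector_mult_linear_continuous_on assms] by blast

lemma emeasure_open_cell_le: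
  fixes L :: "(real^'n) set" and A :: "real^'n^'n"
  assumes L: "discrete_subgroup L" and sym: "sym_matrix A"
    and a: "0 < a" "\<And>v. a * (v \<bullet> v) \<le> v \<bullet> (A *v v)"
    and G: "G \<in> borel_measurable borel"
    and covering: "\<And>x. 1 \<le> (\<integral>\<^sup>+l. G (x + l) \<partial>count_space L)"
    and fin: "(\<integral>\<^sup>+x. G x \<partial>lborel) < \<infinity>"
  shows "emeasure lebesgue (open_cell L A) \<le> ennreal \<bar>det A\<bar> * (\<integral>\<^sup>+x. G x \<partial>lborel)"
proof -
  define Q where "Q = (\<lambda>x. x \<bullet> (A *v x))"
  define V where "V = {q. \<forall>l\<in>L - {0}. Q q < Q (q - l)}"
  have Vset: "V = (\<Inter>l\<in>L - {0}. {q. Q q < Q (q - l)}) \<inter> UNIV" by (auto simp: V_def)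
  have contQ: "continuous_on UNIV Q" unfolding Q_def by (intro continuous_intros)
  have Vborel: "V \<in> sets borel"
  proof -
    have "open {q. Q q < Q (q - l)}" for l
      unfolding Q_def by (intro open_Collect_less continuous_intros)
    then have "(\<Inter>l\<in>L - {0}. {q. Q q < Q (q - l)}) \<in> sets borel"
      using countable_discrete_subgroup[OF L]
      by (intro sets.countable_INT'') (auto intro: borel_open)
    then show ?thesis unfolding Vset by simp
  qed
  have im: "open_cell L A = (*v) A ` V"
  proof -
    have "q \<in> V \<longleftrightarrow> A *v q \<in> open_cell L A" for q
      unfolding V_def open_cell_def Q_def by (auto simp: quadratic_diff[OF sym] field_simps)
    moreover have "surj ((*v) A)" using pos_def_surj[OF a] .
    ultimately show ?thesis by (auto simp: image_iff) (metis surjD)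
  qed
  have packing: "(\<integral>\<^sup>+l. indicator V (x + l) \<partial>count_space L) \<le> (1::ennreal)" for x
  proof (cases "\<exists>l0\<in>L. x + l0 \<in> V")
    case True
    then obtain l0 where l0: "l0 \<in> L" "x + l0 \<in> V" by auto
    have "l = l0" if "l \<in> L" "x + l \<in> V" for l
    proof (rule ccontr)
      assume "l \<noteq> l0"
      then have "l - l0 \<in> L - {0}" "l0 - l \<in> L - {0}"
        using discrete_subgroupD(4)[OF L] that l0 by auto
      then have "Q (x + l) < Q (x + l - (l - l0))" "Q (x + l0) < Q (x + l0 - (l0 - l))"
        using that(2) l0(2) unfolding V_def by blast+
      then show False by (simp add: algebra_simps)
    qed
    then have "l \<in> L \<Longrightarrow> l \<notin> {l0} \<Longrightarrow> indicator V (x + l) = (0::ennreal)" for l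
      by (metis indicator_simps(2) singletonI)
    then have "(\<integral>\<^sup>+l. indicator V (x + l) \<partial>count_space L) = (\<Sum>l\<in>{l0}. indicator V (x + l) :: ennreal)"
      using l0(1) by (intro nn_integral_count_space') simp_all
    also have "\<dots> \<le> 1" using l0(2) by simp
    finally show ?thesis .
  next
    case False
    then have "(\<integral>\<^sup>+l. indicator V (x + l) \<partial>count_space L) = (\<integral>\<^sup>+l. 0 \<partial>count_space L :: ennreal)"
      by (intro nn_integral_cong) (auto simp: indicator_def)
    then show ?thesis by simp
  qed
  have "(\<integral>\<^sup>+x. indicator V x \<partial>lborel) \<le> (\<integral>\<^sup>+x. G x \<partial>lborel)"
    using Vborel by (intro packing_le_covering[OF L _ G packing covering]) auto
  then have V: "emeasure lborel V \<le> (\<integral>\<^sup>+x. G x \<partial>lborel)"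
    using Vborel by simp
  have Vl: "emeasure lebesgue V = emeasure lborel V"
    using Vborel by simp
  have lm: "V \<in> lmeasurable"
    using V fin Vborel by (intro fmeasurableI) (auto simp: Vl)
  have lin: "linear ((*v) A)" by simp
  have "emeasure lebesgue (open_cell L A) = ennreal (measure lebesgue (open_cell L A))"
    unfolding im using measurable_linear_image_finite[OF lin lm]
    by (metis emeasure_eq_measure2)
  also have "\<dots> = ennreal (\<bar>det A\<bar> * measure lebesgue V)"
    unfolding im using measure_linear_image_finite[OF lin lm] by simp
  also have "\<dots> = ennreal \<bar>det A\<bar> * emeasure lebesgue V"
    using lm by (simp add: ennreal_mult emeasure_eq_measure2)
  also have "\<dots> \<le> ennreal \<bar>det A\<bar> * (\<integral>\<^sup>+x. G x \<partial>lborel)"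
    using V Vl by (intro mult_left_mono) auto
  finally show ?thesis .
qed

lemma cell_norm_bound:
  fixes L :: "(real^'n) set"
  assumes cover: "\<And>x. \<exists>l\<in>L. dist x l \<le> r" and r: "0 < r" and b: "0 \<le> b"
    and A: "\<And>v. v \<bullet> (A *v v) \<le> b * (v \<bullet> v)"
    and p: "\<And>l. l \<in> L \<Longrightarrow> norm l \<le> 3 * r \<Longrightarrow> p \<bullet> l \<le> (l \<bullet> (A *v l)) / 2"
  shows "norm p \<le> 9 / 2 * b * r"
proof (cases "p = 0")
  case True then show ?thesis using r b by simp
next
  case False
  define w where "w = (2 * r / norm p) *\<^sub>R p"
  obtain l where l: "l \<in> L" "dist w l \<le> r" using cover by blast
  have nw: "norm w = 2 * r" using False r by (simp add: w_def)
  have nl: "norm l \<le> 3 * r" using l(2) nw norm_triangle_ineq4[of w "w - l"] by (simp add: dist_norm)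
  have "norm p * r = p \<bullet> w - norm p * r"
    using False by (simp add: w_def dot_square_norm power2_eq_square)
  also have "\<dots> \<le> p \<bullet> w - norm p * norm (w - l)"
    using l(2) by (simp add: dist_norm mult_left_mono)
  also have "\<dots> \<le> p \<bullet> w - p \<bullet> (w - l)"
    using norm_cauchy_schwarz[of p "w - l"] by simp
  also have "\<dots> = p \<bullet> l" by (simp add: inner_diff_right)
  also have "\<dots> \<le> (l \<bullet> (A *v l)) / 2" using p l nl by blast
  also have "\<dots> \<le> b * (l \<bullet> l) / 2" using A by simp
  also have "\<dots> \<le> b * (3 * r)\<^sup>2 / 2"
    using nl b power_mono[of "norm l" "3 * r" 2]
    by (simp only: dot_square_norm) (intro divide_right_mono mult_left_mono, auto)
  also have "\<dots> = (9 / 2 * b * r) * r" by (simp add: power2_eq_square)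
  finally show ?thesis using r by simp
qed

lemma cell_local:
  fixes L :: "(real^'n) set"
  assumes cover: "\<And>x. \<exists>l\<in>L. dist x l \<le> r" and r: "0 < r" and a: "0 < a" "a \<le> b"
    and A: "\<And>v. a * (v \<bullet> v) \<le> v \<bullet> (A *v v)" "\<And>v. v \<bullet> (A *v v) \<le> b * (v \<bullet> v)"
    and p: "\<And>l. l \<in> L \<Longrightarrow> norm l \<le> 9 * b / a * r \<Longrightarrow> p \<bullet> l \<le> (l \<bullet> (A *v l)) / 2"
  shows "p \<in> cell L A"
proof -
  have "1 \<le> b / a" using a by simp
  then have "3 * r \<le> 9 * (b / a) * r" using r by (intro mult_right_mono) auto
  then have np: "norm p \<le> 9 / 2 * b * r"
    using a by (intro cell_norm_bound[OF cover r _ A(2)] p) auto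
  have "p \<bullet> l \<le> (l \<bullet> (A *v l)) / 2" if l: "l \<in> L" for l
  proof (cases "norm l \<le> 9 * b / a * r")
    case True then show ?thesis using p l by blast
  next
    case False
    then have "9 * b * r \<le> a * norm l" using a by (simp add: field_simps)
    then have "norm p \<le> a / 2 * norm l" using np by simp
    then have "p \<bullet> l \<le> a / 2 * norm l * norm l"
      using norm_cauchy_schwarz[of p l] by (meson dual_order.trans mult_right_mono norm_ge_zero)
    also have "\<dots> = a * (l \<bullet> l) / 2" by (simp add: dot_square_norm power2_eq_square)
    also have "\<dots> \<le> (l \<bullet> (A *v l)) / 2" using A(1) by simp
    finally show ?thesis .
  qed
  then show ?thesis by (simp add: cell_def)
qed

lemma emeasure_cell_ge:
  fixes L :: "(real^'n) set" and A :: "real^'n^'n"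
  assumes L: "discrete_subgroup L" and sym: "sym_matrix A"
    and cover: "\<And>x. \<exists>l\<in>L. dist x l \<le> r" and r: "0 < r"
    and a: "0 < a" "\<And>v. a * (v \<bullet> v) \<le> v \<bullet> (A *v v)"
    and b: "0 \<le> b" "\<And>v. v \<bullet> (A *v v) \<le> b * (v \<bullet> v)"
    and G: "G \<in> borel_measurable borel"
    and packing: "\<And>x. (\<integral>\<^sup>+l. G (x + l) \<partial>count_space L) \<le> 1"
  shows "ennreal \<bar>det A\<bar> * (\<integral>\<^sup>+x. G x \<partial>lborel) \<le> emeasure lebesgue (cell L A)"
proof -
  define Q where "Q = (\<lambda>x. x \<bullet> (A *v x))"
  define V where "V = {q. \<forall>l\<in>L. Q q \<le> Q (q - l)}"
  have V_cell: "q \<in> V \<longleftrightarrow> A *v q \<in> cell L A" for q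
    unfolding V_def cell_def Q_def by (auto simp: quadratic_diff[OF sym] field_simps)
  have im: "cell L A = (*v) A ` V"
    using V_cell pos_def_surj[OF a] by (auto simp: image_iff) (metis surjD)
  have closedV: "closed V"
  proof -
    have "V = (\<Inter>l\<in>L. {q. Q q \<le> Q (q - l)})" by (auto simp: V_def)
    then show ?thesis unfolding Q_def
      by (simp only:) (intro closed_INT ballI closed_Collect_le continuous_intros)
  qed
  have "norm q \<le> 9 / 2 * b * r / a" if "q \<in> V" for q
  proof -
    have "norm (A *v q) \<le> 9 / 2 * b * r"
      using that by (intro cell_norm_bound[OF cover r b]) (auto simp: V_cell cell_def)
    moreover have "a * (norm q * norm q) \<le> norm q * norm (A *v q)"
      using a(2)[of q] norm_cauchy_schwarz[of q "A *v q"] by (simp add: dot_square_norm power2_eq_square)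
    ultimately have "a * (norm q * norm q) \<le> norm q * (9 / 2 * b * r)"
      by (meson dual_order.trans mult_left_mono norm_ge_zero)
    then show ?thesis
      using a(1) r b(1) by (cases "norm q = 0") (auto simp: field_simps)
  qed
  then have "compact V" using closedV
    by (meson bounded_iff compact_eq_bounded_closed)
  then have lm: "V \<in> lmeasurable" by (rule lmeasurable_compact)
  have covering: "1 \<le> (\<integral>\<^sup>+l. indicator V (x + l) \<partial>count_space L)" for x
  proof -
    define S where "S = {l\<in>L. Q (x + l) \<le> Q x}"
    have "S \<subseteq> L \<inter> cball 0 (norm x + sqrt (Q x / a))"
    proof
      fix l assume l: "l \<in> S"
      then have "a * (norm (x + l))\<^sup>2 \<le> Q x"
        using a(2)[of "x + l"] by (auto simp: S_def Q_def dot_square_norm)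
      then have "(norm (x + l))\<^sup>2 \<le> Q x / a" using a(1) by (simp add: field_simps)
      then have "norm (x + l) \<le> sqrt (Q x / a)" by (rule real_le_rsqrt)
      then show "l \<in> L \<inter> cball 0 (norm x + sqrt (Q x / a))"
        using l norm_triangle_ineq4[of "x + l" x] by (auto simp: S_def)
    qed
    then have finS: "finite S" using discrete_subgroupD(5)[OF L] by (meson finite_subset)
    have 0: "0 \<in> S" using discrete_subgroupD(1)[OF L] by (simp add: S_def)
    obtain l where l: "l \<in> S" "\<And>l'. l' \<in> S \<Longrightarrow> Q (x + l) \<le> Q (x + l')"
      using ex_is_arg_min_if_finite[OF finS, of "\<lambda>l. Q (x + l)"] 0
      by (metis empty_iff is_arg_min_linorder)
    have min: "Q (x + l) \<le> Q (x + l')" if "l' \<in> L" for l'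
      using l 0 that by (cases "l' \<in> S") (force simp: S_def)+
    have "x + l \<in> V"
      unfolding V_def
    proof safe
      fix l' assume "l' \<in> L"
      then have "l - l' \<in> L" using l discrete_subgroupD(4)[OF L] by (auto simp: S_def)
      from min[OF this] show "Q (x + l) \<le> Q (x + l - l')" by (simp add: algebra_simps)
    qed
    moreover have "l \<in> L" using l by (simp add: S_def)
    ultimately show ?thesis
      using nn_integral_ge_point[of l L "\<lambda>l. indicator V (x + l)"] by simp
  qed
  have "(\<integral>\<^sup>+x. G x \<partial>lborel) \<le> (\<integral>\<^sup>+x. indicator V x \<partial>lborel)"
    using closedV by (intro packing_le_covering[OF L G _ packing covering]) auto
  then have V: "(\<integral>\<^sup>+x. G x \<partial>lborel) \<le> emeasure lebesgue V"
    using closedV by simp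
  have lin: "linear ((*v) A)" by simp
  have "ennreal \<bar>det A\<bar> * (\<integral>\<^sup>+x. G x \<partial>lborel) \<le> ennreal \<bar>det A\<bar> * emeasure lebesgue V"
    using V by (intro mult_left_mono) auto
  also have "\<dots> = ennreal (\<bar>det A\<bar> * measure lebesgue V)"
    using lm by (simp add: ennreal_mult emeasure_eq_measure2)
  also have "\<dots> = ennreal (measure lebesgue (cell L A))"
    unfolding im using measure_linear_image_finite[OF lin lm] by simp
  also have "\<dots> = emeasure lebesgue (cell L A)"
    unfolding im using measurable_linear_image_finite[OF lin lm]
    by (metis emeasure_eq_measure2)
  finally show ?thesis .
qed

definition lattice :: "real \<Rightarrow> ('n \<Rightarrow> real^'n) \<Rightarrow> (real^'n) set" where
  "lattice h e = {h *\<^sub>R (\<Sum>j\<in>UNIV. of_int (k j) *\<^sub>R e j) | k :: 'n \<Rightarrow> int. True}"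

lemma basis_expansion_bij:
  fixes e :: "'n \<Rightarrow> real^'n"
  assumes "inj e" "independent (range e)"
  defines "T \<equiv> \<lambda>x::real^'n. \<Sum>j\<in>UNIV. (x $ j) *\<^sub>R e j"
  shows "linear T" "inj T" "surj T"
proof -
  show lin: "linear T"
    unfolding T_def by (rule linearI) (simp_all add: scaleR_add_left sum.distrib scaleR_sum_right)
  show inj: "inj T"
  proof (rule linear_injective_0[OF lin, THEN iffD2, rule_format])
    fix x assume "T x = 0"
    then have "(\<Sum>v\<in>range e. (x $ inv e v) *\<^sub>R v) = 0"
      unfolding T_def using assms(1) by (simp add: sum.reindex)
    then have "x $ inv e v = 0" if "v \<in> range e" for v
      using independentD[OF assms(2), of "range e" "\<lambda>v. x $ inv e v" v] that by simp
    then show "x = 0" using assms(1) by (force simp: vec_eq_iff)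
  qed
  show "surj T" using linear_injective_imp_surjective[OF lin inj] by simp
qed

lemma finite_bounded_int_functions: "finite {k :: 'n::finite \<Rightarrow> int. \<forall>j. \<bar>k j\<bar> \<le> m}"
proof -
  have "{k :: 'n \<Rightarrow> int. \<forall>j. \<bar>k j\<bar> \<le> m} = PiE UNIV (\<lambda>_. {-m..m})"
    by (auto simp: PiE_def Pi_def abs_le_iff) (smt (verit))+
  then show ?thesis by (simp add: finite_PiE)
qed

lemma discrete_subgroup_lattice:
  fixes e :: "'n \<Rightarrow> real^'n"
  assumes h: "0 < h" and e: "inj e" "independent (range e)"
  shows "discrete_subgroup (lattice h e)"
  unfolding discrete_subgroup_def
proof (intro conjI ballI allI)
  show "0 \<in> lattice h e"
    unfolding lattice_def by (auto intro!: exI[of _ "\<lambda>_. 0"])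
next
  fix x y assume "x \<in> lattice h e" "y \<in> lattice h e"
  then obtain k l where "x = h *\<^sub>R (\<Sum>j\<in>UNIV. of_int (k j) *\<^sub>R e j)"
    "y = h *\<^sub>R (\<Sum>j\<in>UNIV. of_int (l j) *\<^sub>R e j)"
    unfolding lattice_def by blast
  then show "x + y \<in> lattice h e"
    unfolding lattice_def
    by (auto intro!: exI[of _ "\<lambda>j. k j + l j"] simp: scaleR_add_left sum.distrib scaleR_add_right)
next
  fix x assume "x \<in> lattice h e"
  then obtain k where "x = h *\<^sub>R (\<Sum>j\<in>UNIV. of_int (k j) *\<^sub>R e j)"
    unfolding lattice_def by blast
  then show "- x \<in> lattice h e"
    unfolding lattice_def by (auto intro!: exI[of _ "\<lambda>j. - k j"] simp: sum_negf)
next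
  fix r
  define T where "T = (\<lambda>x::real^'n. \<Sum>j\<in>UNIV. (x $ j) *\<^sub>R e j)"
  note T = basis_expansion_bij[OF e, folded T_def]
  obtain B where B: "B > 0" "\<And>x. B * norm x \<le> norm (T x)"
    using linear_inj_bounded_below_pos[OF T(1,2)] by (metis mult.commute)
  define m where "m = \<lceil>r / (h * B)\<rceil>"
  have "lattice h e \<inter> cball 0 r \<subseteq>
      (\<lambda>k. h *\<^sub>R (\<Sum>j\<in>UNIV. of_int (k j) *\<^sub>R e j)) ` {k. \<forall>j. \<bar>k j\<bar> \<le> m}"
  proof
    fix x assume "x \<in> lattice h e \<inter> cball 0 r"
    then have "x \<in> lattice h e" and x: "norm x \<le> r" by auto
    then obtain k where k: "x = h *\<^sub>R (\<Sum>j\<in>UNIV. of_int (k j) *\<^sub>R e j)"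
      unfolding lattice_def by blast
    have "\<bar>k j\<bar> \<le> m" for j
    proof -
      have "B * \<bar>of_int (k j)\<bar> \<le> B * norm ((\<chi> j. of_int (k j)) :: real^'n)"
        using component_le_norm_cart[of "(\<chi> j. of_int (k j)) :: real^'n" j] B(1) by simp
      also have "\<dots> \<le> norm (T (\<chi> j. of_int (k j)))" by (rule B)
      also have "\<dots> = norm x / h" using h by (simp add: T_def k)
      also have "\<dots> \<le> r / h" using x h by (simp add: divide_right_mono)
      finally have "of_int \<bar>k j\<bar> \<le> r / (h * B)" using B(1) h by (simp add: field_simps)
      then show ?thesis unfolding m_def by linarith
    qed
    then show "x \<in> (\<lambda>k. h *\<^sub>R (\<Sum>j\<in>UNIV. of_int (k j) *\<^sub>R e j)) ` {k. \<forall>j. \<bar>k j\<bar> \<le> m}"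
      using k by blast
  qed
  then show "finite (lattice h e \<inter> cball 0 r)"
    using finite_bounded_int_functions finite_surj by blast
qed

lemma lattice_covering_radius:
  fixes e :: "'n \<Rightarrow> real^'n"
  assumes h: "0 < h" and e: "inj e" "independent (range e)" "\<And>j. norm (e j) \<le> 1"
  shows "\<exists>l\<in>lattice h e. dist x l \<le> h * CARD('n)"
proof -
  define T where "T = (\<lambda>x::real^'n. \<Sum>j\<in>UNIV. (x $ j) *\<^sub>R e j)"
  note T = basis_expansion_bij[OF e(1,2), folded T_def]
  obtain c where c: "T c = x /\<^sub>R h" using T(3) by (metis surjD)
  define l where "l = h *\<^sub>R (\<Sum>j\<in>UNIV. of_int \<lfloor>c $ j\<rfloor> *\<^sub>R e j)"
  have "x = h *\<^sub>R T c" using c h by simp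
  then have "x - l = h *\<^sub>R (\<Sum>j\<in>UNIV. frac (c $ j) *\<^sub>R e j)"
    by (simp add: l_def T_def frac_def scaleR_diff_left sum_subtractf scaleR_diff_right)
  then have "dist x l = h * norm (\<Sum>j\<in>UNIV. frac (c $ j) *\<^sub>R e j)"
    using h by (simp add: dist_norm)
  also have "\<dots> \<le> h * (\<Sum>j\<in>(UNIV::'n set). 1)"
  proof (intro mult_left_mono order_trans[OF norm_sum] sum_mono)
    fix j
    have "\<bar>frac (c $ j)\<bar> * norm (e j) \<le> 1 * 1"
      using e(3)[of j] frac_lt_1[of "c $ j"] frac_ge_0[of "c $ j"] by (intro mult_mono) auto
    then show "norm (frac (c $ j) *\<^sub>R e j) \<le> 1" by simp
  qed (use h in auto)
  finally show ?thesis
    unfolding l_def lattice_def by auto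
qed

lemma axis_basis: "inj (\<lambda>j. axis j 1 :: real^'n)" "independent (range (\<lambda>j. axis j 1 :: real^'n))"
proof -
  show "inj (\<lambda>j. axis j 1 :: real^'n)" by (auto simp: inj_def axis_eq_axis)
  have "range (\<lambda>j. axis j 1 :: real^'n) = Basis" by (auto simp: Basis_vec_def)
  then show "independent (range (\<lambda>j. axis j 1 :: real^'n))"
    using independent_Basis by simp
qed

text \<open>Monotonicity of the determinant is read off from the volumes of the two cells.\<close>
lemma abs_det_mono:
  fixes A B :: "real^'n^'n"
  assumes sym: "sym_matrix A" "sym_matrix B"
    and a: "0 < a" "\<And>v. a * (v \<bullet> v) \<le> v \<bullet> (A *v v)"
    and less: "\<And>v. v \<noteq> 0 \<Longrightarrow> v \<bullet> (A *v v) < v \<bullet> (B *v v)"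
  shows "\<bar>det A\<bar> \<le> \<bar>det B\<bar>"
proof -
  define L where "L = lattice 1 (\<lambda>j. axis j 1 :: real^'n)"
  define C where "C = {x :: real^'n. \<forall>i. 0 \<le> x $ i \<and> x $ i < 1}"
  have L: "discrete_subgroup L"
    unfolding L_def by (rule discrete_subgroup_lattice[OF _ axis_basis]) simp
  have Leq: "x \<in> L \<longleftrightarrow> (\<forall>i. x $ i \<in> \<int>)" for x
  proof -
    have "x = (\<Sum>j\<in>UNIV. of_int (k j) *\<^sub>R axis j 1) \<longleftrightarrow> (\<forall>i. x $ i = of_int (k i))" for k
      by (auto simp: vec_eq_iff axis_def if_distrib cong: if_cong)
    then show ?thesis
      unfolding L_def lattice_def Ints_def by (auto simp: image_iff choice_iff)
  qed
  have cover: "\<exists>l\<in>L. dist x l \<le> CARD('n)" for x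
    using lattice_covering_radius[OF _ axis_basis, of 1] by (simp add: L_def)
  have C: "C \<in> sets borel"
  proof -
    have "C = (\<Inter>i. {x. 0 \<le> x $ i} \<inter> {x. x $ i < 1})" by (auto simp: C_def)
    moreover have "{x :: real^'n. 0 \<le> x $ i} \<inter> {x. x $ i < 1} \<in> sets borel" for i
      by (intro sets.Int borel_closed borel_open closed_Collect_le open_Collect_less continuous_intros)
    ultimately show ?thesis by (auto intro!: sets.countable_INT'')
  qed
  have tiling: "(\<integral>\<^sup>+l. indicator C (x + l) \<partial>count_space L) = (1::ennreal)" for x
  proof -
    define l0 :: "real^'n" where "l0 = (\<chi> i. - of_int \<lfloor>x $ i\<rfloor>)"
    have "l = l0" if "l \<in> L" "x + l \<in> C" for l
    proof -
      have "l $ i = l0 $ i" for i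
      proof -
        obtain m where m: "l $ i = of_int m" using \<open>l \<in> L\<close> by (auto simp: Leq Ints_def)
        have "0 \<le> x $ i + l $ i" "x $ i + l $ i < 1"
          using \<open>x + l \<in> C\<close> by (auto simp: C_def)
        then have "\<lfloor>x $ i\<rfloor> = - m" unfolding m by (intro floor_unique) auto
        then show ?thesis by (simp add: l0_def m)
      qed
      then show ?thesis by (simp add: vec_eq_iff)
    qed
    moreover have "l0 \<in> L" "x + l0 \<in> C"
      by (auto simp: Leq l0_def C_def) linarith
    ultimately have "l \<in> L \<Longrightarrow> l \<notin> {l0} \<Longrightarrow> indicator C (x + l) = (0::ennreal)" for l
      by (metis indicator_simps(2) singletonI)
    then have "(\<integral>\<^sup>+l. indicator C (x + l) \<partial>count_space L) = (\<Sum>l\<in>{l0}. indicator C (x + l) :: ennreal)"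
      using \<open>l0 \<in> L\<close> by (intro nn_integral_count_space') simp_all
    then show ?thesis using \<open>x + l0 \<in> C\<close> by simp
  qed
  have "C \<subseteq> cbox 0 1" "box 0 1 \<subseteq> C"
    by (auto simp: C_def mem_box_cart less_imp_le)
  then have "emeasure lborel C \<le> emeasure lborel (cbox (0::real^'n) 1)"
    "emeasure lborel (box (0::real^'n) 1) \<le> emeasure lborel C"
    using C by (auto intro!: emeasure_mono)
  moreover have "1 \<bullet> b = 1" if "b \<in> Basis" for b :: "real^'n"
    using that by (auto simp: Basis_vec_def inner_axis)
  then have "emeasure lborel (cbox (0::real^'n) 1) = 1" "emeasure lborel (box (0::real^'n) 1) = 1"
    by (simp_all add: emeasure_lborel_cbox_eq emeasure_lborel_box_eq)
  ultimately have V: "emeasure lborel C = 1" by (metis antisym)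
  have B: "a * (v \<bullet> v) \<le> v \<bullet> (B *v v)" for v
    using a(2)[of v] less[of v] by (cases "v = 0") auto
  obtain b where b: "0 < b" "\<And>v. norm (A *v v) \<le> norm v * b"
    using matrix_vector_mul_bounded_linear[of A] bounded_linear.pos_bounded by metis
  have Ab: "v \<bullet> (A *v v) \<le> b * (v \<bullet> v)" for v
    using norm_cauchy_schwarz[of v "A *v v"] mult_left_mono[OF b(2)[of v], of "norm v"]
    by (simp add: dot_square_norm power2_eq_square mult.commute mult.left_commute)
  have m: "(\<lambda>x. indicator C x) \<in> borel_measurable borel" using C by simp
  have "ennreal \<bar>det A\<bar> * (\<integral>\<^sup>+x. indicator C x \<partial>lborel) \<le> emeasure lebesgue (cell L A)"
    using b(1) by (intro emeasure_cell_ge[OF L sym(1) cover _ a _ Ab m]) (auto simp: tiling)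
  also have "\<dots> \<le> emeasure lebesgue (open_cell L B)"
  proof (rule emeasure_mono)
    show "cell L A \<subseteq> open_cell L B"
      using less by (fastforce simp: cell_def open_cell_def)
    have "open_cell L B = (\<Inter>l\<in>L - {0}. {p. l \<bullet> p < (l \<bullet> (B *v l)) / 2})"
      by (auto simp: open_cell_def inner_commute)
    moreover have "(\<Inter>l\<in>L - {0}. {p. l \<bullet> p < (l \<bullet> (B *v l)) / 2}) \<in> sets borel"
      using countable_discrete_subgroup[OF L]
      by (intro sets.countable_INT'') (auto intro: borel_open open_halfspace_lt)
    ultimately show "open_cell L B \<in> sets lebesgue" by simp
  qed
  also have "\<dots> \<le> ennreal \<bar>det B\<bar> * (\<integral>\<^sup>+x. indicator C x \<partial>lborel)"
    using V C by (intro emeasure_open_cell_le[OF L sym(2) a(1) B m]) (auto simp: tiling)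
  finally show ?thesis using V C by simp
qed

section \<open>Second-order Taylor expansion\<close>

lemma has_derivative_gradient:
  fixes u :: "real^'n \<Rightarrow> real"
  assumes "u differentiable (at x)"
  shows "(u has_derivative (\<lambda>v. gradient u x \<bullet> v)) (at x)"
proof -
  let ?D = "frechet_derivative u (at x)"
  have D: "(u has_derivative ?D) (at x)" using assms by (simp add: frechet_derivative_works)
  then have lin: "linear ?D" by (simp add: has_derivative_linear)
  have "?D v = gradient u x \<bullet> v" for v
  proof -
    have "?D v = ?D (\<Sum>i\<in>UNIV. v $ i *\<^sub>R axis i 1)"
      using basis_expansion[of v] by (simp add: scalar_mult_eq_scaleR)
    also have "\<dots> = (\<Sum>i\<in>UNIV. v $ i * ?D (axis i 1))"
      by (simp add: linear_sum[OF lin] linear_cmul[OF lin])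
    also have "\<dots> = gradient u x \<bullet> v"
      by (simp add: gradient_def inner_vec_def mult.commute)
    finally show ?thesis .
  qed
  then have "?D = (\<lambda>v. gradient u x \<bullet> v)" by (rule ext)
  then show ?thesis using D by simp
qed

lemma gradient_has_derivative_hessian:
  fixes u :: "real^'n \<Rightarrow> real"
  assumes "gradient u differentiable (at x)"
  shows "(gradient u has_derivative (\<lambda>v. hessian u x *v v)) (at x)"
proof -
  have D: "(gradient u has_derivative frechet_derivative (gradient u) (at x)) (at x)"
    using assms by (simp add: frechet_derivative_works)
  then have "hessian u x *v v = frechet_derivative (gradient u) (at x) v" for v
    unfolding hessian_def by (metis has_derivative_linear matrix_vector_mul(2))
  then show ?thesis using D by simp
qed

text \<open>The second difference, divided by the square of the step, converges to the mixed derivative;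
  it is symmetric in the two directions.\<close>
lemma second_difference_hessian:
  fixes u :: "real^'n \<Rightarrow> real"
  assumes S: "open S" "x \<in> S" and u: "\<And>y. y \<in> S \<Longrightarrow> u differentiable (at y)"
    and g: "gradient u differentiable (at x)" and eps: "0 < \<epsilon>"
  shows "\<exists>\<delta>>0. \<forall>s. 0 < s \<and> s < \<delta> \<longrightarrow>
    \<bar>(u (x + s *\<^sub>R a + s *\<^sub>R b) - u (x + s *\<^sub>R a) - (u (x + s *\<^sub>R b) - u x)) - s\<^sup>2 * (a \<bullet> (hessian u x *v b))\<bar>
      \<le> \<epsilon> * s\<^sup>2 * (2 * (norm a + norm b)\<^sup>2)"
proof -
  let ?H = "hessian u x"
  obtain d1 where d1: "d1 > 0" "\<And>w. norm w < d1 \<Longrightarrow> x + w \<in> S"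
    using S by (metis add_diff_cancel_left' dist_norm open_dist dist_commute)
  obtain d2 where d2: "d2 > 0"
    "\<And>w. norm w < d2 \<Longrightarrow> norm (gradient u (x + w) - gradient u x - ?H *v w) \<le> \<epsilon> * norm w"
  proof -
    have "\<exists>d>0. \<forall>y. norm (y - x) < d \<longrightarrow> norm (gradient u y - gradient u x - ?H *v (y - x)) \<le> \<epsilon> * norm (y - x)"
      using gradient_has_derivative_hessian[OF g] eps unfolding has_derivative_at_alt by blast
    then obtain d where "d > 0" "\<And>y. norm (y - x) < d \<Longrightarrow> norm (gradient u y - gradient u x - ?H *v (y - x)) \<le> \<epsilon> * norm (y - x)"
      by blast
    then show ?thesis using that[of d] by (metis add_diff_cancel_left')
  qed
  define N where "N = norm a + norm b"
  define \<delta> where "\<delta> = min d1 d2 / (N + 1)"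
  have N: "0 \<le> N" by (simp add: N_def)
  have "\<delta> > 0" using d1 d2 N by (simp add: \<delta>_def)
  moreover have "\<bar>(u (x + s *\<^sub>R a + s *\<^sub>R b) - u (x + s *\<^sub>R a) - (u (x + s *\<^sub>R b) - u x)) - s\<^sup>2 * (a \<bullet> (?H *v b))\<bar>
      \<le> \<epsilon> * s\<^sup>2 * (2 * N\<^sup>2)" if s: "0 < s" "s < \<delta>" for s
  proof -
    have small: "norm (\<theta> *\<^sub>R a + c *\<^sub>R b) \<le> s * N" "norm (\<theta> *\<^sub>R a + c *\<^sub>R b) < min d1 d2"
      if "0 \<le> \<theta>" "\<theta> \<le> s" "0 \<le> c" "c \<le> s" for \<theta> c
    proof -
      have "norm (\<theta> *\<^sub>R a + c *\<^sub>R b) \<le> \<theta> * norm a + c * norm b"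
        using norm_triangle_ineq[of "\<theta> *\<^sub>R a" "c *\<^sub>R b"] that by simp
      also have "\<dots> \<le> s * N" unfolding N_def distrib_left
        using that by (intro add_mono mult_right_mono) auto
      finally show "norm (\<theta> *\<^sub>R a + c *\<^sub>R b) \<le> s * N" .
      also have "\<dots> \<le> s * (N + 1)" using s by simp
      also have "\<dots> < \<delta> * (N + 1)" using s N by (intro mult_strict_right_mono) auto
      also have "\<dots> = min d1 d2" using N by (simp add: \<delta>_def)
      finally show "norm (\<theta> *\<^sub>R a + c *\<^sub>R b) < min d1 d2" .
    qed
    define \<psi> where "\<psi> = (\<lambda>\<theta>. u (x + \<theta> *\<^sub>R a + s *\<^sub>R b) - u (x + \<theta> *\<^sub>R a))"
    define \<psi>' where "\<psi>' = (\<lambda>\<theta>. gradient u (x + \<theta> *\<^sub>R a + s *\<^sub>R b) \<bullet> a - gradient u (x + \<theta> *\<^sub>R a) \<bullet> a)"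
    have dv: "(\<psi> has_derivative (\<lambda>t. t * \<psi>' \<theta>)) (at \<theta>)" if "0 \<le> \<theta>" "\<theta> \<le> s" for \<theta>
    proof -
      have 1: "x + \<theta> *\<^sub>R a + s *\<^sub>R b \<in> S" "x + \<theta> *\<^sub>R a \<in> S"
        using small(2)[of \<theta> s] small(2)[of \<theta> 0] that s d1(2)[of "\<theta> *\<^sub>R a + s *\<^sub>R b"] d1(2)[of "\<theta> *\<^sub>R a"]
        by (auto simp: add.assoc)
      have "((\<lambda>\<theta>. u (x + \<theta> *\<^sub>R a + s *\<^sub>R b)) has_derivative (\<lambda>t. gradient u (x + \<theta> *\<^sub>R a + s *\<^sub>R b) \<bullet> (t *\<^sub>R a))) (at \<theta>)"
        by (rule has_derivative_compose[where g = u and f = "\<lambda>\<theta>. x + \<theta> *\<^sub>R a + s *\<^sub>R b", OF _ has_derivative_gradient[OF u[OF 1(1)]]])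
           (auto intro!: derivative_eq_intros)
      moreover have "((\<lambda>\<theta>. u (x + \<theta> *\<^sub>R a)) has_derivative (\<lambda>t. gradient u (x + \<theta> *\<^sub>R a) \<bullet> (t *\<^sub>R a))) (at \<theta>)"
        by (rule has_derivative_compose[where g = u and f = "\<lambda>\<theta>. x + \<theta> *\<^sub>R a", OF _ has_derivative_gradient[OF u[OF 1(2)]]])
           (auto intro!: derivative_eq_intros)
      ultimately have "(\<psi> has_derivative (\<lambda>t. gradient u (x + \<theta> *\<^sub>R a + s *\<^sub>R b) \<bullet> (t *\<^sub>R a) - gradient u (x + \<theta> *\<^sub>R a) \<bullet> (t *\<^sub>R a))) (at \<theta>)"
        unfolding \<psi>_def by (rule has_derivative_diff)
      then show ?thesis by (simp add: \<psi>'_def right_diff_distrib)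
    qed
    obtain \<theta> where th: "0 < \<theta>" "\<theta> < s" "\<psi> s - \<psi> 0 = (s - 0) * \<psi>' \<theta>"
    proof -
      have "\<exists>\<theta>. 0 < \<theta> \<and> \<theta> < s \<and> \<psi> s - \<psi> 0 = (s - 0) * \<psi>' \<theta>"
      proof (rule MVT2[OF s(1)])
        fix t assume "0 \<le> t" "t \<le> s"
        then show "(\<psi> has_real_derivative \<psi>' t) (at t)"
          using dv[of t] by (simp add: has_field_derivative_def mult_commute_abs)
      qed
      then show ?thesis using that by blast
    qed
    let ?w1 = "\<theta> *\<^sub>R a + s *\<^sub>R b" and ?w2 = "\<theta> *\<^sub>R a"
    have n1: "norm (gradient u (x + ?w1) - gradient u x - ?H *v ?w1) \<le> \<epsilon> * (s * N)"
      using d2(2)[of ?w1] small[of \<theta> s] th s eps by (smt (verit) mult_left_mono)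
    have n2: "norm (gradient u (x + ?w2) - gradient u x - ?H *v ?w2) \<le> \<epsilon> * (s * N)"
      using d2(2)[of ?w2] small[of \<theta> 0] th s eps by (smt (verit) mult_left_mono add.right_neutral scaleR_zero_left)
    define r1 where "r1 = gradient u (x + ?w1) - gradient u x - ?H *v ?w1"
    define r2 where "r2 = gradient u (x + ?w2) - gradient u x - ?H *v ?w2"
    have "\<psi>' \<theta> - s * (a \<bullet> (?H *v b)) = (r1 - r2) \<bullet> a"
      by (simp add: \<psi>'_def r1_def r2_def inner_diff_left inner_diff_right inner_add_left add.assoc
          matrix_vector_right_distrib inner_commute[of a] matrix_vector_mult_scaleR)
    then have "\<bar>\<psi>' \<theta> - s * (a \<bullet> (?H *v b))\<bar> \<le> norm (r1 - r2) * norm a"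
      by (metis Cauchy_Schwarz_ineq2)
    also have "\<dots> \<le> (2 * (\<epsilon> * (s * N))) * N"
      using n1 n2 norm_triangle_ineq4[of r1 r2] N eps s
      by (intro mult_mono) (auto simp: r1_def r2_def N_def)
    finally have "s * \<bar>\<psi>' \<theta> - s * (a \<bullet> (?H *v b))\<bar> \<le> s * ((2 * (\<epsilon> * (s * N))) * N)"
      using s by simp
    also have "s * \<bar>\<psi>' \<theta> - s * (a \<bullet> (?H *v b))\<bar> = \<bar>(\<psi> s - \<psi> 0) - s\<^sup>2 * (a \<bullet> (?H *v b))\<bar>"
      using th s by (simp add: abs_mult_pos' power2_eq_square right_diff_distrib mult.assoc)
    finally show ?thesis
      by (simp add: \<psi>_def power2_eq_square algebra_simps)
  qed
  ultimately show ?thesis unfolding N_def by blast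
qed

lemma hessian_symmetric:
  fixes u :: "real^'n \<Rightarrow> real"
  assumes "open S" "x \<in> S" "\<And>y. y \<in> S \<Longrightarrow> u differentiable (at y)"
    and "gradient u differentiable (at x)"
  shows "a \<bullet> (hessian u x *v b) = b \<bullet> (hessian u x *v a)"
proof (rule ccontr)
  let ?H = "hessian u x" and ?N = "2 * (norm a + norm b)\<^sup>2"
  assume "a \<bullet> (?H *v b) \<noteq> b \<bullet> (?H *v a)"
  then have D: "0 < \<bar>a \<bullet> (?H *v b) - b \<bullet> (?H *v a)\<bar>" by simp
  define \<epsilon> where "\<epsilon> = \<bar>a \<bullet> (?H *v b) - b \<bullet> (?H *v a)\<bar> / (2 * ?N + 1)"
  have eps: "0 < \<epsilon>" unfolding \<epsilon>_def using D by (intro divide_pos_pos) (auto intro: add_nonneg_pos)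
  obtain d1 where d1: "d1 > 0" "\<And>s. 0 < s \<Longrightarrow> s < d1 \<Longrightarrow>
    \<bar>(u (x + s *\<^sub>R a + s *\<^sub>R b) - u (x + s *\<^sub>R a) - (u (x + s *\<^sub>R b) - u x)) - s\<^sup>2 * (a \<bullet> (?H *v b))\<bar>
      \<le> \<epsilon> * s\<^sup>2 * (2 * (norm a + norm b)\<^sup>2)"
    using second_difference_hessian[OF assms eps, of a b] by blast
  obtain d2 where d2: "d2 > 0" "\<And>s. 0 < s \<Longrightarrow> s < d2 \<Longrightarrow>
    \<bar>(u (x + s *\<^sub>R b + s *\<^sub>R a) - u (x + s *\<^sub>R b) - (u (x + s *\<^sub>R a) - u x)) - s\<^sup>2 * (b \<bullet> (?H *v a))\<bar>
      \<le> \<epsilon> * s\<^sup>2 * (2 * (norm b + norm a)\<^sup>2)"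
    using second_difference_hessian[OF assms eps, of b a] by blast
  define s where "s = min d1 d2 / 2"
  have s: "0 < s" "s < d1" "s < d2" using d1(1) d2(1) by (auto simp: s_def)
  have "\<bar>s\<^sup>2 * (a \<bullet> (?H *v b)) - s\<^sup>2 * (b \<bullet> (?H *v a))\<bar> \<le> 2 * (\<epsilon> * s\<^sup>2 * ?N)"
  proof -
    have "x + s *\<^sub>R b + s *\<^sub>R a = x + s *\<^sub>R a + s *\<^sub>R b" "norm b + norm a = norm a + norm b"
      by (simp_all add: add_ac)
    note d2' = d2(2)[OF s(1,3), unfolded this]
    show ?thesis using d1(2)[OF s(1,2)] d2' by linarith
  qed
  moreover have "\<bar>s\<^sup>2 * (a \<bullet> (?H *v b)) - s\<^sup>2 * (b \<bullet> (?H *v a))\<bar> = s\<^sup>2 * \<bar>a \<bullet> (?H *v b) - b \<bullet> (?H *v a)\<bar>"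
    by (simp only: right_diff_distrib[symmetric] abs_mult abs_power2)
  moreover have "2 * (\<epsilon> * s\<^sup>2 * ?N) = s\<^sup>2 * (\<epsilon> * (2 * ?N))" by (simp only: mult_ac)
  ultimately have "s\<^sup>2 * \<bar>a \<bullet> (?H *v b) - b \<bullet> (?H *v a)\<bar> \<le> s\<^sup>2 * (\<epsilon> * (2 * ?N))"
    by linarith
  then have "\<bar>a \<bullet> (?H *v b) - b \<bullet> (?H *v a)\<bar> \<le> \<epsilon> * (2 * ?N)"
    using s(1) by simp
  also have "\<dots> < \<epsilon> * (2 * ?N + 1)" using eps by simp
  also have "\<dots> = \<bar>a \<bullet> (?H *v b) - b \<bullet> (?H *v a)\<bar>"
    unfolding \<epsilon>_def by (simp add: add_nonneg_eq_0_iff)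
  finally show False by simp
qed

lemma taylor_segment:
  fixes u :: "real^'n \<Rightarrow> real"
  assumes S: "open S" "convex S" "x \<in> S" "y \<in> S"
    and u: "\<And>z. z \<in> S \<Longrightarrow> u differentiable (at z)" "\<And>z. z \<in> S \<Longrightarrow> gradient u differentiable (at z)"
  shows "\<exists>t. 0 < t \<and> t < 1 \<and> u y = u x + gradient u x \<bullet> (y - x) +
    ((y - x) \<bullet> (hessian u (x + t *\<^sub>R (y - x)) *v (y - x))) / 2"
proof -
  define p where "p = (\<lambda>t. x + t *\<^sub>R (y - x))"
  define diff where "diff = (\<lambda>m::nat. if m = 0 then (\<lambda>t. u (p t))
    else if m = 1 then (\<lambda>t. gradient u (p t) \<bullet> (y - x))
    else (\<lambda>t. (y - x) \<bullet> (hessian u (p t) *v (y - x))))"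
  have pS: "p t \<in> S" if "0 \<le> t" "t \<le> 1" for t
  proof -
    have "p t = (1 - t) *\<^sub>R x + t *\<^sub>R y" by (simp add: p_def algebra_simps)
    then show ?thesis using convexD_alt[OF S(2,3,4) that] by simp
  qed
  have dp: "(p has_derivative (\<lambda>s. s *\<^sub>R (y - x))) (at t)" for t
    unfolding p_def by (auto intro!: derivative_eq_intros)
  have "\<exists>t. 0 < t \<and> t < 1 \<and> u (p 1) = (\<Sum>m<2. (diff m 0 / fact m) * 1 ^ m) + (diff 2 t / fact 2) * 1 ^ 2"
  proof (rule Maclaurin)
    show "diff 0 = (\<lambda>t. u (p t))" by (simp add: diff_def)
    show "\<forall>m t. m < 2 \<and> 0 \<le> t \<and> t \<le> 1 \<longrightarrow> (diff m has_real_derivative diff (Suc m) t) (at t)"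
    proof (intro allI impI, elim conjE)
      fix m :: nat and t :: real assume m: "m < 2" and t: "0 \<le> t" "t \<le> 1"
      have 1: "((\<lambda>t. u (p t)) has_derivative (\<lambda>s. gradient u (p t) \<bullet> (s *\<^sub>R (y - x)))) (at t)"
        by (rule has_derivative_compose[where g = u, OF dp has_derivative_gradient[OF u(1)[OF pS[OF t]]]])
      have 2: "((\<lambda>t. gradient u (p t)) has_derivative (\<lambda>s. hessian u (p t) *v (s *\<^sub>R (y - x)))) (at t)"
        by (rule has_derivative_compose[where g = "gradient u", OF dp gradient_has_derivative_hessian[OF u(2)[OF pS[OF t]]]])
      have 3: "((\<lambda>t. gradient u (p t) \<bullet> (y - x)) has_derivative (\<lambda>s. (hessian u (p t) *v (s *\<^sub>R (y - x))) \<bullet> (y - x))) (at t)"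
        by (rule has_derivative_inner_left[OF 2])
      consider "m = 0" | "m = 1" using m by linarith
      then show "(diff m has_real_derivative diff (Suc m) t) (at t)"
      proof cases
        case 1 then show ?thesis using \<open>((\<lambda>t. u (p t)) has_derivative _) _\<close>
          by (simp add: diff_def has_field_derivative_def mult_commute_abs)
      next
        case 2 then show ?thesis using 3
          by (simp add: diff_def has_field_derivative_def mult_commute_abs matrix_vector_mult_scaleR inner_commute)
      qed
    qed
  qed auto
  then obtain t where "0 < t" "t < 1" "u (p 1) = (\<Sum>m<2. diff m 0 / fact m) + diff 2 t / 2"
    by auto
  then show ?thesis
    by (intro exI[of _ t]) (simp add: diff_def p_def lessThan_nat_numeral eval_nat_numeral)
qed

lemma taylor_closure:
  fixes u :: "real^'n \<Rightarrow> real"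
  assumes S: "open S" "convex S" "x \<in> S" "y \<in> closure S"
    and u: "\<And>z. z \<in> S \<Longrightarrow> u differentiable (at z)" "\<And>z. z \<in> S \<Longrightarrow> gradient u differentiable (at z)"
    and c: "continuous_on (closure S) u"
  shows "(\<And>t. 0 < t \<Longrightarrow> t < 1 \<Longrightarrow> (y - x) \<bullet> (hessian u (x + t *\<^sub>R (y - x)) *v (y - x)) \<le> c) \<Longrightarrow>
      u y \<le> u x + gradient u x \<bullet> (y - x) + c / 2"
    and "(\<And>t. 0 < t \<Longrightarrow> t < 1 \<Longrightarrow> c \<le> (y - x) \<bullet> (hessian u (x + t *\<^sub>R (y - x)) *v (y - x))) \<Longrightarrow>
      u x + gradient u x \<bullet> (y - x) + c / 2 \<le> u y"
proof -
  define s where "s = (\<lambda>n. 1 - inverse (real (Suc n)))"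
  have s: "0 \<le> s n" "s n < 1" for n by (auto simp: s_def field_simps)
  have slim: "s \<longlonglongrightarrow> 1"
    unfolding s_def by (rule tendsto_eq_intros LIMSEQ_inverse_real_of_nat refl | simp)+
  define p where "p = (\<lambda>n. x + s n *\<^sub>R (y - x))"
  have pS: "p n \<in> S" for n
  proof (cases "s n = 0")
    case True then show ?thesis using S by (simp add: p_def)
  next
    case False
    then have "y - (1 - s n) *\<^sub>R (y - x) \<in> interior S"
      using mem_interior_closure_convex_shrink[OF S(2) _ S(4), of x "1 - s n"] S s[of n]
      by (simp add: interior_open less_le)
    then show ?thesis using S(1) by (simp add: p_def interior_open algebra_simps)
  qed
  have plim: "p \<longlonglongrightarrow> y"
    unfolding p_def by (rule tendsto_eq_intros slim refl | simp)+
  have ulim: "(\<lambda>n. u (p n)) \<longlonglongrightarrow> u y"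
  proof (rule continuous_on_tendsto_compose[OF c plim S(4)])
    show "\<forall>\<^sub>F n in sequentially. p n \<in> closure S"
      using pS closure_subset by (intro always_eventually) blast
  qed
  have rlim: "(\<lambda>n. u x + s n * (gradient u x \<bullet> (y - x)) + (s n)\<^sup>2 * c / 2) \<longlonglongrightarrow> u x + gradient u x \<bullet> (y - x) + c / 2" for c
    by (rule tendsto_eq_intros slim refl | simp)+
  have ex: "\<exists>t. 0 < t \<and> t < 1 \<and> u (p n) = u x + s n * (gradient u x \<bullet> (y - x)) +
     (s n)\<^sup>2 * ((y - x) \<bullet> (hessian u (x + t *\<^sub>R (y - x)) *v (y - x))) / 2" for n
  proof (cases "s n = 0")
    case True then show ?thesis by (intro exI[of _ "1/2"]) (simp add: p_def)
  next
    case False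
    obtain t where t: "0 < t" "t < 1" "u (p n) = u x + gradient u x \<bullet> (p n - x) +
       ((p n - x) \<bullet> (hessian u (x + t *\<^sub>R (p n - x)) *v (p n - x))) / 2"
      using taylor_segment[OF S(1,2,3) pS u, of n] by blast
    have "0 < t * s n" "t * s n < 1"
    proof -
      have "0 < s n" using s[of n] False by linarith
      then show "0 < t * s n" using t by simp
      show "t * s n < 1" using mult_strict_mono'[of t 1 "s n" 1] t s[of n] by simp
    qed
    moreover have "u (p n) = u x + s n * (gradient u x \<bullet> (y - x)) +
       (s n)\<^sup>2 * ((y - x) \<bullet> (hessian u (x + (t * s n) *\<^sub>R (y - x)) *v (y - x))) / 2"
    proof -
      have "p n - x = s n *\<^sub>R (y - x)" by (simp add: p_def)
      then show ?thesis
        using t(3) by (simp only: scaleR_scaleR matrix_vector_mult_scaleR inner_scaleR_left inner_scaleR_right power2_eq_square mult.assoc)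
    qed
    ultimately show ?thesis by blast
  qed
  show "u y \<le> u x + gradient u x \<bullet> (y - x) + c / 2"
    if "\<And>t. 0 < t \<Longrightarrow> t < 1 \<Longrightarrow> (y - x) \<bullet> (hessian u (x + t *\<^sub>R (y - x)) *v (y - x)) \<le> c"
  proof (rule tendsto_le[OF _ rlim ulim])
    show "\<forall>\<^sub>F n in sequentially. u (p n) \<le> u x + s n * (gradient u x \<bullet> (y - x)) + (s n)\<^sup>2 * c / 2"
    proof (intro always_eventually allI)
      fix n
      obtain t where "0 < t" "t < 1" "u (p n) = u x + s n * (gradient u x \<bullet> (y - x)) +
         (s n)\<^sup>2 * ((y - x) \<bullet> (hessian u (x + t *\<^sub>R (y - x)) *v (y - x))) / 2" using ex by blast
      with that[of t] mult_left_mono[OF that[of t], of "(s n)\<^sup>2"]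
      show "u (p n) \<le> u x + s n * (gradient u x \<bullet> (y - x)) + (s n)\<^sup>2 * c / 2" by simp
    qed
  qed simp
  show "u x + gradient u x \<bullet> (y - x) + c / 2 \<le> u y"
    if "\<And>t. 0 < t \<Longrightarrow> t < 1 \<Longrightarrow> c \<le> (y - x) \<bullet> (hessian u (x + t *\<^sub>R (y - x)) *v (y - x))"
  proof (rule tendsto_le[OF _ ulim rlim])
    show "\<forall>\<^sub>F n in sequentially. u x + s n * (gradient u x \<bullet> (y - x)) + (s n)\<^sup>2 * c / 2 \<le> u (p n)"
    proof (intro always_eventually allI)
      fix n
      obtain t where "0 < t" "t < 1" "u (p n) = u x + s n * (gradient u x \<bullet> (y - x)) +
         (s n)\<^sup>2 * ((y - x) \<bullet> (hessian u (x + t *\<^sub>R (y - x)) *v (y - x))) / 2" using ex by blast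
      with that[of t] mult_left_mono[OF that[of t], of "(s n)\<^sup>2"]
      show "u x + s n * (gradient u x \<bullet> (y - x)) + (s n)\<^sup>2 * c / 2 \<le> u (p n)" by simp
    qed
  qed simp
qed

section \<open>Hat functions on a lattice mesh\<close>

lemma affine_fun_sum:
  fixes f :: "real^'n \<Rightarrow> real"
  assumes "affine_fun f" "sum t C = 1"
  shows "f (\<Sum>v\<in>C. t v *\<^sub>R v) = (\<Sum>v\<in>C. t v * f v)"
proof -
  obtain a b where ab: "\<And>x. f x = a \<bullet> x + b" using assms(1) unfolding affine_fun_def by blast
  show ?thesis
    using assms(2) by (simp add: ab inner_sum_right distrib_left sum.distrib flip: sum_distrib_right)
qed

locale lattice_mesh =
  fixes \<Omega> :: "(real^'n) set" and N0 Nb L :: "(real^'n) set" and \<T> :: "(real^'n) set set"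
    and h \<gamma> \<sigma> :: real and \<phi> :: "real^'n \<Rightarrow> real^'n \<Rightarrow> real"
  assumes open_Omega: "open \<Omega>" and convex_Omega: "convex \<Omega>" and bounded_Omega: "bounded \<Omega>"
    and h_pos: "0 < h" and gamma_pos: "0 < \<gamma>"
    and mesh: "simplicial_mesh \<Omega> N0 Nb \<T>"
    and quasi_unif: "quasi_uniform \<gamma> h N0 \<T>"
    and shape_reg: "shape_regular \<sigma> \<T>"
    and subgroup_L: "discrete_subgroup L"
    and cover_L: "\<And>x. \<exists>l\<in>L. dist x l \<le> h * CARD('n)"
    and N0_eq: "N0 = L \<inter> \<Omega>"
    and hats: "translation_invariant_hat_basis h N0 Nb \<T> \<phi>"
begin

abbreviation vert :: "(real^'n) set \<Rightarrow> (real^'n) set" where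
  "vert T \<equiv> {x. x extreme_point_of T}"

lemma finite_T: "finite \<T>" and simplex_T: "T \<in> \<T> \<Longrightarrow> int CARD('n) simplex T"
  and finite_N: "finite (N0 \<union> Nb)" and N0_sub: "N0 \<subseteq> \<Omega>" and Nb_sub: "Nb \<subseteq> frontier \<Omega>"
  and T_sub: "\<Union>\<T> \<subseteq> closure \<Omega>" and vert_N: "(\<Union>T\<in>\<T>. vert T) = N0 \<union> Nb"
  using mesh unfolding simplicial_mesh_def triangulation_def by auto

lemma compact_T: "T \<in> \<T> \<Longrightarrow> compact T" and convex_T: "T \<in> \<T> \<Longrightarrow> convex T"
  using simplex_T compact_simplex convex_simplex by blast+

lemma compact_UnT: "compact (\<Union>\<T>)"
  using finite_T compact_T by blast

lemma vert_T:
  assumes "T \<in> \<T>"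
  shows "finite (vert T)" "T = convex hull (vert T)" "vert T \<subseteq> N0 \<union> Nb" "vert T \<subseteq> T"
    "vert T \<noteq> {}"
proof -
  obtain C where C: "\<not> affine_dependent C" "int (card C) = int CARD('n) + 1" "T = convex hull C"
    using simplex_T[OF assms] unfolding simplex_def by blast
  then have CV: "vert T = C"
    using extreme_point_of_convex_hull_affine_independent by blast
  show "finite (vert T)" using C(1) CV aff_independent_finite by blast
  show "T = convex hull (vert T)" using C CV by simp
  show "vert T \<subseteq> N0 \<union> Nb" using vert_N assms by blast
  show "vert T \<subseteq> T" by (auto simp: extreme_point_of_def)
  show "vert T \<noteq> {}" using C(2) CV by auto
qed

lemma hat: "z \<in> N0 \<Longrightarrow> hat_function \<T> (N0 \<union> Nb) z (\<phi> z)"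
  using hats unfolding translation_invariant_hat_basis_def by blast

lemma continuous_hat: "z \<in> N0 \<Longrightarrow> continuous_on UNIV (\<phi> z)"
  and hat_outside: "z \<in> N0 \<Longrightarrow> x \<notin> \<Union>\<T> \<Longrightarrow> \<phi> z x = 0"
  and hat_node: "z \<in> N0 \<Longrightarrow> y \<in> N0 \<union> Nb \<Longrightarrow> \<phi> z y = (if y = z then 1 else 0)"
  using hat unfolding hat_function_def by blast+

lemma barycentric:
  assumes T: "T \<in> \<T>" and x: "x \<in> T"
  shows "\<exists>t. (\<forall>v\<in>vert T. 0 \<le> t v) \<and> sum t (vert T) = 1 \<and> x = (\<Sum>v\<in>vert T. t v *\<^sub>R v) \<and>
    (\<forall>z\<in>N0. \<phi> z x = (if z \<in> vert T then t z else 0))"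
proof -
  have "x \<in> convex hull (vert T)" using vert_T(2)[OF T] x by simp
  then obtain t where t: "\<And>v. v \<in> vert T \<Longrightarrow> 0 \<le> t v" "sum t (vert T) = 1" "x = (\<Sum>v\<in>vert T. t v *\<^sub>R v)"
    unfolding convex_hull_finite[OF vert_T(1)[OF T]] by auto
  have "\<phi> z x = (if z \<in> vert T then t z else 0)" if z: "z \<in> N0" for z
  proof -
    obtain f where f: "affine_fun f" "\<And>x. x \<in> T \<Longrightarrow> \<phi> z x = f x"
      using hat[OF z] T unfolding hat_function_def by blast
    have "\<phi> z x = (\<Sum>v\<in>vert T. t v * f v)"
      using f(2)[OF x] affine_fun_sum[OF f(1) t(2)] t(3) by simp
    also have "\<dots> = (\<Sum>v\<in>vert T. if v = z then t v else 0)"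
    proof (rule sum.cong[OF refl])
      fix v assume v: "v \<in> vert T"
      then have "f v = \<phi> z v" "\<phi> z v = (if v = z then 1 else 0)"
        using f(2)[of v] vert_T(3,4)[OF T] hat_node[OF z, of v] by auto
      then show "t v * f v = (if v = z then t v else 0)" by simp
    qed
    also have "\<dots> = (if z \<in> vert T then t z else 0)"
      using vert_T(1)[OF T] by simp
    finally show ?thesis .
  qed
  then show ?thesis using t by blast
qed

lemma finite_N0: "finite N0" using finite_N by simp

lemma hat_nonneg: "z \<in> N0 \<Longrightarrow> 0 \<le> \<phi> z x"
proof (cases "x \<in> \<Union>\<T>")
  case True
  assume z: "z \<in> N0"
  from True obtain T where "T \<in> \<T>" "x \<in> T" by blast
  then obtain t where "\<forall>v\<in>vert T. 0 \<le> t v" "\<forall>z\<in>N0. \<phi> z x = (if z \<in> vert T then t z else 0)"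
    using barycentric by blast
  then show ?thesis using z by simp
qed (simp add: hat_outside)

lemma sum_hat:
  assumes T: "T \<in> \<T>" and x: "x \<in> T"
  shows "(\<Sum>z\<in>N0. \<phi> z x) \<le> 1" "vert T \<subseteq> N0 \<Longrightarrow> (\<Sum>z\<in>N0. \<phi> z x) = 1"
proof -
  obtain t where t: "\<forall>v\<in>vert T. 0 \<le> t v" "sum t (vert T) = 1"
    "\<forall>z\<in>N0. \<phi> z x = (if z \<in> vert T then t z else 0)"
    using barycentric[OF assms] by blast
  have "(\<Sum>z\<in>N0. \<phi> z x) = (\<Sum>z\<in>N0. if z \<in> vert T then t z else 0)"
    using t(3) by (intro sum.cong) auto
  also have "\<dots> = (\<Sum>z\<in>N0 \<inter> vert T. t z)"
    using finite_N0 by (simp add: sum.inter_restrict)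
  finally have eq: "(\<Sum>z\<in>N0. \<phi> z x) = (\<Sum>z\<in>N0 \<inter> vert T. t z)" .
  show "(\<Sum>z\<in>N0. \<phi> z x) \<le> 1"
    unfolding eq t(2)[symmetric] using vert_T(1)[OF T] t(1) by (intro sum_mono2) auto
  show "(\<Sum>z\<in>N0. \<phi> z x) = 1" if "vert T \<subseteq> N0"
    using eq t(2) that by (simp add: Int_absorb1)
qed

lemma sum_hat_le_1: "(\<Sum>z\<in>N0. \<phi> z x) \<le> 1"
proof (cases "x \<in> \<Union>\<T>")
  case True then show ?thesis using sum_hat(1) by blast
next
  case False then show ?thesis by (simp add: hat_outside)
qed

lemma hat_le_1: "z \<in> N0 \<Longrightarrow> \<phi> z x \<le> 1"
  using sum_hat_le_1[of x] member_le_sum[of z N0 "\<lambda>z. \<phi> z x"] hat_nonneg finite_N0 by fastforce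

lemma diameter_le_h:
  assumes "z \<in> N0" "T \<in> \<T>" "z \<in> T"
  shows "diameter T \<le> h"
proof -
  have "diameter T \<le> local_size \<T> z"
    unfolding local_size_def using finite_T assms by (intro Max_ge) auto
  then show ?thesis using quasi_unif assms(1) unfolding quasi_uniform_def by fastforce
qed

lemma hat_support:
  assumes z: "z \<in> N0" and nz: "\<phi> z x \<noteq> 0"
  shows "dist z x \<le> h"
proof -
  obtain T where T: "T \<in> \<T>" "x \<in> T" using hat_outside[OF z] nz by blast
  then have "z \<in> vert T" using barycentric[OF T] z nz by (metis (lifting))
  then have "z \<in> T" by (simp add: extreme_point_of_def)
  then have "dist z x \<le> diameter T"
    using diameter_bounded_bound[OF compact_imp_bounded[OF compact_T[OF T(1)]]] T(2) by blast
  then show ?thesis using diameter_le_h[OF z T(1) \<open>z \<in> T\<close>] by simp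
qed

lemma interior_UnT:
  assumes T: "T \<in> \<T>" and x: "x \<in> T" and v: "vert T \<subseteq> N0"
  shows "x \<in> interior (\<Union>\<T>)"
proof -
  have "\<exists>z\<in>N0. \<phi> z x \<noteq> 0"
    using sum_hat(2)[OF assms] by (metis sum.neutral zero_neq_one)
  then obtain z where z: "z \<in> N0" "\<phi> z x \<noteq> 0" by blast
  have "open {y. \<phi> z y \<noteq> 0}"
    using continuous_hat[OF z(1)] by (intro open_Collect_neq) auto
  moreover have "{y. \<phi> z y \<noteq> 0} \<subseteq> \<Union>\<T>" using hat_outside[OF z(1)] by blast
  ultimately show ?thesis using z(2) by (intro interiorI) auto
qed

lemma N0_interior: "z \<in> N0 \<Longrightarrow> z \<in> interior (\<Union>\<T>)"
proof -
  assume z: "z \<in> N0"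
  have "open {y. \<phi> z y \<noteq> 0}"
    using continuous_hat[OF z] by (intro open_Collect_neq) auto
  moreover have "{y. \<phi> z y \<noteq> 0} \<subseteq> \<Union>\<T>" using hat_outside[OF z] by blast
  ultimately show ?thesis using hat_node[OF z, of z] z by (intro interiorI) auto
qed

lemma T_sub_hull: "T \<in> \<T> \<Longrightarrow> T \<subseteq> convex hull (N0 \<union> Nb)"
  using vert_T(2,3) hull_mono by metis

lemma inball_diameter_bounds:
  assumes T: "T \<in> \<T>"
  shows "0 < inball_diameter T" "diameter T \<le> \<sigma> * inball_diameter T"
    "s < inball_diameter T \<Longrightarrow> \<exists>c r. 0 \<le> r \<and> s < 2 * r \<and> cball c r \<subseteq> T"
    "(\<And>c r. 0 \<le> r \<Longrightarrow> cball c r \<subseteq> T \<Longrightarrow> 2 * r \<le> b) \<Longrightarrow> inball_diameter T \<le> b"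
proof -
  let ?S = "{2 * r |r. 0 \<le> r \<and> (\<exists>c. cball c r \<subseteq> T)}"
  have "aff_dim T = int CARD('n)" using simplex_T[OF T] aff_dim_simplex by blast
  then have "affine hull T = UNIV" by (simp add: aff_dim_eq_full[symmetric])
  moreover have "T \<noteq> {}" using vert_T(4,5)[OF T] by blast
  ultimately have "interior T \<noteq> {}"
    using convex_T[OF T] rel_interior_interior rel_interior_eq_empty by metis
  then obtain c r where r: "0 < r" "cball c r \<subseteq> T"
    using mem_interior_cball by blast
  have bdd: "bdd_above ?S"
  proof (rule bdd_aboveI[of _ "diameter T"], clarsimp)
    fix r c assume "0 \<le> r" "cball c r \<subseteq> T"
    then show "2 * r \<le> diameter T"
      using diameter_subset[of "cball c r" T] compact_imp_bounded[OF compact_T[OF T]]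
      by (simp add: diameter_cball)
  qed
  have "2 * r \<le> inball_diameter T"
    unfolding inball_diameter_def using r bdd by (intro cSup_upper) auto
  then show pos: "0 < inball_diameter T" using r by simp
  show "diameter T \<le> \<sigma> * inball_diameter T"
    using shape_reg T pos unfolding shape_regular_def by (simp add: divide_le_eq)
  show "\<exists>c r. 0 \<le> r \<and> s < 2 * r \<and> cball c r \<subseteq> T" if "s < inball_diameter T"
    using less_cSup_iff[of ?S s] bdd r that unfolding inball_diameter_def by force
  show "inball_diameter T \<le> b" if "\<And>c r. 0 \<le> r \<Longrightarrow> cball c r \<subseteq> T \<Longrightarrow> 2 * r \<le> b"
    unfolding inball_diameter_def
  proof (rule cSup_least)
    show "?S \<noteq> {}" using r less_imp_le by blast
  qed (use that in auto)
qed

lemma sigma_nonneg: "T \<in> \<T> \<Longrightarrow> 0 \<le> \<sigma>"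
proof -
  assume T: "T \<in> \<T>"
  have "0 \<le> diameter T" using compact_T[OF T] by (simp add: diameter_ge_0 compact_imp_bounded)
  then have "0 \<le> \<sigma> * inball_diameter T" using inball_diameter_bounds(2)[OF T] by linarith
  then show ?thesis using inball_diameter_bounds(1)[OF T] by (simp add: zero_le_mult_iff)
qed

definition K\<^sub>d :: real where "K\<^sub>d = max 1 (2 * CARD('n) * \<sigma>)"

lemma K\<^sub>d_ge_1: "1 \<le> K\<^sub>d" by (simp add: K\<^sub>d_def)

text \<open>A simplex without interior nodes contains no lattice point in its interior, so its inscribed
  balls have radius at most the covering radius of the lattice.\<close>
lemma mesh_diameter_le:
  assumes T: "T \<in> \<T>"
  shows "diameter T \<le> K\<^sub>d * h"
proof (cases "\<exists>z\<in>N0. z \<in> T")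
  case True
  then have "diameter T \<le> 1 * h" using diameter_le_h T by auto
  also have "\<dots> \<le> K\<^sub>d * h" using h_pos K\<^sub>d_ge_1 by (intro mult_right_mono) auto
  finally show ?thesis .
next
  case False
  have "inball_diameter T \<le> 2 * (h * CARD('n))"
  proof (rule inball_diameter_bounds(4)[OF T])
    fix c r assume r: "0 \<le> r" "cball c r \<subseteq> T"
    have "r \<le> h * CARD('n)"
    proof (rule ccontr)
      assume "\<not> r \<le> h * CARD('n)"
      then obtain l where l: "l \<in> L" "dist c l < r" using cover_L[of c] by force
      have "ball c r \<subseteq> closure \<Omega>" using r(2) T T_sub ball_subset_cball by blast
      then have "ball c r \<subseteq> interior (closure \<Omega>)" by (simp add: interior_maximal)
      also have "\<dots> = \<Omega>" using convex_interior_closure[OF convex_Omega] open_Omega by (simp add: interior_open)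
      finally have "l \<in> N0" using l N0_eq by auto
      moreover have "l \<in> T" using r(2) l(2) by (auto simp: subset_eq)
      ultimately show False using False by blast
    qed
    then show "2 * r \<le> 2 * (h * CARD('n))" by simp
  qed
  then have "diameter T \<le> \<sigma> * (2 * (h * CARD('n)))"
    using inball_diameter_bounds(2)[OF T] sigma_nonneg[OF T] by (meson dual_order.trans mult_left_mono)
  also have "\<dots> = (2 * CARD('n) * \<sigma>) * h" by simp
  also have "\<dots> \<le> K\<^sub>d * h" using h_pos by (intro mult_right_mono) (auto simp: K\<^sub>d_def)
  finally show ?thesis .
qed

lemma vert_deep:
  assumes T: "T \<in> \<T>" and x: "x \<in> T" "cball x (K\<^sub>d * h) \<subseteq> \<Omega>"
  shows "vert T \<subseteq> N0"
proof
  fix v assume v: "v \<in> vert T"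
  then have "v \<in> T" by (simp add: extreme_point_of_def)
  then have "dist x v \<le> diameter T"
    using diameter_bounded_bound[OF compact_imp_bounded[OF compact_T[OF T]]] x(1) by blast
  then have "v \<in> \<Omega>" using x(2) mesh_diameter_le[OF T] by (auto simp: subset_eq)
  then have "v \<notin> Nb" using Nb_sub open_Omega by (auto simp: frontier_def interior_open)
  then show "v \<in> N0" using v vert_T(3)[OF T] by blast
qed

lemma cball_sub_interior_UnT:
  assumes z: "z \<in> N0" and s: "0 \<le> s" and deep: "cball z (s + K\<^sub>d * h) \<subseteq> \<Omega>"
  shows "cball z s \<subseteq> interior (\<Union>\<T>)"
proof -
  have deep': "cball x (K\<^sub>d * h) \<subseteq> \<Omega>" if "x \<in> cball z s" for x
  proof -
    have "cball x (K\<^sub>d * h) \<subseteq> cball z (s + K\<^sub>d * h)"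
    proof
      fix w assume "w \<in> cball x (K\<^sub>d * h)"
      then show "w \<in> cball z (s + K\<^sub>d * h)" using that dist_triangle[of z w x] by simp
    qed
    then show ?thesis using deep by blast
  qed
  have sub: "cball z s \<inter> \<Union>\<T> \<subseteq> interior (\<Union>\<T>)"
    using interior_UnT vert_deep deep' by blast
  have "cball z s \<inter> \<Union>\<T> = cball z s"
  proof -
    have "closedin (top_of_set (cball z s)) (cball z s \<inter> \<Union>\<T>)"
      using compact_UnT by (simp add: closedin_closed_Int compact_imp_closed)
    moreover have "cball z s \<inter> \<Union>\<T> = cball z s \<inter> interior (\<Union>\<T>)"
      using sub interior_subset by blast
    then have "openin (top_of_set (cball z s)) (cball z s \<inter> \<Union>\<T>)"
      by (simp add: openin_open_Int)
    moreover have "z \<in> cball z s \<inter> \<Union>\<T>" using N0_interior[OF z] interior_subset s by auto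
    ultimately show ?thesis
      using connected_clopen[of "cball z s"] by (metis connected_cball empty_iff)
  qed
  then show ?thesis using sub by simp
qed

lemma infdist_frontier_UnT:
  assumes "cball y s \<subseteq> interior (\<Union>\<T>)" and s: "h < s"
  shows "h < infdist y (frontier (\<Union>\<T>))"
proof -
  have y: "y \<in> interior (\<Union>\<T>)" using assms h_pos by auto
  have "frontier (\<Union>\<T>) \<noteq> {}"
  proof
    assume "frontier (\<Union>\<T>) = {}"
    then have "\<Union>\<T> = {} \<or> \<Union>\<T> = UNIV" by (simp add: frontier_eq_empty)
    moreover have "\<Union>\<T> \<noteq> {}" using y interior_subset by blast
    moreover have "\<Union>\<T> \<noteq> UNIV" using compact_UnT not_compact_UNIV by metis
    ultimately show False by blast
  qed
  then obtain w where w: "w \<in> frontier (\<Union>\<T>)" "infdist y (frontier (\<Union>\<T>)) = dist y w"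
    using infdist_attains_inf[OF frontier_closed] by metis
  then have "w \<notin> interior (\<Union>\<T>)" by (simp add: frontier_def)
  then have "w \<notin> cball y s" using assms(1) by blast
  then show ?thesis using w(2) s by simp
qed

definition R\<^sub>d :: real where "R\<^sub>d = CARD('n) + 3 + K\<^sub>d"

lemma hat_translate:
  assumes z: "z \<in> N0" and deep: "cball z (R\<^sub>d * h) \<subseteq> \<Omega>" and l: "l \<in> L" "norm l \<le> (CARD('n) + 1) * h"
  shows "z - l \<in> N0" "\<phi> (z - l) (x + (z - l)) = \<phi> z (x + z)"
proof -
  have int: "cball z ((CARD('n) + 3) * h) \<subseteq> interior (\<Union>\<T>)"
    using deep h_pos by (intro cball_sub_interior_UnT[OF z]) (auto simp: R\<^sub>d_def algebra_simps)
  have "z - l \<in> cball z (R\<^sub>d * h)"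
  proof -
    have "(CARD('n) + 1) * h \<le> R\<^sub>d * h"
      using h_pos K\<^sub>d_ge_1 by (intro mult_right_mono) (auto simp: R\<^sub>d_def)
    then show ?thesis using l(2) by (simp add: dist_norm)
  qed
  then show zl: "z - l \<in> N0"
    using deep N0_eq z l(1) discrete_subgroupD(4)[OF subgroup_L] by blast
  have "cball (z - l) (2 * h) \<subseteq> cball z ((CARD('n) + 3) * h)"
  proof
    fix w assume "w \<in> cball (z - l) (2 * h)"
    then have "norm (z - l - w) \<le> 2 * h" by (simp add: dist_norm)
    then have "norm (z - w) \<le> (CARD('n) + 1) * h + 2 * h"
      using norm_triangle_ineq[of "z - l - w" l] l(2) by simp
    then show "w \<in> cball z ((CARD('n) + 3) * h)" by (simp add: dist_norm algebra_simps)
  qed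
  then have 1: "h < infdist (z - l) (frontier (\<Union>\<T>))"
    using int h_pos by (intro infdist_frontier_UnT[of _ "2 * h"]) auto
  have "cball z (2 * h) \<subseteq> cball z ((CARD('n) + 3) * h)"
    using h_pos by (intro subset_cball mult_right_mono) auto
  then have 2: "h < infdist z (frontier (\<Union>\<T>))"
    using int h_pos by (intro infdist_frontier_UnT[of _ "2 * h"]) auto
  show "\<phi> (z - l) (x + (z - l)) = \<phi> z (x + z)"
    using hats z zl 1 2 unfolding translation_invariant_hat_basis_def by blast
qed

lemma partition_of_unity:
  assumes z: "z \<in> N0" and deep: "cball z (R\<^sub>d * h) \<subseteq> \<Omega>"
  shows "(\<integral>\<^sup>+l. ennreal (\<phi> z (x + l + z)) \<partial>count_space L) = 1"
proof -
  obtain l0 where l0: "l0 \<in> L" "dist x l0 \<le> h * CARD('n)" using cover_L by blast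
  define y where "y = x - l0"
  have ny: "norm y \<le> h * CARD('n)" using l0(2) by (simp add: y_def dist_norm)
  define S where "S = L \<inter> cball 0 ((CARD('n) + 1) * h)"
  have finS: "finite S" using discrete_subgroupD(5)[OF subgroup_L] by (simp add: S_def)
  have bij: "bij_betw (\<lambda>l. l - l0) L L"
    by (rule bij_betwI[where g="\<lambda>l. l + l0"])
       (use discrete_subgroupD[OF subgroup_L] l0(1) in auto)
  have far: "\<phi> w (z + y) = 0" if "w \<in> N0" "w \<notin> (\<lambda>l. z - l) ` S" for w
  proof (rule ccontr)
    assume "\<phi> w (z + y) \<noteq> 0"
    then have "norm (w - (z + y)) \<le> h" using hat_support[OF that(1)] by (simp add: dist_norm)
    then have "norm (z - w) \<le> (CARD('n) + 1) * h"
      using ny norm_triangle_ineq[of "w - (z + y)" y] by (simp add: norm_minus_commute algebra_simps)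
    moreover have "z - w \<in> L" using z that(1) N0_eq discrete_subgroupD(4)[OF subgroup_L] by blast
    ultimately have "z - w \<in> S" by (simp add: S_def)
    then show False using that(2) by (metis diff_diff_eq2 add_diff_cancel_left' image_eqI)
  qed
  have "(\<integral>\<^sup>+l. ennreal (\<phi> z (x + l + z)) \<partial>count_space L) = (\<integral>\<^sup>+l. ennreal (\<phi> z (y + l + z)) \<partial>count_space L)"
    using nn_integral_bij_count_space[OF bij, of "\<lambda>l. ennreal (\<phi> z (x + l + z))"]
    by (simp add: y_def algebra_simps)
  also have "\<dots> = (\<Sum>l\<in>S. ennreal (\<phi> z (y + l + z)))"
  proof (rule nn_integral_count_space'[OF finS])
    fix l assume l: "l \<in> L" "l \<notin> S"
    have "\<phi> z (y + l + z) = 0"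
    proof (rule ccontr)
      assume "\<phi> z (y + l + z) \<noteq> 0"
      then have "norm (y + l) \<le> h" using hat_support[OF z] by (fastforce simp: dist_norm norm_minus_commute)
      then have "norm l \<le> (CARD('n) + 1) * h"
        using ny norm_triangle_ineq4[of "y + l" y] by (simp add: algebra_simps)
      then show False using l by (simp add: S_def)
    qed
    then show "ennreal (\<phi> z (y + l + z)) = 0" by simp
  qed (simp add: S_def)
  also have "\<dots> = (\<Sum>l\<in>S. ennreal (\<phi> (z - l) (z + y)))"
  proof (rule sum.cong[OF refl])
    fix l assume "l \<in> S"
    then show "ennreal (\<phi> z (y + l + z)) = ennreal (\<phi> (z - l) (z + y))"
      using hat_translate(2)[OF z deep, of l "y + l"] by (simp add: S_def algebra_simps)
  qed
  also have "\<dots> = (\<Sum>w\<in>(\<lambda>l. z - l) ` S. ennreal (\<phi> w (z + y)))"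
    by (subst sum.reindex) (auto simp: inj_on_def)
  also have "\<dots> = (\<Sum>w\<in>N0. ennreal (\<phi> w (z + y)))"
  proof (rule sum.mono_neutral_left[OF finite_N0])
    show "(\<lambda>l. z - l) ` S \<subseteq> N0" using hat_translate(1)[OF z deep] by (auto simp: S_def)
    show "\<forall>w\<in>N0 - (\<lambda>l. z - l) ` S. ennreal (\<phi> w (z + y)) = 0" using far by simp
  qed
  also have "\<dots> = ennreal (\<Sum>w\<in>N0. \<phi> w (z + y))"
    using hat_nonneg by (intro sum_ennreal) auto
  also have "(\<Sum>w\<in>N0. \<phi> w (z + y)) = 1"
  proof -
    have "cball z (CARD('n) * h) \<subseteq> interior (\<Union>\<T>)"
    proof (rule cball_sub_interior_UnT[OF z])
      have "CARD('n) * h + K\<^sub>d * h \<le> R\<^sub>d * h" using h_pos by (simp add: R\<^sub>d_def algebra_simps)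
      then show "cball z (CARD('n) * h + K\<^sub>d * h) \<subseteq> \<Omega>" using deep subset_cball by blast
    qed (use h_pos in auto)
    moreover have "z + y \<in> cball z (CARD('n) * h)" using ny by (simp add: dist_norm mult.commute)
    ultimately obtain T where T: "T \<in> \<T>" "z + y \<in> T" using interior_subset by blast
    have "cball (z + y) (K\<^sub>d * h) \<subseteq> cball z (R\<^sub>d * h)"
    proof
      fix w assume "w \<in> cball (z + y) (K\<^sub>d * h)"
      then have "norm (z + y - w) \<le> K\<^sub>d * h" by (simp add: dist_norm)
      then have "norm (z - w) \<le> K\<^sub>d * h + h * CARD('n)"
        using ny norm_triangle_ineq4[of "z + y - w" y] by simp
      then show "w \<in> cball z (R\<^sub>d * h)" using h_pos by (simp add: dist_norm R\<^sub>d_def algebra_simps)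
    qed
    then show ?thesis
      using sum_hat(2)[OF T vert_deep[OF T]] deep by blast
  qed
  finally show ?thesis by simp
qed

end

lemma ennreal_integral_lborel:
  assumes "integrable lborel f" "\<And>x. 0 \<le> f x"
  shows "ennreal (integral\<^sup>L lborel f) = (\<integral>\<^sup>+x. ennreal (f x) \<partial>lborel)"
  using nn_integral_eq_integral[OF assms(1)] assms(2) by simp

context lattice_mesh
begin

definition hat_vol :: "real^'n \<Rightarrow> real" where
  "hat_vol z = (\<integral>x. \<phi> z x \<partial>lborel)"

lemma borel_hat [measurable]: "z \<in> N0 \<Longrightarrow> \<phi> z \<in> borel_measurable borel"
  using continuous_hat borel_measurable_continuous_onI by blast

lemma nn_integral_hat_le:
  assumes z: "z \<in> N0"
  shows "(\<integral>\<^sup>+x. ennreal (\<phi> z x) \<partial>lborel) \<le> ennreal (unit_ball_vol (CARD('n)) * h ^ CARD('n))"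
proof -
  have "(\<integral>\<^sup>+x. ennreal (\<phi> z x) \<partial>lborel) \<le> (\<integral>\<^sup>+x. indicator (cball z h) x \<partial>lborel)"
  proof (rule nn_integral_mono)
    fix x show "ennreal (\<phi> z x) \<le> indicator (cball z h) x"
      using hat_support[OF z, of x] hat_le_1[OF z, of x] by (cases "\<phi> z x = 0") (auto simp: ennreal_le_1)
  qed
  also have "\<dots> = ennreal (unit_ball_vol (CARD('n)) * h ^ CARD('n))"
    using h_pos by (simp add: emeasure_cball)
  finally show ?thesis .
qed

lemma integrable_hat:
  assumes z: "z \<in> N0"
  shows "integrable lborel (\<phi> z)"
proof (rule integrableI_nonneg)
  show "\<phi> z \<in> borel_measurable lborel" using borel_hat[OF z] by simp
  show "AE x in lborel. 0 \<le> \<phi> z x" using hat_nonneg[OF z] by simp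
  show "(\<integral>\<^sup>+x. ennreal (\<phi> z x) \<partial>lborel) < \<infinity>"
    using nn_integral_hat_le[OF z] by (simp add: le_less_trans)
qed

lemma hat_vol_ennreal: "z \<in> N0 \<Longrightarrow> ennreal (hat_vol z) = (\<integral>\<^sup>+x. ennreal (\<phi> z x) \<partial>lborel)"
  unfolding hat_vol_def by (rule ennreal_integral_lborel[OF integrable_hat hat_nonneg])

lemma hat_vol_nonneg: "z \<in> N0 \<Longrightarrow> 0 \<le> hat_vol z"
  unfolding hat_vol_def by (simp add: hat_nonneg)

lemma hat_vol_le:
  assumes z: "z \<in> N0"
  shows "hat_vol z \<le> unit_ball_vol (CARD('n)) * h ^ CARD('n)"
  using nn_integral_hat_le[OF z] h_pos unfolding hat_vol_ennreal[OF z, symmetric] by simp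

lemma sigma_pos:
  assumes z: "z \<in> N0"
  shows "0 < \<sigma>" and "\<exists>T\<in>\<T>. z \<in> T \<and> \<gamma> * h \<le> diameter T"
proof -
  let ?S = "{T \<in> \<T>. z \<in> T}"
  have "?S \<noteq> {}" using vert_N z vert_T(4) by blast
  then have "local_size \<T> z \<in> diameter ` ?S"
    unfolding local_size_def using finite_T by (intro Max_in) auto
  moreover have "\<gamma> * h \<le> local_size \<T> z" using quasi_unif z unfolding quasi_uniform_def by blast
  ultimately show ex: "\<exists>T\<in>\<T>. z \<in> T \<and> \<gamma> * h \<le> diameter T" by auto
  then obtain T where T: "T \<in> \<T>" "\<gamma> * h \<le> diameter T" by blast
  have "0 < \<gamma> * h" using gamma_pos h_pos by simp
  then have "0 < \<sigma> * inball_diameter T" using T inball_diameter_bounds(2)[OF T(1)] by linarith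
  then show "0 < \<sigma>" using inball_diameter_bounds(1)[OF T(1)] by (simp add: zero_less_mult_iff)
qed

text \<open>Shrinking a simplex to half its size towards the node keeps the hat function above one half.\<close>
lemma hat_vol_ge:
  assumes z: "z \<in> N0"
  shows "unit_ball_vol (CARD('n)) / 2 * (\<gamma> * h / (8 * \<sigma>)) ^ CARD('n) \<le> hat_vol z"
proof -
  note s = sigma_pos(1)[OF z]
  obtain T where T: "T \<in> \<T>" "z \<in> T" "\<gamma> * h \<le> diameter T" using sigma_pos(2)[OF z] by blast
  have gh: "0 < \<gamma> * h" using gamma_pos h_pos by simp
  define q where "q = \<gamma> * h / (8 * \<sigma>)"
  have q: "0 < q" using gh s by (simp add: q_def)
  have "\<gamma> * h \<le> \<sigma> * inball_diameter T" using inball_diameter_bounds(2)[OF T(1)] T(3) by linarith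
  then have "8 * q \<le> inball_diameter T" using s by (simp add: q_def field_simps)
  then have "4 * q < inball_diameter T" using q by linarith
  then obtain c r where r: "4 * q < 2 * r" "cball c r \<subseteq> T"
    using inball_diameter_bounds(3)[OF T(1)] by blast
  define m where "m = (1/2) *\<^sub>R (z + c)"
  have half: "1 / 2 \<le> \<phi> z y" if "y \<in> cball m q" for y
  proof -
    define x where "x = 2 *\<^sub>R y - z"
    have "c - x = 2 *\<^sub>R (m - y)" by (simp add: x_def m_def scaleR_right_diff_distrib scaleR_add_right scaleR_2)
    then have "dist c x = 2 * dist m y" by (simp add: dist_norm)
    then have "x \<in> T" using that r by auto
    have y: "y = (1/2) *\<^sub>R z + (1/2) *\<^sub>R x" by (simp add: x_def algebra_simps)
    then have "y \<in> T" using convex_T[OF T(1)] T(2) \<open>x \<in> T\<close> by (simp add: convexD)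
    obtain f where f: "affine_fun f" "\<And>x. x \<in> T \<Longrightarrow> \<phi> z x = f x"
      using hat[OF z] T(1) unfolding hat_function_def by blast
    obtain a b where ab: "\<And>x. f x = a \<bullet> x + b" using f(1) unfolding affine_fun_def by blast
    have "f y = (f z + f x) / 2" unfolding ab y by (simp add: inner_add_right field_simps)
    then have "\<phi> z y = (\<phi> z z + \<phi> z x) / 2" using f(2) T(2) \<open>x \<in> T\<close> \<open>y \<in> T\<close> by simp
    then show ?thesis using hat_node[OF z, of z] z hat_nonneg[OF z, of x] by simp
  qed
  have "ennreal (1/2) * emeasure lborel (cball m q) = (\<integral>\<^sup>+x. ennreal (1/2) * indicator (cball m q) x \<partial>lborel)"
    by (simp add: nn_integral_cmult_indicator)
  also have "\<dots> \<le> (\<integral>\<^sup>+x. ennreal (\<phi> z x) \<partial>lborel)"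
  proof (rule nn_integral_mono)
    fix x show "ennreal (1/2) * indicator (cball m q) x \<le> ennreal (\<phi> z x)"
      using ennreal_leI[OF half[of x]] by (cases "x \<in> cball m q") simp_all
  qed
  also have "\<dots> = ennreal (hat_vol z)" by (simp add: hat_vol_ennreal[OF z])
  finally have "ennreal (1/2 * (unit_ball_vol (CARD('n)) * q ^ CARD('n))) \<le> ennreal (hat_vol z)"
    using q by (subst ennreal_mult') (simp_all only: emeasure_cball less_imp_le, simp_all)
  then have "1/2 * (unit_ball_vol (CARD('n)) * q ^ CARD('n)) \<le> hat_vol z"
    using hat_vol_nonneg[OF z] by simp
  then show ?thesis by (simp add: q_def)
qed

lemma weighted_hat_integrable:
  assumes z: "z \<in> N0" and f: "continuous_on \<Omega> f" and B: "\<And>x. x \<in> \<Omega> \<Longrightarrow> 0 \<le> f x \<and> f x \<le> B"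
  shows "integrable lborel (\<lambda>x. indicator \<Omega> x *\<^sub>R (f x * \<phi> z x))"
    and "(LINT x:\<Omega>|lebesgue. f x * \<phi> z x) = (\<integral>x. indicator \<Omega> x *\<^sub>R (f x * \<phi> z x) \<partial>lborel)"
proof -
  have m1: "(\<lambda>x. indicator \<Omega> x *\<^sub>R f x) \<in> borel_measurable borel"
    using borel_measurable_continuous_on_indicator[OF _ f] open_Omega by simp
  have "(\<lambda>x. (indicator \<Omega> x *\<^sub>R f x) * \<phi> z x) \<in> borel_measurable borel"
    using m1 borel_hat[OF z] by measurable
  then have m: "(\<lambda>x. indicator \<Omega> x *\<^sub>R (f x * \<phi> z x)) \<in> borel_measurable lborel"
    by (simp add: mult.assoc)
  show "integrable lborel (\<lambda>x. indicator \<Omega> x *\<^sub>R (f x * \<phi> z x))"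
  proof (rule Bochner_Integration.integrable_bound[OF _ m])
    show "integrable lborel (\<lambda>x. B * \<phi> z x)" using integrable_hat[OF z] by simp
    show "AE x in lborel. norm (indicator \<Omega> x *\<^sub>R (f x * \<phi> z x)) \<le> norm (B * \<phi> z x)"
    proof (rule AE_I2)
      fix x show "norm (indicator \<Omega> x *\<^sub>R (f x * \<phi> z x)) \<le> norm (B * \<phi> z x)"
        using B[of x] hat_nonneg[OF z, of x]
        by (cases "x \<in> \<Omega>") (auto simp: abs_mult intro!: mult_right_mono)
    qed
  qed
  show "(LINT x:\<Omega>|lebesgue. f x * \<phi> z x) = (\<integral>x. indicator \<Omega> x *\<^sub>R (f x * \<phi> z x) \<partial>lborel)"
    unfolding set_lebesgue_integral_def by (rule integral_completion[OF m])
qed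

lemma weighted_hat_le:
  assumes z: "z \<in> N0" and f: "continuous_on \<Omega> f" and B: "\<And>x. x \<in> \<Omega> \<Longrightarrow> 0 \<le> f x \<and> f x \<le> B"
    and B': "\<And>x. x \<in> \<Omega> \<Longrightarrow> dist z x \<le> h \<Longrightarrow> f x \<le> B'" "0 \<le> B'"
  shows "(LINT x:\<Omega>|lebesgue. f x * \<phi> z x) \<le> B' * hat_vol z"
proof -
  have "(LINT x:\<Omega>|lebesgue. f x * \<phi> z x) = (\<integral>x. indicator \<Omega> x *\<^sub>R (f x * \<phi> z x) \<partial>lborel)"
    by (rule weighted_hat_integrable(2)[OF z f B])
  also have "\<dots> \<le> (\<integral>x. B' * \<phi> z x \<partial>lborel)"
  proof (rule integral_mono)
    show "integrable lborel (\<lambda>x. indicator \<Omega> x *\<^sub>R (f x * \<phi> z x))"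
      by (rule weighted_hat_integrable(1)[OF z f B])
    show "integrable lborel (\<lambda>x. B' * \<phi> z x)" using integrable_hat[OF z] by simp
    fix x show "indicator \<Omega> x *\<^sub>R (f x * \<phi> z x) \<le> B' * \<phi> z x"
      using B'(1)[of x] B'(2) hat_nonneg[OF z, of x] hat_support[OF z, of x]
      by (cases "x \<in> \<Omega> \<and> \<phi> z x \<noteq> 0") (auto intro!: mult_right_mono)
  qed
  finally show ?thesis by (simp add: hat_vol_def)
qed

lemma weighted_hat_ge:
  assumes z: "z \<in> N0" and f: "continuous_on \<Omega> f" and B: "\<And>x. x \<in> \<Omega> \<Longrightarrow> 0 \<le> f x \<and> f x \<le> B"
    and deep: "cball z h \<subseteq> \<Omega>" and b: "\<And>x. dist z x \<le> h \<Longrightarrow> b \<le> f x"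
  shows "b * hat_vol z \<le> (LINT x:\<Omega>|lebesgue. f x * \<phi> z x)"
proof -
  have "(\<integral>x. b * \<phi> z x \<partial>lborel) \<le> (\<integral>x. indicator \<Omega> x *\<^sub>R (f x * \<phi> z x) \<partial>lborel)"
  proof (rule integral_mono)
    show "integrable lborel (\<lambda>x. indicator \<Omega> x *\<^sub>R (f x * \<phi> z x))"
      by (rule weighted_hat_integrable(1)[OF z f B])
    show "integrable lborel (\<lambda>x. b * \<phi> z x)" using integrable_hat[OF z] by simp
    fix x show "b * \<phi> z x \<le> indicator \<Omega> x *\<^sub>R (f x * \<phi> z x)"
    proof (cases "\<phi> z x = 0")
      case False
      then have "dist z x \<le> h" "x \<in> \<Omega>" using hat_support[OF z] deep by auto
      then show ?thesis using b[of x] hat_nonneg[OF z, of x] by (auto intro!: mult_right_mono)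
    qed simp
  qed
  also have "\<dots> = (LINT x:\<Omega>|lebesgue. f x * \<phi> z x)"
    by (rule weighted_hat_integrable(2)[OF z f B, symmetric])
  finally show ?thesis by (simp add: hat_vol_def)
qed

lemma sum_weighted_hat_le:
  assumes f: "continuous_on \<Omega> f" and B: "\<And>x. x \<in> \<Omega> \<Longrightarrow> 0 \<le> f x \<and> f x \<le> B"
  shows "(\<Sum>z\<in>N0. LINT x:\<Omega>|lebesgue. f x * \<phi> z x) \<le> B * measure lborel \<Omega>"
proof -
  have "(\<Sum>z\<in>N0. LINT x:\<Omega>|lebesgue. f x * \<phi> z x)
      = (\<Sum>z\<in>N0. \<integral>x. indicator \<Omega> x *\<^sub>R (f x * \<phi> z x) \<partial>lborel)"
    using weighted_hat_integrable(2)[OF _ f B] by (intro sum.cong) auto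
  also have "\<dots> = (\<integral>x. (\<Sum>z\<in>N0. indicator \<Omega> x *\<^sub>R (f x * \<phi> z x)) \<partial>lborel)"
    using weighted_hat_integrable(1)[OF _ f B] by (intro Bochner_Integration.integral_sum[symmetric]) auto
  also have "\<dots> \<le> (\<integral>x. B * indicator \<Omega> x \<partial>lborel)"
  proof (rule integral_mono)
    show "integrable lborel (\<lambda>x. \<Sum>z\<in>N0. indicator \<Omega> x *\<^sub>R (f x * \<phi> z x))"
      using weighted_hat_integrable(1)[OF _ f B] by (intro Bochner_Integration.integrable_sum) auto
    have "emeasure lborel \<Omega> < \<infinity>" using emeasure_bounded_finite[OF bounded_Omega] .
    then show "integrable lborel (\<lambda>x. B * indicator \<Omega> x :: real)"
      using open_Omega by simp
    fix x
    show "(\<Sum>z\<in>N0. indicator \<Omega> x *\<^sub>R (f x * \<phi> z x)) \<le> B * indicator \<Omega> x"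
    proof (cases "x \<in> \<Omega>")
      case True
      have "f x * (\<Sum>z\<in>N0. \<phi> z x) \<le> B * 1"
        using B[OF True] sum_hat_le_1[of x] hat_nonneg by (intro mult_mono) (auto intro: sum_nonneg)
      then show ?thesis using True by (simp add: sum_distrib_left)
    qed simp
  qed
  also have "\<dots> = B * measure lborel \<Omega>" by simp
  finally show ?thesis .
qed

lemma emeasure_cell_hat:
  assumes z: "z \<in> N0" and deep: "cball z (R\<^sub>d * h) \<subseteq> \<Omega>" and sym: "sym_matrix A"
    and a: "0 < a" "\<And>v. a * (v \<bullet> v) \<le> v \<bullet> (A *v v)"
  shows "emeasure lebesgue (open_cell L A) \<le> ennreal (\<bar>det A\<bar> * hat_vol z)"
    and "0 \<le> b \<Longrightarrow> (\<And>v. v \<bullet> (A *v v) \<le> b * (v \<bullet> v)) \<Longrightarrow> ennreal (\<bar>det A\<bar> * hat_vol z) \<le> emeasure lebesgue (cell L A)"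
proof -
  define G where "G = (\<lambda>x. ennreal (\<phi> z (x + z)))"
  have G: "G \<in> borel_measurable borel" unfolding G_def using borel_hat[OF z] by measurable
  have intG: "(\<integral>\<^sup>+x. G x \<partial>lborel) = ennreal (hat_vol z)"
  proof -
    have "(\<lambda>x. ennreal (\<phi> z x)) \<in> borel_measurable borel" using borel_hat[OF z] by measurable
    from nn_integral_lborel_translate[OF this] show ?thesis
      unfolding G_def hat_vol_ennreal[OF z] .
  qed
  have one: "(\<integral>\<^sup>+l. G (x + l) \<partial>count_space L) = 1" for x
    unfolding G_def using partition_of_unity[OF z deep, of x] by simp
  have mult: "ennreal \<bar>det A\<bar> * (\<integral>\<^sup>+x. G x \<partial>lborel) = ennreal (\<bar>det A\<bar> * hat_vol z)"
    by (simp add: intG ennreal_mult')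
  show "emeasure lebesgue (open_cell L A) \<le> ennreal (\<bar>det A\<bar> * hat_vol z)"
    unfolding mult[symmetric]
    by (rule emeasure_open_cell_le[OF subgroup_L sym a G]) (simp_all add: one intG)
  show "ennreal (\<bar>det A\<bar> * hat_vol z) \<le> emeasure lebesgue (cell L A)"
    if "0 \<le> b" "\<And>v. v \<bullet> (A *v v) \<le> b * (v \<bullet> v)"
    unfolding mult[symmetric]
    by (rule emeasure_cell_ge[OF subgroup_L sym cover_L _ a that G])
       (simp_all add: one h_pos)
qed

end

section \<open>Barriers and discrete comparison\<close>

lemma mat_vector_mult: "(mat k :: real^'n^'n) *v v = k *\<^sub>R v"
  by (simp add: vec_eq_iff matrix_vector_mult_def mat_def if_distrib if_distribR cong: if_cong)

lemma sym_matrix_simps: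
  fixes A B :: "real^'n^'n"
  shows "sym_matrix (mat k :: real^'n^'n)"
    and "sym_matrix A \<Longrightarrow> sym_matrix B \<Longrightarrow> sym_matrix (A + B)"
    and "sym_matrix A \<Longrightarrow> sym_matrix (c *\<^sub>R A)"
  by (simp_all add: sym_matrix_def mat_vector_mult inner_commute matrix_vector_mult_add_rdistrib
      inner_add_right scaleR_matrix_vector_assoc[symmetric])

lemma quadratic_simps:
  fixes A :: "real^'n^'n"
  shows "v \<bullet> ((A + mat k) *v v) = v \<bullet> (A *v v) + k * (v \<bullet> v)"
    and "v \<bullet> ((c *\<^sub>R A) *v v) = c * (v \<bullet> (A *v v))"
    and "v \<bullet> ((mat k :: real^'n^'n) *v v) = k * (v \<bullet> v)"
  by (simp_all add: mat_vector_mult matrix_vector_mult_add_rdistrib inner_add_right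
      scaleR_matrix_vector_assoc[symmetric])

lemma norm_matrix_vector_mult_le:
  fixes A :: "real^'n^'m"
  shows "norm (A *v v) \<le> norm A * norm v"
proof -
  have "norm (A *v v) = L2_set (\<lambda>i. norm (A $ i \<bullet> v)) UNIV"
    by (simp add: norm_vec_def matrix_mult_dot)
  also have "\<dots> \<le> L2_set (\<lambda>i. norm (A $ i) * norm v) UNIV"
    by (intro L2_set_mono) (simp_all add: Cauchy_Schwarz_ineq2)
  also have "\<dots> = norm A * norm v"
    by (simp add: L2_set_left_distrib[symmetric] norm_vec_def)
  finally show ?thesis .
qed

lemma pos_def_det_nonzero:
  fixes A :: "real^'n^'n"
  assumes "0 < a" and "\<And>v. a * (v \<bullet> v) \<le> v \<bullet> (A *v v)"
  shows "det A \<noteq> 0"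
  using det_nz_iff_inj[of "(*v) A"] pos_def_inj[OF assms] by simp

lemma emeasure_lebesgue_translate:
  fixes S :: "'a::euclidean_space set"
  shows "emeasure lebesgue ((+) a ` S) = emeasure lebesgue S"
  using emeasure_lebesgue_affine[of 1 a S] by (simp add: add.commute[of a])

lemma closed_nodal_subdifferential: "closed (nodal_subdifferential N w z)"
proof -
  have "nodal_subdifferential N w z = (\<Inter>y\<in>N. {p. (y - z) \<bullet> p \<le> w y - w z})"
    by (auto simp: nodal_subdifferential_def inner_commute algebra_simps)
  then show ?thesis by (simp only:) (intro closed_INT ballI closed_halfspace_le)
qed

lemma sets_nodal_subdifferential: "nodal_subdifferential N w z \<in> sets lebesgue"
  using closed_nodal_subdifferential[of N w z] by (simp add: borel_closed)

lemma nodal_subdifferential_mono: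
  assumes "\<And>y. y \<in> N \<Longrightarrow> v y - w y \<le> v z - w z"
  shows "nodal_subdifferential N v z \<subseteq> nodal_subdifferential N w z"
  using assms unfolding nodal_subdifferential_def by force

lemma finite_max_ex:
  fixes d :: "'a \<Rightarrow> real"
  assumes "finite S" "x \<in> S"
  shows "\<exists>z\<in>S. d x \<le> d z \<and> (\<forall>y\<in>S. d y \<le> d z)"
proof -
  have "Max (d ` S) \<in> d ` S" using assms by (intro Max_in) auto
  then obtain z where "z \<in> S" "d z = Max (d ` S)" by auto
  then show ?thesis using assms by (metis Max_ge finite_imageI imageI)
qed

lemma norm_add_square:
  fixes a b :: "'a::real_inner"
  shows "(norm (a + b))\<^sup>2 = (norm a)\<^sup>2 + 2 * (a \<bullet> b) + (norm b)\<^sup>2"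
  unfolding power2_norm_eq_inner by (simp add: inner_add_left inner_add_right inner_commute)

lemma square_expand:
  fixes x y c :: "'a::real_inner"
  shows "(dist y c)\<^sup>2 = (dist x c)\<^sup>2 + 2 * ((x - c) \<bullet> (y - x)) + (norm (y - x))\<^sup>2"
  using norm_add_square[of "x - c" "y - x"] by (simp add: dist_norm)

locale ma_problem = lattice_mesh \<Omega> N0 Nb L \<T> h \<gamma> \<sigma> \<phi>
  for \<Omega> :: "(real^'n) set" and N0 Nb L \<T> h \<gamma> \<sigma> \<phi> +
  fixes f g u uh :: "real^'n \<Rightarrow> real" and lam Lam M \<alpha> :: real
  assumes Omega_ne: "\<Omega> \<noteq> {}" and lam: "0 < lam" "lam \<le> Lam"
    and f_cont: "continuous_on (closure \<Omega>) f" and f_pos: "\<And>x. x \<in> \<Omega> \<Longrightarrow> 0 < f x"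
    and sol: "convex_MA_solution \<Omega> f g u"
    and eig: "\<And>x. x \<in> \<Omega> \<Longrightarrow> loewner_le (mat lam) (hessian u x)"
      "\<And>x. x \<in> \<Omega> \<Longrightarrow> loewner_le (hessian u x) (mat Lam)"
    and disc: "discrete_MA_solution \<Omega> f g N0 Nb \<phi> uh"
    and u_cont: "continuous_on (closure \<Omega>) u"
    and u_diff: "\<And>x. x \<in> \<Omega> \<Longrightarrow> u differentiable (at x)"
    and grad_diff: "\<And>x. x \<in> \<Omega> \<Longrightarrow> gradient u differentiable (at x)"
    and hessian_holder: "\<And>x y. x \<in> \<Omega> \<Longrightarrow> y \<in> \<Omega> \<Longrightarrow> norm (hessian u x - hessian u y) \<le> M * dist x y powr \<alpha>"
    and M_nonneg: "0 \<le> M" and alpha: "0 < \<alpha>" "\<alpha> \<le> 1"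
begin

abbreviation "N \<equiv> N0 \<union> Nb"

definition F :: real where "F = \<bar>det (mat (Lam + 1) :: real^'n^'n)\<bar>"

lemma hessian_bounds:
  assumes "x \<in> \<Omega>"
  shows "lam * (v \<bullet> v) \<le> v \<bullet> (hessian u x *v v)" "v \<bullet> (hessian u x *v v) \<le> Lam * (v \<bullet> v)"
  using eig[OF assms] unfolding loewner_le_def by (simp_all add: mat_vector_mult)

lemma sym_hessian: "x \<in> \<Omega> \<Longrightarrow> sym_matrix (hessian u x)"
  unfolding sym_matrix_def using hessian_symmetric[OF open_Omega _ u_diff grad_diff] by blast

lemma f_det: "x \<in> \<Omega> \<Longrightarrow> f x = \<bar>det (hessian u x)\<bar>"
  using sol f_pos unfolding convex_MA_solution_def by (metis abs_of_pos)

lemma f_le: "x \<in> \<Omega> \<Longrightarrow> f x \<le> F"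
proof -
  assume x: "x \<in> \<Omega>"
  show ?thesis unfolding f_det[OF x] F_def
  proof (rule abs_det_mono[OF sym_hessian[OF x] sym_matrix_simps(1) lam(1) hessian_bounds(1)[OF x]])
    fix v :: "real^'n" assume "v \<noteq> 0"
    then show "v \<bullet> (hessian u x *v v) < v \<bullet> (mat (Lam + 1) *v v)"
      using hessian_bounds(2)[OF x, of v] by (simp add: mat_vector_mult distrib_right add_strict_increasing2)
         (smt (verit) inner_gt_zero_iff)
  qed
qed

lemma f_bounds: "x \<in> \<Omega> \<Longrightarrow> 0 \<le> f x \<and> f x \<le> F"
  using f_le f_pos by (simp add: less_imp_le)

lemma F_nonneg: "0 \<le> F" by (simp add: F_def)

lemma f_cont': "continuous_on \<Omega> f"
  using f_cont closure_subset continuous_on_subset by blast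

lemma Nb_frontier: "y \<in> Nb \<Longrightarrow> y \<in> closure \<Omega>" "y \<in> Nb \<Longrightarrow> y \<notin> \<Omega>"
  using Nb_sub open_Omega by (auto simp: frontier_def interior_open)

lemma N_closure: "y \<in> N \<Longrightarrow> y \<in> closure \<Omega>"
  using Nb_frontier N0_sub closure_subset by blast

lemma uh_Nb: "y \<in> Nb \<Longrightarrow> uh y = u y"
  using disc sol Nb_sub unfolding discrete_MA_solution_def convex_MA_solution_def by auto

abbreviation "fz z \<equiv> LINT x:\<Omega>|lebesgue. f x * \<phi> z x"

lemma subdiff_measure: "z \<in> N0 \<Longrightarrow> emeasure lebesgue (nodal_subdifferential N uh z) = ennreal (fz z)"
  using disc unfolding discrete_MA_solution_def by blast

lemma fz_le: "z \<in> N0 \<Longrightarrow> fz z \<le> F * (unit_ball_vol (CARD('n)) * h ^ CARD('n))"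
proof -
  assume z: "z \<in> N0"
  have "fz z \<le> F * hat_vol z"
    by (rule weighted_hat_le[OF z f_cont' f_bounds]) (auto intro: f_le F_nonneg)
  also have "\<dots> \<le> F * (unit_ball_vol (CARD('n)) * h ^ CARD('n))"
    using hat_vol_le[OF z] F_nonneg by (rule mult_left_mono)
  finally show ?thesis .
qed

lemma fz_nonneg: "z \<in> N0 \<Longrightarrow> 0 \<le> fz z"
proof -
  assume z: "z \<in> N0"
  have "fz z = (\<integral>x. indicator \<Omega> x *\<^sub>R (f x * \<phi> z x) \<partial>lborel)"
    by (rule weighted_hat_integrable(2)[OF z f_cont' f_bounds])
  also have "0 \<le> \<dots>"
    using f_bounds hat_nonneg[OF z] by (intro integral_nonneg_AE AE_I2) (auto simp: indicator_def)
  finally show ?thesis .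
qed

lemma segment_in: "x \<in> \<Omega> \<Longrightarrow> y \<in> closure \<Omega> \<Longrightarrow> 0 \<le> t \<Longrightarrow> t < 1 \<Longrightarrow> x + t *\<^sub>R (y - x) \<in> \<Omega>"
proof (cases "t = 0")
  case False
  assume a: "x \<in> \<Omega>" "y \<in> closure \<Omega>" "0 \<le> t" "t < 1"
  then have "y - (1 - t) *\<^sub>R (y - x) \<in> interior \<Omega>"
    using mem_interior_closure_convex_shrink[OF convex_Omega _ a(2), of x "1 - t"] open_Omega False
    by (simp add: interior_open less_le)
  then show ?thesis using open_Omega by (simp add: interior_open algebra_simps)
qed simp

lemma u_upper:
  assumes "x \<in> \<Omega>" "y \<in> closure \<Omega>"
  shows "u y \<le> u x + gradient u x \<bullet> (y - x) + Lam / 2 * (norm (y - x))\<^sup>2"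
proof -
  have "u y \<le> u x + gradient u x \<bullet> (y - x) + Lam * ((y - x) \<bullet> (y - x)) / 2"
    using hessian_bounds(2)[OF segment_in[OF assms]]
    by (intro taylor_closure(1)[OF open_Omega convex_Omega assms u_diff grad_diff u_cont]) auto
  then show ?thesis by (simp add: dot_square_norm)
qed

lemma u_lower:
  assumes "x \<in> \<Omega>" "y \<in> closure \<Omega>"
  shows "u x + gradient u x \<bullet> (y - x) + lam / 2 * (norm (y - x))\<^sup>2 \<le> u y"
proof -
  have "u x + gradient u x \<bullet> (y - x) + lam * ((y - x) \<bullet> (y - x)) / 2 \<le> u y"
    using hessian_bounds(1)[OF segment_in[OF assms]]
    by (intro taylor_closure(2)[OF open_Omega convex_Omega assms u_diff grad_diff u_cont]) auto
  then show ?thesis by (simp add: dot_square_norm)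
qed

lemma hessian_holder_quadratic:
  assumes "x \<in> \<Omega>" "y \<in> \<Omega>" "dist x y \<le> \<rho>"
  shows "\<bar>v \<bullet> (hessian u y *v v) - v \<bullet> (hessian u x *v v)\<bar> \<le> M * \<rho> powr \<alpha> * (v \<bullet> v)"
proof -
  have "\<bar>v \<bullet> (hessian u y *v v) - v \<bullet> (hessian u x *v v)\<bar> = \<bar>v \<bullet> ((hessian u x - hessian u y) *v v)\<bar>"
    by (simp add: matrix_vector_mult_diff_rdistrib inner_diff_right)
  also have "\<dots> \<le> norm v * (norm (hessian u x - hessian u y) * norm v)"
    by (meson Cauchy_Schwarz_ineq2 dual_order.trans mult_left_mono norm_ge_zero norm_matrix_vector_mult_le)
  also have "\<dots> \<le> norm v * ((M * dist x y powr \<alpha>) * norm v)"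
    using hessian_holder[OF assms(1,2)] by (intro mult_left_mono mult_right_mono) auto
  also have "\<dots> \<le> norm v * ((M * \<rho> powr \<alpha>) * norm v)"
    using assms(3) alpha M_nonneg by (intro mult_left_mono mult_right_mono powr_mono2) auto
  also have "\<dots> = M * \<rho> powr \<alpha> * (v \<bullet> v)" by (simp add: dot_square_norm power2_eq_square)
  finally show ?thesis .
qed

lemma u_taylor:
  assumes x: "x \<in> \<Omega>" and y: "y \<in> \<Omega>" "dist x y \<le> \<rho>"
  defines "Q \<equiv> (y - x) \<bullet> (hessian u x *v (y - x))" and "\<epsilon> \<equiv> M * \<rho> powr \<alpha> * ((y - x) \<bullet> (y - x))"
  shows "u x + gradient u x \<bullet> (y - x) + (Q - \<epsilon>) / 2 \<le> u y" "u y \<le> u x + gradient u x \<bullet> (y - x) + (Q + \<epsilon>) / 2"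
proof -
  have yc: "y \<in> closure \<Omega>" using y closure_subset by blast
  have *: "\<bar>(y - x) \<bullet> (hessian u (x + t *\<^sub>R (y - x)) *v (y - x)) - Q\<bar> \<le> \<epsilon>" if "0 < t" "t < 1" for t
    unfolding Q_def \<epsilon>_def
  proof (rule hessian_holder_quadratic[OF x])
    show "x + t *\<^sub>R (y - x) \<in> \<Omega>" using segment_in[OF x yc] that by simp
    have "dist x (x + t *\<^sub>R (y - x)) = t * dist x y" using that by (simp add: dist_norm norm_minus_commute)
    also have "\<dots> \<le> 1 * dist x y" using that by (intro mult_right_mono) auto
    finally show "dist x (x + t *\<^sub>R (y - x)) \<le> \<rho>" using y(2) by simp
  qed
  show "u x + gradient u x \<bullet> (y - x) + (Q - \<epsilon>) / 2 \<le> u y"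
    using * by (intro taylor_closure(2)[OF open_Omega convex_Omega x yc u_diff grad_diff u_cont]) (smt (verit))+
  show "u y \<le> u x + gradient u x \<bullet> (y - x) + (Q + \<epsilon>) / 2"
    using * by (intro taylor_closure(1)[OF open_Omega convex_Omega x yc u_diff grad_diff u_cont]) (smt (verit))+
qed

text \<open>Adding to the solution a concave quadratic that vanishes on an enclosing sphere makes it
  strictly concave, and a strictly concave function cannot touch a nodally convex one from above
  at an interior node.\<close>
lemma upper_barrier:
  assumes enc: "\<Omega> \<subseteq> cball c R" and z: "z \<in> N0"
  shows "uh z \<le> u z + Lam * (R\<^sup>2 - (dist z c)\<^sup>2)"
proof (rule ccontr)
  define d where "d = (\<lambda>y. uh y - u y - Lam * (R\<^sup>2 - (dist y c)\<^sup>2))"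
  assume "\<not> uh z \<le> u z + Lam * (R\<^sup>2 - (dist z c)\<^sup>2)"
  then have dz: "0 < d z" by (simp add: d_def)
  obtain x where x: "x \<in> N" "d z \<le> d x" "\<And>y. y \<in> N \<Longrightarrow> d y \<le> d x"
    using finite_max_ex[OF finite_N, of z d] z by auto
  have Lam: "0 < Lam" using lam by simp
  have enc': "closure \<Omega> \<subseteq> cball c R" using enc by (simp add: closure_minimal)
  have xN0: "x \<in> N0"
  proof (rule ccontr)
    assume "x \<notin> N0"
    then have xb: "x \<in> Nb" using x(1) by simp
    then have "dist x c \<le> R" using enc' Nb_frontier(1)[OF xb] by (auto simp: dist_commute subset_eq)
    then have "(dist x c)\<^sup>2 \<le> R\<^sup>2" by (simp add: power_mono)
    then have "d x \<le> 0" using uh_Nb[OF xb] Lam by (simp add: d_def)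
    then show False using dz x(2) by simp
  qed
  then have xO: "x \<in> \<Omega>" using N0_sub by blast
  obtain L' where L': "affine_fun L'" "L' x = uh x" "\<And>y. y \<in> N \<Longrightarrow> L' y \<le> uh y"
    using disc xN0 unfolding discrete_MA_solution_def convex_nodal_def by blast
  obtain a b where ab: "\<And>y. L' y = a \<bullet> y + b" using L'(1) unfolding affine_fun_def by blast
  define q where "q = a - gradient u x + (2 * Lam) *\<^sub>R (x - c)"
  have "N \<subseteq> cball (x - q /\<^sub>R Lam) (norm q / Lam)"
  proof
    fix y assume y: "y \<in> N"
    have "a \<bullet> (y - x) \<le> uh y - uh x"
      using L'(2) L'(3)[OF y] by (simp add: ab inner_diff_right)
    also have "\<dots> \<le> u y - u x + Lam * ((dist x c)\<^sup>2 - (dist y c)\<^sup>2)"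
      using x(3)[OF y] by (simp add: d_def algebra_simps)
    also have "\<dots> \<le> gradient u x \<bullet> (y - x) + Lam / 2 * (norm (y - x))\<^sup>2
        + Lam * (- 2 * ((x - c) \<bullet> (y - x)) - (norm (y - x))\<^sup>2)"
      using u_upper[OF xO N_closure[OF y]] square_expand[of y c x] by simp
    finally have 1: "q \<bullet> (y - x) + Lam / 2 * (norm (y - x))\<^sup>2 \<le> 0"
      unfolding q_def inner_add_left inner_diff_left inner_scaleR_left by (simp add: algebra_simps)
    have "(norm ((y - x) + q /\<^sub>R Lam))\<^sup>2 = (norm (y - x))\<^sup>2 + 2 * ((y - x) \<bullet> q) / Lam + (norm q / Lam)\<^sup>2"
      using Lam norm_add_square[of "y - x" "q /\<^sub>R Lam"] by (simp add: divide_inverse mult.commute)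
    also have "\<dots> = (2 / Lam) * (q \<bullet> (y - x) + Lam / 2 * (norm (y - x))\<^sup>2) + (norm q / Lam)\<^sup>2"
      using Lam by (simp add: inner_commute field_simps)
    also have "\<dots> \<le> (norm q / Lam)\<^sup>2"
    proof -
      have "(2 / Lam) * (q \<bullet> (y - x) + Lam / 2 * (norm (y - x))\<^sup>2) \<le> 0"
        using 1 Lam by (intro mult_nonneg_nonpos) auto
      then show ?thesis by linarith
    qed
    finally have "norm ((y - x) + q /\<^sub>R Lam) \<le> norm q / Lam"
      by (rule power2_le_imp_le) (use Lam in simp)
    then show "y \<in> cball (x - q /\<^sub>R Lam) (norm q / Lam)"
      by (simp add: dist_norm norm_minus_commute algebra_simps)
  qed
  then have "convex hull N \<subseteq> cball (x - q /\<^sub>R Lam) (norm q / Lam)"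
    by (simp add: hull_minimal)
  then have "\<Union>\<T> \<subseteq> cball (x - q /\<^sub>R Lam) (norm q / Lam)" using T_sub_hull by blast
  then have "interior (\<Union>\<T>) \<subseteq> ball (x - q /\<^sub>R Lam) (norm q / Lam)"
    by (metis interior_cball interior_mono)
  then have "x \<in> ball (x - q /\<^sub>R Lam) (norm q / Lam)" using N0_interior[OF xN0] by blast
  then show False using Lam by (simp add: dist_norm divide_inverse mult.commute)
qed

text \<open>Aleksandrov's argument: if the nodal function were far below a tangent plane of the solution,
  every slope in a large ball would be attained at some interior node.\<close>
lemma crude_lower:
  assumes D: "0 < D" "\<And>x y. x \<in> closure \<Omega> \<Longrightarrow> y \<in> closure \<Omega> \<Longrightarrow> dist x y \<le> D"
    and m: "0 < m" "F * measure lborel \<Omega> < unit_ball_vol (CARD('n)) * (m / D) ^ CARD('n)"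
    and z: "z \<in> N0"
  shows "u z - (Lam / 2 * D\<^sup>2 + m) \<le> uh z"
proof -
  obtain x0 where x0: "x0 \<in> \<Omega>" using Omega_ne by blast
  define e where "e = gradient u x0"
  define T where "T = (\<lambda>y. u x0 + e \<bullet> (y - x0))"
  have zc: "z \<in> closure \<Omega>" using z N_closure by blast
  have "T z - m \<le> uh z"
  proof (rule ccontr)
    assume neg: "\<not> T z - m \<le> uh z"
    have "ball e (m / D) \<subseteq> (\<Union>y\<in>N0. nodal_subdifferential N uh y)"
    proof
      fix p assume p: "p \<in> ball e (m / D)"
      obtain y where y: "y \<in> N" "- (uh z - p \<bullet> z) \<le> - (uh y - p \<bullet> y)"
        "\<forall>w\<in>N. - (uh w - p \<bullet> w) \<le> - (uh y - p \<bullet> y)"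
        using finite_max_ex[OF finite_N, of z "\<lambda>y. - (uh y - p \<bullet> y)"] z by blast
      have "y \<in> N0"
      proof (rule ccontr)
        assume "y \<notin> N0"
        then have yb: "y \<in> Nb" using y(1) by simp
        then have "T y \<le> uh y"
          using u_lower[OF x0 Nb_frontier(1)[OF yb]] lam uh_Nb[OF yb] unfolding T_def e_def
          by (smt (verit) mult_nonneg_nonneg divide_nonneg_pos zero_le_power2)
        have "\<bar>(e - p) \<bullet> (y - z)\<bar> \<le> norm (e - p) * norm (y - z)" by (rule Cauchy_Schwarz_ineq2)
        also have "\<dots> \<le> (m / D) * D"
          using p D(2)[OF Nb_frontier(1)[OF yb] zc] D(1) m(1) by (intro mult_mono) (auto simp: dist_norm)
        also have "\<dots> = m" using D(1) by simp
        finally have "- m \<le> (e - p) \<bullet> (y - z)" by linarith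
        moreover have "T y - p \<bullet> y = T z - p \<bullet> z + (e - p) \<bullet> (y - z)"
          by (simp add: T_def algebra_simps inner_diff_left inner_diff_right)
        ultimately show False using \<open>T y \<le> uh y\<close> y(2) neg by linarith
      qed
      moreover have "p \<in> nodal_subdifferential N uh y"
        using y(3) by (force simp: nodal_subdifferential_def inner_diff_right algebra_simps)
      ultimately show "p \<in> (\<Union>y\<in>N0. nodal_subdifferential N uh y)" by blast
    qed
    then have "emeasure lebesgue (ball e (m / D)) \<le> emeasure lebesgue (\<Union>y\<in>N0. nodal_subdifferential N uh y)"
      using finite_N0 by (intro emeasure_mono) (auto intro!: sets.finite_UN sets_nodal_subdifferential)
    also have "\<dots> \<le> (\<Sum>y\<in>N0. emeasure lebesgue (nodal_subdifferential N uh y))"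
      using finite_N0 by (intro emeasure_subadditive_finite) (auto intro: sets_nodal_subdifferential)
    also have "\<dots> = (\<Sum>y\<in>N0. ennreal (fz y))"
      by (intro sum.cong) (auto simp: subdiff_measure)
    also have "\<dots> = ennreal (\<Sum>y\<in>N0. fz y)"
      by (rule sum_ennreal) (rule fz_nonneg)
    also have "\<dots> \<le> ennreal (F * measure lborel \<Omega>)"
      using sum_weighted_hat_le[OF f_cont' f_bounds] by (intro ennreal_leI) auto
    finally have "ennreal (unit_ball_vol (CARD('n)) * (m / D) ^ CARD('n)) \<le> ennreal (F * measure lborel \<Omega>)"
      using m(1) D(1) by (simp add: emeasure_ball)
    then have "unit_ball_vol (CARD('n)) * (m / D) ^ CARD('n) \<le> F * measure lborel \<Omega>"
      using F_nonneg by simp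
    then show False using m(2) by simp
  qed
  moreover have "u z \<le> T z + Lam / 2 * D\<^sup>2"
  proof -
    have "dist z x0 \<le> D" using D(2)[OF zc] x0 closure_subset by blast
    then have "Lam / 2 * (norm (z - x0))\<^sup>2 \<le> Lam / 2 * D\<^sup>2"
      using lam by (intro mult_left_mono power_mono) (auto simp: dist_norm)
    then show ?thesis using u_upper[OF x0 zc] unfolding T_def e_def by linarith
  qed
  ultimately show ?thesis by linarith
qed

end

lemma det_scaleR:
  fixes A :: "real^'n^'n"
  shows "det (c *\<^sub>R A) = c ^ CARD('n) * det A"
proof -
  have "c *\<^sub>R A = (\<chi> i. c *s (A $ i))" by (simp add: vec_eq_iff)
  then show ?thesis using det_rows_mul[of "\<lambda>_. c" "\<lambda>i. A $ i"] by simp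
qed

lemma det_scaled_mono:
  fixes A B :: "real^'n^'n"
  assumes sym: "sym_matrix A" "sym_matrix B" and a: "0 < a" "\<And>v. a * (v \<bullet> v) \<le> v \<bullet> (A *v v)"
    and \<delta>: "0 \<le> \<delta>" and less: "\<And>v. v \<noteq> 0 \<Longrightarrow> (1 + \<delta>) * (v \<bullet> (A *v v)) < v \<bullet> (B *v v)"
  shows "(1 + \<delta>) * \<bar>det A\<bar> \<le> \<bar>det B\<bar>"
proof -
  have "(1 + \<delta>) * \<bar>det A\<bar> \<le> (1 + \<delta>) ^ CARD('n) * \<bar>det A\<bar>"
    using \<delta> by (intro mult_right_mono self_le_power) auto
  also have "\<dots> = \<bar>det ((1 + \<delta>) *\<^sub>R A)\<bar>"
    using \<delta> by (simp add: det_scaleR abs_mult)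
  also have "\<dots> \<le> \<bar>det B\<bar>"
  proof (rule abs_det_mono[OF sym_matrix_simps(3)[OF sym(1)] sym(2) a(1)])
    fix v :: "real^'n"
    have "1 * (a * (v \<bullet> v)) \<le> (1 + \<delta>) * (v \<bullet> (A *v v))"
      using a(2)[of v] a(1) \<delta> by (intro mult_mono) (auto intro: order_trans[OF _ a(2)])
    then show "a * (v \<bullet> v) \<le> v \<bullet> (((1 + \<delta>) *\<^sub>R A) *v v)" by (simp only: quadratic_simps mult_1)
  qed (unfold quadratic_simps, rule less)
  finally show ?thesis .
qed

context ma_problem
begin

text \<open>The barrier jumps down by a multiple of the squared mesh size at the interior nodes. The jump
  absorbs the constraints coming from the boundary nodes, whose position relative to the lattice is
  arbitrary.\<close>
lemma lower_barrier:
  assumes enc: "\<Omega> \<subseteq> cball c R" and K: "0 < K"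
    and big: "ennreal (F * (unit_ball_vol (CARD('n)) * h ^ CARD('n))) < emeasure lebesgue (cell L (mat (2 * K)))"
    and z: "z \<in> N0"
  shows "u z - (81 / 4 * K * (h * CARD('n))\<^sup>2 + K * (R\<^sup>2 - (dist z c)\<^sup>2)) \<le> uh z"
proof (rule ccontr)
  define J where "J = 81 / 4 * K * (h * CARD('n))\<^sup>2"
  define v where "v = (\<lambda>y. if y \<in> N0 then u y - (J + K * (R\<^sup>2 - (dist y c)\<^sup>2)) else u y)"
  assume "\<not> ?thesis"
  then have dz: "0 < v z - uh z" using z by (simp add: v_def J_def)
  obtain x where x: "x \<in> N" "v z - uh z \<le> v x - uh x" "\<forall>y\<in>N. v y - uh y \<le> v x - uh x"
    using finite_max_ex[OF finite_N, of z "\<lambda>y. v y - uh y"] z by blast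
  have enc': "closure \<Omega> \<subseteq> cball c R" using enc by (simp add: closure_minimal)
  have xN0: "x \<in> N0"
    using x(1,2) dz uh_Nb[of x] by (auto simp: v_def split: if_splits)
  then have xO: "x \<in> \<Omega>" using N0_sub by blast
  define e where "e = gradient u x + (2 * K) *\<^sub>R (x - c)"
  have sub: "(+) e ` cell L (mat (2 * K)) \<subseteq> nodal_subdifferential N v x"
  proof clarify
    fix p assume p: "p \<in> cell L (mat (2 * K))"
    have np: "norm p \<le> 9 / 2 * (2 * K) * (h * CARD('n))"
      by (rule cell_norm_bound[where A = "mat (2 * K)", OF cover_L]) (use p K h_pos in \<open>auto simp: cell_def quadratic_simps\<close>)
    have "v x + (e + p) \<bullet> (y - x) \<le> v y" if y: "y \<in> N" for y
    proof -
      have yc: "y \<in> closure \<Omega>" using N_closure y by blast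
      have "lam / 2 * (norm (y - x))\<^sup>2 \<ge> 0" using lam by simp
      then have u: "u x + gradient u x \<bullet> (y - x) \<le> u y" using u_lower[OF xO yc] by linarith
      have sq: "K * (dist y c)\<^sup>2 = K * (dist x c)\<^sup>2 + 2 * K * ((x - c) \<bullet> (y - x)) + K * (norm (y - x))\<^sup>2"
        unfolding square_expand[of y c x] by (simp add: algebra_simps)
      have e: "e \<bullet> (y - x) = gradient u x \<bullet> (y - x) + 2 * K * ((x - c) \<bullet> (y - x))"
        by (simp add: e_def inner_add_left)
      have vx: "v x = u x - J - K * R\<^sup>2 + K * (dist x c)\<^sup>2"
        using xN0 by (simp add: v_def algebra_simps)
      show ?thesis
      proof (cases "y \<in> N0")
        case True
        then have "y - x \<in> L" using xN0 N0_eq discrete_subgroupD(4)[OF subgroup_L] by blast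
        then have "p \<bullet> (y - x) \<le> K * (norm (y - x))\<^sup>2"
          using p by (auto simp: cell_def quadratic_simps dot_square_norm)
        moreover have "v y = u y - J - K * R\<^sup>2 + K * (dist y c)\<^sup>2"
          using True by (simp add: v_def algebra_simps)
        ultimately show ?thesis using u sq e vx unfolding inner_add_left by linarith
      next
        case False
        define t where "t = norm (y - x)"
        have "p \<bullet> (y - x) \<le> norm p * t" unfolding t_def by (rule norm_cauchy_schwarz)
        also have "\<dots> \<le> (9 / 2 * (2 * K) * (h * CARD('n))) * t"
          using np by (intro mult_right_mono) (auto simp: t_def)
        also have "\<dots> \<le> J + K * t\<^sup>2"
        proof -
          have "0 \<le> K * (t - 9 / 2 * (h * CARD('n)))\<^sup>2" using K by simp
          then show ?thesis by (simp add: J_def power2_eq_square algebra_simps)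
        qed
        finally have "p \<bullet> (y - x) \<le> J + K * (norm (y - x))\<^sup>2" by (simp add: t_def)
        moreover have "K * (dist y c)\<^sup>2 \<le> K * R\<^sup>2"
        proof -
          have "dist y c \<le> R" using enc' yc by (auto simp: dist_commute subset_eq)
          then show ?thesis using K by (intro mult_left_mono power_mono) auto
        qed
        moreover have "v y = u y" using False by (simp add: v_def)
        ultimately show ?thesis using u sq e vx unfolding inner_add_left by linarith
      qed
    qed
    then show "e + p \<in> nodal_subdifferential N v x" by (auto simp: nodal_subdifferential_def)
  qed
  also have "\<dots> \<subseteq> nodal_subdifferential N uh x"
    by (rule nodal_subdifferential_mono) (use x(3) in blast)
  finally have "emeasure lebesgue ((+) e ` cell L (mat (2 * K))) \<le> ennreal (fz x)"
    unfolding subdiff_measure[OF xN0, symmetric] by (intro emeasure_mono sets_nodal_subdifferential)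
  also have "\<dots> \<le> ennreal (F * (unit_ball_vol (CARD('n)) * h ^ CARD('n)))"
    using fz_le[OF xN0] by (rule ennreal_leI)
  finally show False using big by (simp add: emeasure_lebesgue_translate)
qed

definition R\<^sub>c :: real where "R\<^sub>c = 36 * (Lam / lam) * CARD('n)"

definition R\<^sub>t :: real where "R\<^sub>t = R\<^sub>c + R\<^sub>d"

lemma R\<^sub>c_ge_1: "1 \<le> R\<^sub>c"
proof -
  have "1 \<le> Lam / lam" using lam by simp
  then have "1 * 1 \<le> (36 * (Lam / lam)) * real CARD('n)" by (intro mult_mono) auto
  then show ?thesis by (simp add: R\<^sub>c_def)
qed

lemma deepD:
  assumes deep: "cball x (R\<^sub>t * h) \<subseteq> \<Omega>"
  shows "cball x (R\<^sub>d * h) \<subseteq> \<Omega>" "cball x (R\<^sub>c * h) \<subseteq> \<Omega>" "cball x h \<subseteq> \<Omega>"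
proof -
  have "1 \<le> R\<^sub>d" using K\<^sub>d_ge_1 by (simp add: R\<^sub>d_def)
  then have "R\<^sub>d * h \<le> R\<^sub>t * h" "R\<^sub>c * h \<le> R\<^sub>t * h" "1 * h \<le> R\<^sub>t * h"
    using R\<^sub>c_ge_1 h_pos unfolding R\<^sub>t_def by (intro mult_right_mono; simp)+
  then show "cball x (R\<^sub>d * h) \<subseteq> \<Omega>" "cball x (R\<^sub>c * h) \<subseteq> \<Omega>" "cball x h \<subseteq> \<Omega>"
    using deep subset_cball[of _ "R\<^sub>t * h" x] by auto
qed

text \<open>The curvature of the quadratic correction, large enough to dominate the consistency error.\<close>
definition \<kappa> :: real where "\<kappa> = (M * (R\<^sub>c + 2) + 3) * h powr \<alpha> / 2"

definition \<tau> :: real where "\<tau> = 2 * \<kappa> - M * (R\<^sub>c * h) powr \<alpha>"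

lemma h_powr_pos: "0 < h powr \<alpha>" using h_pos by simp

lemma kappa_nonneg: "0 \<le> \<kappa>"
  using M_nonneg R\<^sub>c_ge_1 by (simp add: \<kappa>_def)

lemma tau_bounds: "(2 * M + 3) * h powr \<alpha> \<le> \<tau>" "\<tau> \<le> 2 * \<kappa>"
proof -
  have "(R\<^sub>c * h) powr \<alpha> = R\<^sub>c powr \<alpha> * h powr \<alpha>"
    using R\<^sub>c_ge_1 h_pos by (simp add: powr_mult)
  moreover have "R\<^sub>c powr \<alpha> \<le> R\<^sub>c"
    using powr_mono[of \<alpha> 1 R\<^sub>c] alpha R\<^sub>c_ge_1 by simp
  ultimately have "M * (R\<^sub>c * h) powr \<alpha> \<le> M * (R\<^sub>c * h powr \<alpha>)"
    using M_nonneg h_powr_pos by (intro mult_left_mono) auto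
  then show "(2 * M + 3) * h powr \<alpha> \<le> \<tau>" unfolding \<tau>_def \<kappa>_def by (simp add: algebra_simps)
  show "\<tau> \<le> 2 * \<kappa>" unfolding \<tau>_def using M_nonneg by simp
qed

lemma tau_ge_h: "h powr \<alpha> \<le> \<tau>"
proof -
  have "1 * h powr \<alpha> \<le> (2 * M + 3) * h powr \<alpha>" using M_nonneg by (intro mult_right_mono) auto
  then show ?thesis using tau_bounds(1) by linarith
qed

lemma tau_gap: "M * h powr \<alpha> + 2 * h powr \<alpha> < \<tau>"
proof -
  have "(2 * M + 3) * h powr \<alpha> = 2 * (M * h powr \<alpha>) + 3 * h powr \<alpha>" by (simp add: algebra_simps)
  moreover have "0 \<le> M * h powr \<alpha>" using M_nonneg by simp
  ultimately show ?thesis using tau_bounds(1) h_powr_pos by linarith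
qed

lemma hat_vol_pos: "z \<in> N0 \<Longrightarrow> 0 < hat_vol z"
proof -
  assume z: "z \<in> N0"
  have "0 < unit_ball_vol (CARD('n)) / 2 * (\<gamma> * h / (8 * \<sigma>)) ^ CARD('n)"
    using gamma_pos h_pos sigma_pos(1)[OF z] by simp
  then show ?thesis using hat_vol_ge[OF z] by linarith
qed

lemma deep_lower:
  assumes small: "2 * \<kappa> \<le> lam / 2" and E: "0 \<le> E"
    and layer: "\<And>z. z \<in> N0 \<Longrightarrow> \<not> cball z (R\<^sub>t * h) \<subseteq> \<Omega> \<Longrightarrow> u z - E \<le> uh z"
    and D: "closure \<Omega> \<subseteq> cball x0 D"
    and z: "z \<in> N0"
  shows "u z - (E + \<kappa> * D\<^sup>2) \<le> uh z"
proof -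
  define v where "v = (\<lambda>y. u y - E - \<kappa> * (D\<^sup>2 - (dist y x0)\<^sup>2))"
  have v_le: "v y \<le> u y - E" if "y \<in> N" for y
  proof -
    have "dist y x0 \<le> D" using N_closure[OF that] D by (auto simp: dist_commute subset_eq)
    then have "(dist y x0)\<^sup>2 \<le> D\<^sup>2" by (simp add: power_mono)
    then show ?thesis using kappa_nonneg by (simp add: v_def)
  qed
  have "v z \<le> uh z"
  proof (rule ccontr)
    assume "\<not> v z \<le> uh z"
    then have dz: "0 < v z - uh z" by simp
    obtain x where x: "x \<in> N" "v z - uh z \<le> v x - uh x" "\<forall>y\<in>N. v y - uh y \<le> v x - uh x"
      using finite_max_ex[OF finite_N, of z "\<lambda>y. v y - uh y"] z by blast
    have xN0: "x \<in> N0" using v_le[OF x(1)] E x(1,2) dz uh_Nb[of x] by auto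
    have deep: "cball x (R\<^sub>t * h) \<subseteq> \<Omega>"
      using v_le[OF x(1)] layer[OF xN0] x(2) dz by linarith
    have xO: "x \<in> \<Omega>" using xN0 N0_sub by blast
    define A where "A = hessian u x + mat \<tau>"
    define e where "e = gradient u x + (2 * \<kappa>) *\<^sub>R (x - x0)"
    have tau: "0 < \<tau>" "\<tau> \<le> lam / 2"
      using tau_ge_h tau_bounds(2) small h_powr_pos by linarith+
    have symA: "sym_matrix A" unfolding A_def by (intro sym_matrix_simps sym_hessian[OF xO])
    have Alow: "lam * (w \<bullet> w) \<le> w \<bullet> (A *v w)" for w
      unfolding A_def quadratic_simps using hessian_bounds(1)[OF xO, of w] tau by (simp add: add_increasing2)
    have Aup: "w \<bullet> (A *v w) \<le> (2 * Lam) * (w \<bullet> w)" for w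
    proof -
      have "\<tau> * (w \<bullet> w) \<le> Lam * (w \<bullet> w)" using tau lam by (intro mult_right_mono) auto
      then show ?thesis unfolding A_def quadratic_simps using hessian_bounds(2)[OF xO, of w] by simp
    qed
    have sub: "(+) e ` cell L A \<subseteq> nodal_subdifferential N v x"
    proof clarify
      fix p assume p: "p \<in> cell L A"
      have np: "norm p \<le> 9 / 2 * (2 * Lam) * (h * CARD('n))"
        by (rule cell_norm_bound[OF cover_L _ _ Aup]) (use p lam h_pos in \<open>auto simp: cell_def\<close>)
      have "v x + (e + p) \<bullet> (y - x) \<le> v y" if y: "y \<in> N" for y
      proof -
        have yc: "y \<in> closure \<Omega>" using N_closure y by blast
        have sq: "\<kappa> * (dist y x0)\<^sup>2 = \<kappa> * (dist x x0)\<^sup>2 + 2 * \<kappa> * ((x - x0) \<bullet> (y - x)) + \<kappa> * (norm (y - x))\<^sup>2"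
          unfolding square_expand[of y x0 x] by (simp add: algebra_simps)
        have e: "e \<bullet> (y - x) = gradient u x \<bullet> (y - x) + 2 * \<kappa> * ((x - x0) \<bullet> (y - x))"
          by (simp add: e_def inner_add_left)
        have vy: "v y = u y - E - \<kappa> * D\<^sup>2 + \<kappa> * (dist y x0)\<^sup>2" and vx: "v x = u x - E - \<kappa> * D\<^sup>2 + \<kappa> * (dist x x0)\<^sup>2"
          by (simp_all add: v_def algebra_simps)
        have main: "p \<bullet> (y - x) \<le> u y - u x - gradient u x \<bullet> (y - x) + \<kappa> * (norm (y - x))\<^sup>2"
        proof (cases "dist x y \<le> R\<^sub>c * h")
          case True
          then have yO: "y \<in> \<Omega>" using deepD(2)[OF deep] by auto
          then have "y \<in> N0" using y Nb_frontier(2) by blast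
          then have "y - x \<in> L" using xN0 N0_eq discrete_subgroupD(4)[OF subgroup_L] by blast
          then have "p \<bullet> (y - x) \<le> ((y - x) \<bullet> (A *v (y - x))) / 2" using p by (simp add: cell_def)
          also have "\<dots> = ((y - x) \<bullet> (hessian u x *v (y - x)) - M * (R\<^sub>c * h) powr \<alpha> * ((y - x) \<bullet> (y - x))) / 2
              + \<kappa> * (norm (y - x))\<^sup>2"
            unfolding A_def quadratic_simps by (simp add: \<tau>_def dot_square_norm field_simps)
          also have "\<dots> \<le> u y - u x - gradient u x \<bullet> (y - x) + \<kappa> * (norm (y - x))\<^sup>2"
            using u_taylor(1)[OF xO yO True] by linarith
          finally show ?thesis .
        next
          case False
          then have far: "R\<^sub>c * h \<le> norm (y - x)" by (simp add: dist_norm norm_minus_commute)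
          have "p \<bullet> (y - x) \<le> norm p * norm (y - x)" by (rule norm_cauchy_schwarz)
          also have "\<dots> \<le> (9 / 2 * (2 * Lam) * (h * CARD('n))) * norm (y - x)"
            using np by (intro mult_right_mono) auto
          also have "\<dots> \<le> (lam / 2 * norm (y - x)) * norm (y - x)"
          proof (rule mult_right_mono)
            have "9 / 2 * (2 * Lam) * (h * CARD('n)) \<le> 18 * Lam * (h * CARD('n))"
              using lam h_pos by (intro mult_right_mono) auto
            also have "\<dots> = lam / 2 * (R\<^sub>c * h)" using lam by (simp add: R\<^sub>c_def)
            also have "\<dots> \<le> lam / 2 * norm (y - x)" using far lam by (intro mult_left_mono) auto
            finally show "9 / 2 * (2 * Lam) * (h * CARD('n)) \<le> lam / 2 * norm (y - x)" .
          qed simp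
          also have "\<dots> \<le> u y - u x - gradient u x \<bullet> (y - x)"
            using u_lower[OF xO yc] by (simp add: power2_eq_square)
          also have "\<dots> \<le> u y - u x - gradient u x \<bullet> (y - x) + \<kappa> * (norm (y - x))\<^sup>2"
            using kappa_nonneg by simp
          finally show ?thesis .
        qed
        show ?thesis using main sq e unfolding vy vx inner_add_left by linarith
      qed
      then show "e + p \<in> nodal_subdifferential N v x" by (auto simp: nodal_subdifferential_def)
    qed
    also have "\<dots> \<subseteq> nodal_subdifferential N uh x"
      by (rule nodal_subdifferential_mono) (use x(3) in blast)
    finally have "emeasure lebesgue ((+) e ` cell L A) \<le> ennreal (fz x)"
      unfolding subdiff_measure[OF xN0, symmetric] by (intro emeasure_mono sets_nodal_subdifferential)
    moreover have "ennreal (\<bar>det A\<bar> * hat_vol x) \<le> emeasure lebesgue (cell L A)"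
      using lam by (intro emeasure_cell_hat(2)[OF xN0 deepD(1)[OF deep] symA lam(1) Alow _ Aup]) simp
    ultimately have ge: "ennreal (\<bar>det A\<bar> * hat_vol x) \<le> ennreal (fz x)"
      unfolding emeasure_lebesgue_translate by (rule order_trans[rotated])
    define \<delta> where "\<delta> = h powr \<alpha> / Lam"
    have del: "0 < \<delta>" using h_powr_pos lam by (simp add: \<delta>_def)
    have "(1 + \<delta>) * f y \<le> \<bar>det A\<bar>" if y: "dist x y \<le> h" for y
    proof -
      have yO: "y \<in> \<Omega>" using deepD(3)[OF deep] y by auto
      show ?thesis unfolding f_det[OF yO]
      proof (rule det_scaled_mono[OF sym_hessian[OF yO] symA lam(1) hessian_bounds(1)[OF yO]])
        fix w :: "real^'n" assume "w \<noteq> 0"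
        then have w: "0 < w \<bullet> w" by simp
        have "w \<bullet> (hessian u y *v w) \<le> w \<bullet> (hessian u x *v w) + M * h powr \<alpha> * (w \<bullet> w)"
          using hessian_holder_quadratic[OF xO yO y, of w] by linarith
        moreover have "\<delta> * (w \<bullet> (hessian u y *v w)) \<le> h powr \<alpha> * (w \<bullet> w)"
          using mult_left_mono[OF hessian_bounds(2)[OF yO, of w], of \<delta>] del lam by (simp add: \<delta>_def)
        moreover have "M * h powr \<alpha> * (w \<bullet> w) + h powr \<alpha> * (w \<bullet> w) < \<tau> * (w \<bullet> w)"
        proof -
          have "M * h powr \<alpha> + h powr \<alpha> < \<tau>" using tau_gap h_powr_pos by linarith
          then show ?thesis using w by (simp add: distrib_right[symmetric])
        qed
        ultimately show "(1 + \<delta>) * (w \<bullet> (hessian u y *v w)) < w \<bullet> (A *v w)"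
          unfolding A_def quadratic_simps distrib_right by linarith
      qed (use del in simp)
    qed
    then have fb: "f y \<le> \<bar>det A\<bar> / (1 + \<delta>)" if "dist x y \<le> h" for y
      using that del by (simp add: pos_le_divide_eq mult.commute)
    have detA: "0 < \<bar>det A\<bar>" using pos_def_det_nonzero[OF lam(1) Alow] by simp
    have "fz x \<le> \<bar>det A\<bar> / (1 + \<delta>) * hat_vol x"
      by (rule weighted_hat_le[OF xN0 f_cont' f_bounds]) (use fb del in auto)
    also have "\<dots> < \<bar>det A\<bar> * hat_vol x"
      using detA del hat_vol_pos[OF xN0] by (intro mult_strict_right_mono) (auto simp: field_simps)
    finally have "fz x < \<bar>det A\<bar> * hat_vol x" .
    moreover have "0 < \<bar>det A\<bar> * hat_vol x" using detA hat_vol_pos[OF xN0] by simp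
    ultimately show False using ge by (simp add: ennreal_le_iff2)
  qed
  moreover have "u z - (E + \<kappa> * D\<^sup>2) \<le> v z"
    using kappa_nonneg by (simp add: v_def algebra_simps)
  ultimately show ?thesis by linarith
qed

lemma deep_upper:
  assumes small: "2 * \<kappa> \<le> lam / 2" and E: "0 \<le> E"
    and layer: "\<And>z. z \<in> N0 \<Longrightarrow> \<not> cball z (R\<^sub>t * h) \<subseteq> \<Omega> \<Longrightarrow> uh z \<le> u z + E"
    and D: "closure \<Omega> \<subseteq> cball x0 D"
    and z: "z \<in> N0"
  shows "uh z \<le> u z + (E + \<kappa> * D\<^sup>2)"
proof -
  define v where "v = (\<lambda>y. u y + E + \<kappa> * (D\<^sup>2 - (dist y x0)\<^sup>2))"
  have v_ge: "u y + E \<le> v y" if "y \<in> N" for y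
  proof -
    have "dist y x0 \<le> D" using N_closure[OF that] D by (auto simp: dist_commute subset_eq)
    then have "(dist y x0)\<^sup>2 \<le> D\<^sup>2" by (simp add: power_mono)
    then show ?thesis using kappa_nonneg by (simp add: v_def)
  qed
  have "uh z \<le> v z"
  proof (rule ccontr)
    assume "\<not> uh z \<le> v z"
    then have dz: "0 < uh z - v z" by simp
    obtain x where x: "x \<in> N" "uh z - v z \<le> uh x - v x" "\<forall>y\<in>N. uh y - v y \<le> uh x - v x"
      using finite_max_ex[OF finite_N, of z "\<lambda>y. uh y - v y"] z by blast
    have xN0: "x \<in> N0" using v_ge[OF x(1)] E x(1,2) dz uh_Nb[of x] by auto
    have deep: "cball x (R\<^sub>t * h) \<subseteq> \<Omega>"
      using v_ge[OF x(1)] layer[OF xN0] x(2) dz by linarith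
    have xO: "x \<in> \<Omega>" using xN0 N0_sub by blast
    define A where "A = hessian u x + mat (- \<tau>)"
    define A' where "A' = hessian u x + mat (- (\<tau> - h powr \<alpha>))"
    define e where "e = gradient u x - (2 * \<kappa>) *\<^sub>R (x - x0)"
    have tau: "0 < \<tau>" "\<tau> \<le> lam / 2" "h powr \<alpha> \<le> \<tau>"
      using tau_ge_h tau_bounds(2) small h_powr_pos by linarith+
    have symA': "sym_matrix A'" unfolding A'_def by (intro sym_matrix_simps sym_hessian[OF xO])
    have Alow: "lam / 2 * (w \<bullet> w) \<le> w \<bullet> (A *v w)" for w
    proof -
      have "\<tau> * (w \<bullet> w) \<le> lam / 2 * (w \<bullet> w)" using tau by (intro mult_right_mono) auto
      then show ?thesis unfolding A_def quadratic_simps using hessian_bounds(1)[OF xO, of w] by simp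
    qed
    have Aup: "w \<bullet> (A *v w) \<le> (2 * Lam) * (w \<bullet> w)" for w
    proof -
      have "0 \<le> \<tau> * (w \<bullet> w)" "0 \<le> Lam * (w \<bullet> w)" using tau lam by simp_all
      then show ?thesis unfolding A_def quadratic_simps using hessian_bounds(2)[OF xO, of w] by simp
    qed
    have AA': "w \<bullet> (A' *v w) = w \<bullet> (A *v w) + h powr \<alpha> * (w \<bullet> w)" for w
      unfolding A_def A'_def quadratic_simps by (simp add: algebra_simps)
    have A'low: "lam / 2 * (w \<bullet> w) \<le> w \<bullet> (A' *v w)" for w
    proof -
      have "0 \<le> h powr \<alpha> * (w \<bullet> w)" by simp
      then show ?thesis unfolding AA' using Alow[of w] by linarith
    qed
    have A'up: "w \<bullet> (A' *v w) \<le> Lam * (w \<bullet> w)" for w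
    proof -
      have "0 \<le> (\<tau> - h powr \<alpha>) * (w \<bullet> w)" using tau by simp
      then show ?thesis unfolding A'_def quadratic_simps mult_minus_left
        using hessian_bounds(2)[OF xO, of w] by linarith
    qed
    have "nodal_subdifferential N uh x \<subseteq> nodal_subdifferential N v x"
      by (rule nodal_subdifferential_mono) (use x(3) in blast)
    also have "\<dots> \<subseteq> (+) e ` open_cell L A'"
    proof
      fix q assume q: "q \<in> nodal_subdifferential N v x"
      define p where "p = q - e"
      have "p \<in> cell L A"
      proof (rule cell_local[OF cover_L _ _ _ Alow Aup])
        fix l assume l: "l \<in> L" "norm l \<le> 9 * (2 * Lam) / (lam / 2) * (h * CARD('n))"
        then have nl: "norm l \<le> R\<^sub>c * h" using lam by (simp add: R\<^sub>c_def field_simps)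
        define y where "y = x + l"
        have dxy: "dist x y \<le> R\<^sub>c * h" using nl by (simp add: y_def dist_norm)
        have yO: "y \<in> \<Omega>" using deepD(2)[OF deep] dxy by auto
        have yN: "y \<in> N"
          using yO xN0 l(1) N0_eq discrete_subgroupD(2)[OF subgroup_L] by (auto simp: y_def)
        have sq: "\<kappa> * (dist y x0)\<^sup>2 = \<kappa> * (dist x x0)\<^sup>2 + 2 * \<kappa> * ((x - x0) \<bullet> (y - x)) + \<kappa> * (norm (y - x))\<^sup>2"
          unfolding square_expand[of y x0 x] by (simp add: algebra_simps)
        have e: "e \<bullet> (y - x) = gradient u x \<bullet> (y - x) - 2 * \<kappa> * ((x - x0) \<bullet> (y - x))"
          by (simp add: e_def inner_diff_left)
        have "v x + q \<bullet> (y - x) \<le> v y" using q yN unfolding nodal_subdifferential_def by blast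
        then have "q \<bullet> (y - x) \<le> v y - v x" by linarith
        also have "\<dots> = u y - u x - \<kappa> * (dist y x0)\<^sup>2 + \<kappa> * (dist x x0)\<^sup>2" by (simp add: v_def algebra_simps)
        finally have "p \<bullet> (y - x) \<le> u y - u x - gradient u x \<bullet> (y - x) - \<kappa> * (norm (y - x))\<^sup>2"
          unfolding p_def inner_diff_left using sq e by linarith
        also have "\<dots> \<le> ((y - x) \<bullet> (hessian u x *v (y - x)) + M * (R\<^sub>c * h) powr \<alpha> * ((y - x) \<bullet> (y - x))) / 2
            - \<kappa> * (norm (y - x))\<^sup>2"
          using u_taylor(2)[OF xO yO dxy] by linarith
        also have "\<dots> = ((y - x) \<bullet> (A *v (y - x))) / 2"
          unfolding A_def quadratic_simps by (simp add: \<tau>_def dot_square_norm field_simps)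
        finally show "p \<bullet> l \<le> (l \<bullet> (A *v l)) / 2" by (simp add: y_def)
      qed (use lam h_pos in auto)
      have "p \<in> open_cell L A'"
        unfolding open_cell_def
      proof (intro CollectI ballI)
        fix l assume l: "l \<in> L - {0}"
        then have "0 < h powr \<alpha> * (l \<bullet> l)" by (intro mult_pos_pos h_powr_pos) auto
        then have "(l \<bullet> (A *v l)) / 2 < (l \<bullet> (A' *v l)) / 2" unfolding AA' by simp
        moreover have "p \<bullet> l \<le> (l \<bullet> (A *v l)) / 2" using \<open>p \<in> cell L A\<close> l by (simp add: cell_def)
        ultimately show "p \<bullet> l < (l \<bullet> (A' *v l)) / 2" by (rule le_less_trans[rotated])
      qed
      then show "q \<in> (+) e ` open_cell L A'" by (intro image_eqI[of _ _ p]) (simp_all add: p_def)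
    qed
    finally have sub: "nodal_subdifferential N uh x \<subseteq> (+) e ` open_cell L A'" .
    have "ennreal (fz x) \<le> emeasure lebesgue ((+) e ` open_cell L A')"
      unfolding subdiff_measure[OF xN0, symmetric]
    proof (rule emeasure_mono[OF sub])
      have "open_cell L A' = (\<Inter>l\<in>L - {0}. {p. l \<bullet> p < (l \<bullet> (A' *v l)) / 2}) \<inter> UNIV"
        by (auto simp: open_cell_def inner_commute)
      moreover have "(\<Inter>l\<in>L - {0}. {p. l \<bullet> p < (l \<bullet> (A' *v l)) / 2}) \<in> sets borel"
        using countable_discrete_subgroup[OF subgroup_L]
        by (intro sets.countable_INT'') (auto intro: borel_open open_halfspace_lt)
      ultimately have "open_cell L A' \<in> sets lebesgue" by simp
      then show "(+) e ` open_cell L A' \<in> sets lebesgue" by (rule lebesgue_sets_translation)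
    qed
    also have "\<dots> \<le> ennreal (\<bar>det A'\<bar> * hat_vol x)"
      unfolding emeasure_lebesgue_translate
      using lam by (intro emeasure_cell_hat(1)[OF xN0 deepD(1)[OF deep] symA' _ A'low]) simp
    finally have le: "fz x \<le> \<bar>det A'\<bar> * hat_vol x"
      using hat_vol_pos[OF xN0] by simp
    define \<delta> where "\<delta> = h powr \<alpha> / Lam"
    have del: "0 < \<delta>" using h_powr_pos lam by (simp add: \<delta>_def)
    have fb: "(1 + \<delta>) * \<bar>det A'\<bar> \<le> f y" if y: "dist x y \<le> h" for y
    proof -
      have yO: "y \<in> \<Omega>" using deepD(3)[OF deep] y by auto
      show ?thesis unfolding f_det[OF yO]
      proof (rule det_scaled_mono[OF symA' sym_hessian[OF yO] _ A'low])
        fix w :: "real^'n" assume "w \<noteq> 0"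
        then have w: "0 < w \<bullet> w" by simp
        have "w \<bullet> (hessian u x *v w) - M * h powr \<alpha> * (w \<bullet> w) \<le> w \<bullet> (hessian u y *v w)"
          using hessian_holder_quadratic[OF xO yO y, of w] by linarith
        moreover have "\<delta> * (w \<bullet> (A' *v w)) \<le> h powr \<alpha> * (w \<bullet> w)"
          using mult_left_mono[OF A'up[of w], of \<delta>] del lam by (simp add: \<delta>_def)
        moreover have "M * h powr \<alpha> * (w \<bullet> w) + h powr \<alpha> * (w \<bullet> w) < (\<tau> - h powr \<alpha>) * (w \<bullet> w)"
        proof -
          have "M * h powr \<alpha> + h powr \<alpha> < \<tau> - h powr \<alpha>" using tau_gap by linarith
          then show ?thesis using w by (simp add: distrib_right[symmetric])
        qed
        ultimately show "(1 + \<delta>) * (w \<bullet> (A' *v w)) < w \<bullet> (hessian u y *v w)"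
          using quadratic_simps(1)[of w "hessian u x" "- (\<tau> - h powr \<alpha>)"]
          unfolding A'_def[symmetric] distrib_right mult_1 mult_minus_left by linarith
      qed (use del lam in auto)
    qed
    have detA: "0 < \<bar>det A'\<bar>" using pos_def_det_nonzero[OF _ A'low] lam by simp
    have "\<bar>det A'\<bar> * hat_vol x < (1 + \<delta>) * \<bar>det A'\<bar> * hat_vol x"
      using detA del hat_vol_pos[OF xN0] by (intro mult_strict_right_mono) auto
    also have "\<dots> \<le> fz x"
      by (rule weighted_hat_ge[OF xN0 f_cont' f_bounds deepD(3)[OF deep] fb]) auto
    finally show False using le by simp
  qed
  moreover have "v z \<le> u z + (E + \<kappa> * D\<^sup>2)"
    using kappa_nonneg by (simp add: v_def algebra_simps)
  ultimately show ?thesis by linarith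
qed

end

section \<open>The error estimate\<close>

context ma_problem
begin

lemma layer_frontier:
  assumes "z \<in> N0" "\<not> cball z r \<subseteq> \<Omega>" "0 \<le> r"
  shows "\<exists>z0\<in>frontier \<Omega>. dist z z0 \<le> r"
proof -
  have "cball z r \<inter> frontier \<Omega> \<noteq> {}"
  proof (rule connected_Int_frontier)
    have "z \<in> cball z r \<inter> \<Omega>" using assms N0_sub by auto
    then show "cball z r \<inter> \<Omega> \<noteq> {}" by blast
  qed (use assms in auto)
  then show ?thesis by auto
qed

lemma enclosing_gap:
  assumes c: "dist c z0 = R" "\<Omega> \<subseteq> cball c R" and z: "z \<in> N0" "dist z z0 \<le> \<rho>"
  shows "R\<^sup>2 - (dist z c)\<^sup>2 \<le> 2 * R * \<rho>"
proof -
  have R: "dist z c \<le> R" using c(2) z(1) N0_sub by (auto simp: dist_commute)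
  have "R - dist z c \<le> \<rho>" using dist_triangle[of c z0 z] c(1) z(2) by (simp add: dist_commute)
  then have "(R - dist z c) * (R + dist z c) \<le> \<rho> * (2 * R)"
    using R by (intro mult_mono) (auto intro: order_trans[OF _ z(2)] add_nonneg_nonneg order_trans[OF zero_le_dist R])
  then show ?thesis by (simp add: power2_eq_square algebra_simps)
qed

lemma nodal_error_coarse:
  assumes D: "0 < D" "\<And>x y. x \<in> closure \<Omega> \<Longrightarrow> y \<in> closure \<Omega> \<Longrightarrow> dist x y \<le> D"
    and m: "0 < m" "F * measure lborel \<Omega> < unit_ball_vol (CARD('n)) * (m / D) ^ CARD('n)"
    and enc: "\<Omega> \<subseteq> cball c R" and z: "z \<in> N0"
  shows "\<bar>uh z - u z\<bar> \<le> Lam * R\<^sup>2 + Lam / 2 * D\<^sup>2 + m"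
proof -
  have "0 \<le> Lam * R\<^sup>2" "0 \<le> Lam / 2 * D\<^sup>2" using lam by simp_all
  moreover have "Lam * (R\<^sup>2 - (dist z c)\<^sup>2) \<le> Lam * R\<^sup>2" using lam by (intro mult_left_mono) auto
  ultimately show ?thesis
    using crude_lower[OF D m z] upper_barrier[OF enc z] m(1) by linarith
qed

lemma nodal_error_fine:
  assumes small: "2 * \<kappa> \<le> lam / 2" and R: "0 < R"
    and enc: "\<And>z0. z0 \<in> frontier \<Omega> \<Longrightarrow> \<exists>c. dist c z0 = R \<and> \<Omega> \<subseteq> cball c R"
    and K: "0 < K"
    and big: "ennreal (F * (unit_ball_vol (CARD('n)) * h ^ CARD('n))) < emeasure lebesgue (cell L (mat (2 * K)))"
    and D: "closure \<Omega> \<subseteq> cball x0 D" and z: "z \<in> N0"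
  shows "\<bar>uh z - u z\<bar> \<le> (2 * Lam + 2 * K) * R * (R\<^sub>t * h) + 81 / 4 * K * (h * CARD('n))\<^sup>2 + \<kappa> * D\<^sup>2"
proof -
  define E where "E = (2 * Lam + 2 * K) * R * (R\<^sub>t * h) + 81 / 4 * K * (h * CARD('n))\<^sup>2"
  have Rt: "0 \<le> R\<^sub>t * h" using R\<^sub>c_ge_1 K\<^sub>d_ge_1 h_pos by (simp add: R\<^sub>t_def R\<^sub>d_def)
  have Lam: "0 < Lam" using lam by simp
  have 0: "0 \<le> Lam * (2 * R * (R\<^sub>t * h))" "0 \<le> K * (2 * R * (R\<^sub>t * h))" "0 \<le> 81 / 4 * K * (h * CARD('n))\<^sup>2"
    using Rt Lam K R by (auto intro!: mult_nonneg_nonneg)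
  have E_eq: "E = Lam * (2 * R * (R\<^sub>t * h)) + K * (2 * R * (R\<^sub>t * h)) + 81 / 4 * K * (h * CARD('n))\<^sup>2"
    unfolding E_def by (simp add: algebra_simps)
  have layer: "uh z \<le> u z + E" "u z - E \<le> uh z" if z: "z \<in> N0" "\<not> cball z (R\<^sub>t * h) \<subseteq> \<Omega>" for z
  proof -
    obtain z0 where z0: "z0 \<in> frontier \<Omega>" "dist z z0 \<le> R\<^sub>t * h" using layer_frontier[OF z Rt] by blast
    obtain c where c: "dist c z0 = R" "\<Omega> \<subseteq> cball c R" using enc[OF z0(1)] by blast
    note gap = enclosing_gap[OF c z(1) z0(2)]
    have "Lam * (R\<^sup>2 - (dist z c)\<^sup>2) \<le> Lam * (2 * R * (R\<^sub>t * h))" using gap Lam by (intro mult_left_mono) auto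
    then show "uh z \<le> u z + E" using upper_barrier[OF c(2) z(1)] 0 E_eq by linarith
    have "K * (R\<^sup>2 - (dist z c)\<^sup>2) \<le> K * (2 * R * (R\<^sub>t * h))" using gap K by (intro mult_left_mono) auto
    then show "u z - E \<le> uh z" using lower_barrier[OF c(2) K big z(1)] 0 E_eq by linarith
  qed
  have E: "0 \<le> E" using 0 E_eq by linarith
  show ?thesis
    using deep_upper[OF small E layer(1) D z] deep_lower[OF small E layer(2) D z] unfolding E_def by linarith
qed

lemma cell_big:
  assumes z: "z \<in> N0" and deep: "cball z (R\<^sub>d * h) \<subseteq> \<Omega>" and K: "0 < K"
    and big: "2 * F < (K * \<gamma> / (4 * \<sigma>)) ^ CARD('n)"
  shows "ennreal (F * (unit_ball_vol (CARD('n)) * h ^ CARD('n))) < emeasure lebesgue (cell L (mat (2 * K)))"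
proof -
  have pos: "0 < unit_ball_vol (CARD('n)) * h ^ CARD('n) / 2" using h_pos by simp
  have s: "0 < \<sigma>" using sigma_pos(1)[OF z] .
  have det: "\<bar>det (mat (2 * K) :: real^'n^'n)\<bar> = (2 * K) ^ CARD('n)"
  proof -
    have "(mat (2 * K) :: real^'n^'n) = (2 * K) *\<^sub>R mat 1" by (simp add: vec_eq_iff mat_def)
    then show ?thesis using K by (simp add: det_scaleR)
  qed
  have "F * (unit_ball_vol (CARD('n)) * h ^ CARD('n)) = 2 * F * (unit_ball_vol (CARD('n)) * h ^ CARD('n) / 2)"
    by simp
  also have "\<dots> < (K * \<gamma> / (4 * \<sigma>)) ^ CARD('n) * (unit_ball_vol (CARD('n)) * h ^ CARD('n) / 2)"
    using big pos by (rule mult_strict_right_mono)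
  also have "\<dots> = (2 * K) ^ CARD('n) * (unit_ball_vol (CARD('n)) / 2 * (\<gamma> * h / (8 * \<sigma>)) ^ CARD('n))"
  proof -
    have "(2 * K) ^ CARD('n) * (\<gamma> * h / (8 * \<sigma>)) ^ CARD('n) = (K * \<gamma> / (4 * \<sigma>)) ^ CARD('n) * h ^ CARD('n)"
      unfolding power_mult_distrib[symmetric] using s by (simp add: field_simps)
    then show ?thesis by (simp add: algebra_simps)
  qed
  also have "\<dots> \<le> (2 * K) ^ CARD('n) * hat_vol z"
    using hat_vol_ge[OF z] K by (intro mult_left_mono) auto
  finally have "F * (unit_ball_vol (CARD('n)) * h ^ CARD('n)) < (2 * K) ^ CARD('n) * hat_vol z" .
  then have "ennreal (F * (unit_ball_vol (CARD('n)) * h ^ CARD('n))) < ennreal ((2 * K) ^ CARD('n) * hat_vol z)"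
    using F_nonneg h_pos by (subst ennreal_less_iff) auto
  also have "\<dots> \<le> emeasure lebesgue (cell L (mat (2 * K)))"
    unfolding det[symmetric]
    by (rule emeasure_cell_hat(2)[OF z deep sym_matrix_simps(1), where a = "2 * K" and b = "2 * K"])
       (use K in \<open>auto simp: quadratic_simps\<close>)
  finally show ?thesis .
qed

lemma deep_node_ex:
  assumes x: "cball x r \<subseteq> \<Omega>" and h: "h * (R\<^sub>t + CARD('n)) \<le> r"
  shows "\<exists>z\<in>N0. cball z (R\<^sub>t * h) \<subseteq> \<Omega>"
proof -
  obtain l where l: "l \<in> L" "dist x l \<le> h * CARD('n)" using cover_L by blast
  have Rt: "0 \<le> R\<^sub>t * h" using R\<^sub>c_ge_1 K\<^sub>d_ge_1 h_pos by (simp add: R\<^sub>t_def R\<^sub>d_def)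
  have sub: "cball l (R\<^sub>t * h) \<subseteq> \<Omega>"
  proof
    fix w assume "w \<in> cball l (R\<^sub>t * h)"
    then have "dist x w \<le> h * CARD('n) + R\<^sub>t * h" using l(2) dist_triangle[of x w l] by simp
    then show "w \<in> \<Omega>" using x h by (auto simp: algebra_simps subset_eq)
  qed
  then have "l \<in> N0" using l(1) N0_eq Rt by auto
  then show ?thesis using sub by blast
qed

abbreviation "minorants x \<equiv> {f x |f. affine_fun f \<and> (\<forall>y\<in>N. f y \<le> uh y)}"

lemma minorants_ne: "minorants x \<noteq> {}"
proof -
  have "affine_fun (\<lambda>_::real^'n. Min (uh ` N))" unfolding affine_fun_def
    by (intro exI[of _ 0] exI[of _ "Min (uh ` N)"]) simp
  moreover have "\<forall>y\<in>N. Min (uh ` N) \<le> uh y" using finite_N by (auto intro!: Min_le)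
  ultimately show ?thesis by blast
qed

lemma minorants_le:
  assumes E: "\<And>y. y \<in> N \<Longrightarrow> \<bar>uh y - u y\<bar> \<le> E" and d: "\<And>T. T \<in> \<T> \<Longrightarrow> diameter T \<le> d"
    and T: "T \<in> \<T>" and x: "x \<in> T" "x \<in> \<Omega>" and r: "r \<in> minorants x"
  shows "r \<le> u x + E + Lam / 2 * d\<^sup>2"
proof -
  obtain f where f: "affine_fun f" "\<And>y. y \<in> N \<Longrightarrow> f y \<le> uh y" "r = f x" using r by blast
  obtain t where t: "\<forall>v\<in>vert T. 0 \<le> t v" "sum t (vert T) = 1" "x = (\<Sum>v\<in>vert T. t v *\<^sub>R v)"
    using barycentric[OF T x(1)] by blast
  have fv: "f v \<le> u x + gradient u x \<bullet> (v - x) + (E + Lam / 2 * d\<^sup>2)" if v: "v \<in> vert T" for v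
  proof -
    have vN: "v \<in> N" using v vert_T(3)[OF T] by blast
    have "v \<in> T" using v vert_T(4)[OF T] by blast
    then have "dist v x \<le> d"
      using diameter_bounded_bound[OF compact_imp_bounded[OF compact_T[OF T]] _ x(1)] d[OF T] by fastforce
    then have "Lam / 2 * (norm (v - x))\<^sup>2 \<le> Lam / 2 * d\<^sup>2"
      using lam by (intro mult_left_mono power_mono) (auto simp: dist_norm)
    then show ?thesis using f(2)[OF vN] E[OF vN] u_upper[OF x(2) N_closure[OF vN]] by linarith
  qed
  have "f x = (\<Sum>v\<in>vert T. t v * f v)" using affine_fun_sum[OF f(1) t(2)] t(3) by simp
  also have "\<dots> \<le> (\<Sum>v\<in>vert T. t v * (u x + gradient u x \<bullet> (v - x) + (E + Lam / 2 * d\<^sup>2)))"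
    using fv t(1) by (intro sum_mono mult_left_mono) auto
  also have "\<dots> = u x + gradient u x \<bullet> (x - x) + (E + Lam / 2 * d\<^sup>2)"
  proof -
    have "affine_fun (\<lambda>v. u x + gradient u x \<bullet> (v - x) + (E + Lam / 2 * d\<^sup>2))"
      unfolding affine_fun_def
      by (intro exI[of _ "gradient u x"] exI[of _ "u x - gradient u x \<bullet> x + (E + Lam / 2 * d\<^sup>2)"])
         (simp add: inner_diff_right)
    from affine_fun_sum[OF this t(2)] show ?thesis unfolding t(3)[symmetric] by simp
  qed
  finally show ?thesis using f(3) by simp
qed

lemma minorants_bdd:
  assumes T: "T \<in> \<T>" and x: "x \<in> T"
  shows "bdd_above (minorants x)"
proof (rule bdd_aboveI[of _ "Max (uh ` N)"])
  fix r assume "r \<in> minorants x"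
  then obtain f where f: "affine_fun f" "\<And>y. y \<in> N \<Longrightarrow> f y \<le> uh y" "r = f x" by blast
  obtain t where t: "\<forall>v\<in>vert T. 0 \<le> t v" "sum t (vert T) = 1" "x = (\<Sum>v\<in>vert T. t v *\<^sub>R v)"
    using barycentric[OF T x] by blast
  have "f x = (\<Sum>v\<in>vert T. t v * f v)" using affine_fun_sum[OF f(1) t(2)] t(3) by simp
  also have "\<dots> \<le> (\<Sum>v\<in>vert T. t v * Max (uh ` N))"
  proof (intro sum_mono mult_left_mono)
    fix v assume v: "v \<in> vert T"
    then have vN: "v \<in> N" using vert_T(3)[OF T] by blast
    then have "uh v \<le> Max (uh ` N)" using finite_N by (intro Max_ge) auto
    then show "f v \<le> Max (uh ` N)" using f(2)[OF vN] by linarith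
  qed (use t in auto)
  also have "\<dots> = Max (uh ` N)" using t(2) by (simp flip: sum_distrib_right)
  finally show "r \<le> Max (uh ` N)" using f(3) by simp
qed

lemma envelope_error:
  assumes E: "\<And>y. y \<in> N \<Longrightarrow> \<bar>uh y - u y\<bar> \<le> E" and d: "\<And>T. T \<in> \<T> \<Longrightarrow> diameter T \<le> d"
    and T: "T \<in> \<T>" and x: "x \<in> T" "x \<in> \<Omega>"
  shows "\<bar>u x - convex_envelope N uh x\<bar> \<le> E + Lam / 2 * d\<^sup>2"
proof -
  have "convex_envelope N uh x \<le> u x + E + Lam / 2 * d\<^sup>2"
    unfolding convex_envelope_def using minorants_ne minorants_le[OF E d T x] by (rule cSup_least)
  moreover have "u x - E \<le> convex_envelope N uh x"
    unfolding convex_envelope_def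
  proof (rule cSup_upper[OF _ minorants_bdd[OF T x(1)]])
    define f where "f = (\<lambda>y. u x + gradient u x \<bullet> (y - x) - E)"
    have "affine_fun f"
      unfolding affine_fun_def f_def
      by (intro exI[of _ "gradient u x"] exI[of _ "u x - gradient u x \<bullet> x - E"]) (simp add: inner_diff_right)
    moreover have "f y \<le> uh y" if y: "y \<in> N" for y
    proof -
      have "0 \<le> lam / 2 * (norm (y - x))\<^sup>2" using lam by simp
      then show ?thesis using u_lower[OF x(2) N_closure[OF y]] E[OF y] unfolding f_def by linarith
    qed
    moreover have "f x = u x - E" by (simp add: f_def)
    ultimately show "u x - E \<in> minorants x" by (intro CollectI exI[of _ f]) simp
  qed
  moreover have "0 \<le> Lam / 2 * d\<^sup>2" using lam by simp
  ultimately show ?thesis by linarith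
qed

lemma sets_UnT: "\<Union>\<T> \<in> sets lebesgue"
  using compact_UnT by (simp add: borel_compact)

lemma envelope_measurable: "convex_envelope N uh \<in> borel_measurable (lebesgue_on (\<Union>\<T>))"
proof (rule borel_measurable_iff_greater[THEN iffD2, rule_format])
  fix a
  define U where "U = (\<Union>f\<in>{f. affine_fun f \<and> (\<forall>y\<in>N. f y \<le> uh y)}. {x. a < f x})"
  have "open U"
  proof -
    have "open {x. a < f x}" if f: "affine_fun f" for f
    proof -
      obtain p b where "\<And>x. f x = p \<bullet> x + b" using f unfolding affine_fun_def by blast
      then show ?thesis by (simp add: open_Collect_less continuous_intros)
    qed
    then show ?thesis unfolding U_def by (intro open_UN) blast
  qed
  have "x \<in> U \<longleftrightarrow> a < convex_envelope N uh x" if x: "x \<in> \<Union>\<T>" for x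
  proof -
    obtain T where "T \<in> \<T>" "x \<in> T" using x by blast
    from less_cSup_iff[OF minorants_ne minorants_bdd[OF this]]
    show ?thesis unfolding convex_envelope_def U_def by auto
  qed
  then have "{w \<in> space (lebesgue_on (\<Union>\<T>)). a < convex_envelope N uh w} = \<Union>\<T> \<inter> U"
    by (auto simp: space_restrict_space)
  moreover have "\<Union>\<T> \<inter> U \<in> sets (lebesgue_on (\<Union>\<T>))"
    using \<open>open U\<close> by (auto simp: sets_restrict_space borel_open intro!: image_eqI[of _ _ U])
  ultimately show "{w \<in> space (lebesgue_on (\<Union>\<T>)). a < convex_envelope N uh w} \<in> sets (lebesgue_on (\<Union>\<T>))"
    by simp
qed

lemma Linf_error:
  assumes E: "\<And>y. y \<in> N \<Longrightarrow> \<bar>uh y - u y\<bar> \<le> E" and d: "\<And>T. T \<in> \<T> \<Longrightarrow> diameter T \<le> d"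
  shows "Linf_norm (\<Union>\<T>) (\<lambda>x. u x - convex_envelope N uh x) \<le> ereal (E + Lam / 2 * d\<^sup>2)"
  unfolding Linf_norm_def
proof (rule esssup_I)
  have "u \<in> borel_measurable (lebesgue_on (\<Union>\<T>))"
    using continuous_on_subset[OF u_cont T_sub] sets_UnT
    by (rule continuous_imp_measurable_on_sets_lebesgue)
  then show "(\<lambda>x. ereal (norm (u x - convex_envelope N uh x))) \<in> borel_measurable (lebesgue_on (\<Union>\<T>))"
    using envelope_measurable by measurable
  have "frontier \<Omega> \<in> null_sets lebesgue"
    using negligible_convex_frontier[OF convex_Omega] by (simp add: negligible_iff_null_sets)
  then have "AE x in lebesgue. x \<notin> frontier \<Omega>" by (rule AE_not_in)
  then have "AE x in lebesgue. x \<in> \<Union>\<T> \<longrightarrow> ereal (norm (u x - convex_envelope N uh x)) \<le> ereal (E + Lam / 2 * d\<^sup>2)"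
  proof (rule AE_mp, intro AE_I2 impI)
    fix x assume x: "x \<notin> frontier \<Omega>" "x \<in> \<Union>\<T>"
    then have "x \<in> \<Omega>" using T_sub open_Omega by (auto simp: frontier_def interior_open)
    then show "ereal (norm (u x - convex_envelope N uh x)) \<le> ereal (E + Lam / 2 * d\<^sup>2)"
      using x(2) envelope_error[OF E d] by auto
  qed
  then show "AE x in lebesgue_on (\<Union>\<T>). ereal (norm (u x - convex_envelope N uh x)) \<le> ereal (E + Lam / 2 * d\<^sup>2)"
    using sets_UnT by (subst AE_restrict_space_iff) auto
qed

end

lemma min_le_powr:
  fixes h \<alpha> b :: real
  assumes "0 < h" "0 < \<alpha>" "\<alpha> \<le> 1"
  shows "h \<le> 1 \<Longrightarrow> h \<le> h powr \<alpha>" "1 \<le> h \<Longrightarrow> 1 \<le> h powr \<alpha>" "b \<le> h \<Longrightarrow> min 1 b \<le> h powr \<alpha>"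
proof -
  show 1: "h \<le> h powr \<alpha>" if "h \<le> 1" using powr_mono'[of \<alpha> 1 h] assms that by simp
  show 2: "1 \<le> h powr \<alpha>" if "1 \<le> h" using ge_one_powr_ge_zero[of h \<alpha>] assms that by simp
  show "min 1 b \<le> h powr \<alpha>" if "b \<le> h" using 1 2 that by (cases "h \<le> 1") auto
qed

lemma holder_seminorm_bound:
  assumes "x \<in> S" "y \<in> S" and fin: "holder_seminorm \<alpha> S F = ereal M"
  shows "norm (F x - F y) \<le> M * dist x y powr \<alpha>"
proof (cases "x = y")
  case False
  have "ereal (norm (F x - F y) / dist x y powr \<alpha>) \<le> holder_seminorm \<alpha> S F"
    unfolding holder_seminorm_def using assms(1,2) False by (intro SUP_upper2[of "(x, y)"]) auto
  then have "norm (F x - F y) / dist x y powr \<alpha> \<le> M" using fin by simp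
  then show ?thesis using False by (simp add: pos_divide_le_eq)
qed simp

lemma holder_seminorm_nonneg:
  fixes S :: "(real^'n) set"
  assumes "open S" "S \<noteq> {}"
  shows "0 \<le> holder_seminorm \<alpha> S F"
proof -
  obtain x r where x: "0 < r" "ball x r \<subseteq> S" using assms open_contains_ball by blast
  define y where "y = x + (r / 2) *\<^sub>R axis undefined 1"
  have "y \<in> S" "x \<in> S" "x \<noteq> y" using x by (auto simp: y_def dist_norm subset_eq)
  have "0 \<le> ereal (norm (F x - F y) / dist x y powr \<alpha>)" by simp
  also have "\<dots> \<le> holder_seminorm \<alpha> S F"
    unfolding holder_seminorm_def using \<open>y \<in> S\<close> \<open>x \<in> S\<close> \<open>x \<noteq> y\<close> by (intro SUP_upper2[of "(x, y)"]) auto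
  finally show ?thesis .
qed

lemma Linf_norm_ge:
  fixes S :: "(real^'n) set"
  assumes S: "open S" "S \<noteq> {}" and F: "\<And>x. x \<in> S \<Longrightarrow> b \<le> norm (F x)"
  shows "ereal b \<le> Linf_norm S F"
proof (rule ccontr)
  assume "\<not> ereal b \<le> Linf_norm S F"
  then have less: "Linf_norm S F < ereal b" by simp
  have Sl: "S \<in> sets lebesgue" using S(1) by simp
  have "AE x in lebesgue_on S. ereal (norm (F x)) \<le> Linf_norm S F"
    unfolding Linf_norm_def by (rule esssup_AE)
  then have "AE x in lebesgue. x \<in> S \<longrightarrow> ereal (norm (F x)) \<le> Linf_norm S F"
    using Sl by (subst (asm) AE_restrict_space_iff) auto
  then have "AE x in lebesgue. x \<notin> S"
  proof (rule AE_mp, intro AE_I2 impI notI)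
    fix x assume "x \<in> S \<longrightarrow> ereal (norm (F x)) \<le> Linf_norm S F" "x \<in> S"
    then have "ereal (norm (F x)) < ereal b" using less by (meson le_less_trans)
    then show False using F[OF \<open>x \<in> S\<close>] by simp
  qed
  then have "S \<in> null_sets lebesgue" using Sl by (simp add: AE_iff_null_sets)
  then have "negligible S" by (simp add: negligible_iff_null_sets)
  then show False using open_not_negligible[OF S] by blast
qed

theorem theorem6p1:
  fixes \<Omega> :: "(real^'n) set" and lam Lam lamF \<gamma> \<sigma> :: real
  assumes "2 \<le> CARD('n)"
    and "uniformly_convex_domain \<Omega>"
    and "0 < lam" and "lam \<le> Lam" and "0 < lamF"
    and "0 < \<gamma>" and "\<gamma> \<le> 1"
  shows "\<exists>C>0. \<forall>(f :: real^'n \<Rightarrow> real) (g :: real^'n \<Rightarrow> real) (u :: real^'n \<Rightarrow> real) (\<alpha> :: real)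
      (h :: real) (N0 :: (real^'n) set) (Nb :: (real^'n) set) (\<T> :: (real^'n) set set)
      (\<phi> :: real^'n \<Rightarrow> real^'n \<Rightarrow> real) (uh :: real^'n \<Rightarrow> real).
      0 < h \<and>
      simplicial_mesh \<Omega> N0 Nb \<T> \<and>
      quasi_uniform \<gamma> h N0 \<T> \<and>
      shape_regular \<sigma> \<T> \<and>
      translation_invariant_nodes \<Omega> h N0 Nb \<and>
      continuous_on (closure \<Omega>) f \<and>
      continuous_on (frontier \<Omega>) g \<and>
      convex_MA_solution \<Omega> f g u \<and>
      (\<forall>x\<in>\<Omega>. loewner_le (mat lam) (hessian u x) \<and> loewner_le (hessian u x) (mat Lam)) \<and>
      translation_invariant_hat_basis h N0 Nb \<T> \<phi> \<and>
      discrete_MA_solution \<Omega> f g N0 Nb \<phi> uh \<and>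
      (\<forall>x\<in>\<Omega>. lamF \<le> f x) \<and>
      0 < \<alpha> \<and> \<alpha> \<le> 1 \<and>
      C2_holder \<alpha> \<Omega> u
      \<longrightarrow> Linf_norm (\<Union>\<T>) (\<lambda>x. u x - convex_envelope (N0 \<union> Nb) uh x)
          \<le> ereal C * (C2_holder_seminorm \<alpha> \<Omega> u + W2inf_seminorm \<Omega> u) * ereal (h powr \<alpha>)"
proof -
  obtain Re where Om: "open \<Omega>" "\<Omega> \<noteq> {}" "bounded \<Omega>" "convex \<Omega>"
    and Re: "0 < Re" "\<And>z. z \<in> frontier \<Omega> \<Longrightarrow> \<exists>c. dist c z = Re \<and> \<Omega> \<subseteq> cball c Re"
    using assms(2) unfolding uniformly_convex_domain_def by blast
  note lam = assms(3,4)
  have Lam: "0 < Lam" using lam by simp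
  define n where "n = real CARD('n)"
  have n: "1 \<le> n" unfolding n_def by (simp add: Suc_leI)
  define Fm where "Fm = \<bar>det (mat (Lam + 1) :: real^'n^'n)\<bar>"
  have Fm: "0 \<le> Fm" by (simp add: Fm_def)
  define Kd where "Kd = max 1 (2 * n * \<sigma>)"
  define Rd where "Rd = n + 3 + Kd"
  define Rc where "Rc = 36 * (Lam / lam) * n"
  define Rt where "Rt = Rc + Rd"
  have Kd: "1 \<le> Kd" by (simp add: Kd_def)
  have Rc: "0 < Rc" using Lam lam n by (simp add: Rc_def)
  have Rt: "0 < Rt" using Rc n Kd by (simp add: Rt_def Rd_def)
  obtain D where D: "0 < D" "\<And>x y. x \<in> closure \<Omega> \<Longrightarrow> y \<in> closure \<Omega> \<Longrightarrow> dist x y \<le> D"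
  proof -
    have b: "bounded (closure \<Omega>)" using Om(3) by (rule bounded_closure)
    show ?thesis
    proof (rule that[of "diameter (closure \<Omega>) + 1"])
      show "0 < diameter (closure \<Omega>) + 1" using diameter_ge_0[OF b] by simp
      show "dist x y \<le> diameter (closure \<Omega>) + 1" if "x \<in> closure \<Omega>" "y \<in> closure \<Omega>" for x y
        using diameter_bounded_bound[OF b that] by simp
    qed
  qed
  obtain x0 where x0: "x0 \<in> \<Omega>" using Om(2) by blast
  then have "x0 \<in> closure \<Omega>" using closure_subset by blast
  then have D0: "closure \<Omega> \<subseteq> cball x0 D" using D(2)[of x0] by auto
  obtain r0 where r0: "0 < r0" "cball x0 r0 \<subseteq> \<Omega>" using Om(1) x0 open_contains_cball by blast
  obtain z1 where z1: "z1 \<in> frontier \<Omega>"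
    using frontier_eq_empty[of \<Omega>] Om(2,3) not_bounded_UNIV by blast
  obtain c1 where c1: "\<Omega> \<subseteq> cball c1 Re" using Re(2)[OF z1] by blast
  define h0 where "h0 = r0 / (Rt + n)"
  have h0: "0 < h0" using r0 Rt n by (simp add: h0_def)
  define \<omega> where "\<omega> = unit_ball_vol n"
  have \<omega>: "0 < \<omega>" unfolding \<omega>_def n_def by simp
  define q where "q = Fm * measure lborel \<Omega> / \<omega> + 1"
  have q: "1 \<le> q" using Fm \<omega> by (simp add: q_def)
  define m where "m = D * q"
  have m: "0 < m" using D(1) q by (simp add: m_def)
  have m': "Fm * measure lborel \<Omega> < unit_ball_vol (CARD('n)) * (m / D) ^ CARD('n)"
  proof -
    have "Fm * measure lborel \<Omega> < \<omega> * q" using \<omega> by (simp add: q_def field_simps)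
    also have "\<dots> \<le> \<omega> * q ^ CARD('n)" using q \<omega> by (intro mult_left_mono self_le_power) auto
    finally show ?thesis using D(1) by (simp add: m_def \<omega>_def n_def)
  qed
  define K where "K = 4 * \<bar>\<sigma>\<bar> / \<gamma> * (2 * Fm + 1)"
  have K0: "0 \<le> K" using Fm assms(6) by (simp add: K_def)
  define E1 where "E1 = Lam * Re\<^sup>2 + Lam / 2 * D\<^sup>2 + m"
  define E2 where "E2 = (2 * Lam + 2 * K) * Re * Rt + 81 / 4 * K * n\<^sup>2 * h0"
  have E1: "0 < E1" unfolding E1_def using Lam m by (simp add: add_nonneg_pos)
  have E2: "0 \<le> E2" unfolding E2_def using Lam K0 Re(1) Rt h0 by simp
  define P where "P = E2 * (1 + h0) + Lam / 2 * (Kd\<^sup>2 + D\<^sup>2) + 3 / 2 * D\<^sup>2 + E1 / min 1 h0 + E1 * 6 / lam"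
  define Q where "Q = (Rc + 2) / 2 * D\<^sup>2 + E1 * 2 * (Rc + 2) / lam"
  have P: "0 < P" unfolding P_def using E1 E2 h0 Lam lam
    by (intro add_nonneg_pos add_nonneg_nonneg divide_pos_pos mult_nonneg_nonneg) auto
  have Q: "0 \<le> Q" unfolding Q_def using E1 Rc lam by simp
  define C where "C = P / lam + Q"
  have C: "0 < C" unfolding C_def using P Q lam by (simp add: add_pos_nonneg)
  show ?thesis
  proof (intro exI[of _ C] conjI C allI impI, elim conjE)
    fix f g u :: "real^'n \<Rightarrow> real" and \<alpha> h :: real and N0 Nb :: "(real^'n) set" and \<T> \<phi> uh
    assume h: "0 < h" and mesh: "simplicial_mesh \<Omega> N0 Nb \<T>" and qu: "quasi_uniform \<gamma> h N0 \<T>"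
      and sr: "shape_regular \<sigma> \<T>" and tin: "translation_invariant_nodes \<Omega> h N0 Nb"
      and fc: "continuous_on (closure \<Omega>) f" and sol: "convex_MA_solution \<Omega> f g u"
      and eig: "\<forall>x\<in>\<Omega>. loewner_le (mat lam) (hessian u x) \<and> loewner_le (hessian u x) (mat Lam)"
      and hats: "translation_invariant_hat_basis h N0 Nb \<T> \<phi>"
      and disc: "discrete_MA_solution \<Omega> f g N0 Nb \<phi> uh"
      and fpos: "\<forall>x\<in>\<Omega>. lamF \<le> f x" and \<alpha>: "0 < \<alpha>" "\<alpha> \<le> 1" and C2: "C2_holder \<alpha> \<Omega> u"
    obtain e :: "'n \<Rightarrow> real^'n" where e: "inj e" "independent (range e)" "\<And>j. norm (e j) \<le> 1"
      "N0 = lattice h e \<inter> \<Omega>"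
      using tin unfolding translation_invariant_nodes_def lattice_def by blast
    define L where "L = lattice h e"
    define M where "M = real_of_ereal (C2_holder_seminorm \<alpha> \<Omega> u)"
    have M_eq: "C2_holder_seminorm \<alpha> \<Omega> u = ereal M" and M: "0 \<le> M"
    proof -
      have "0 \<le> C2_holder_seminorm \<alpha> \<Omega> u"
        unfolding C2_holder_seminorm_def by (rule holder_seminorm_nonneg[OF Om(1,2)])
      moreover have "C2_holder_seminorm \<alpha> \<Omega> u < \<infinity>" using C2 unfolding C2_holder_def by blast
      ultimately show "C2_holder_seminorm \<alpha> \<Omega> u = ereal M" "0 \<le> M"
        unfolding M_def by (cases "C2_holder_seminorm \<alpha> \<Omega> u"; simp)+
    qed
    interpret ma_problem \<Omega> N0 Nb L \<T> h \<gamma> \<sigma> \<phi> f g u uh lam Lam M \<alpha>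
    proof unfold_locales
      show "\<exists>l\<in>L. dist x l \<le> h * CARD('n)" for x
        unfolding L_def by (rule lattice_covering_radius[OF h e(1-3)])
      show "discrete_subgroup L" unfolding L_def by (rule discrete_subgroup_lattice[OF h e(1,2)])
      show "norm (hessian u x - hessian u y) \<le> M * dist x y powr \<alpha>" if "x \<in> \<Omega>" "y \<in> \<Omega>" for x y
        using holder_seminorm_bound[OF that] M_eq unfolding C2_holder_seminorm_def by blast
      show "0 < f x" if "x \<in> \<Omega>" for x using fpos that assms(5) by fastforce
    qed (use Om h assms mesh qu sr hats e(4) fc sol eig disc \<alpha> M C2 in \<open>auto simp: C2_holder_def L_def\<close>)
    have const_eqs: "K\<^sub>d = Kd" "R\<^sub>d = Rd" "R\<^sub>c = Rc" "R\<^sub>t = Rt" "F = Fm"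
      unfolding K\<^sub>d_def R\<^sub>d_def R\<^sub>c_def R\<^sub>t_def Fm_def F_def Kd_def Rd_def Rc_def Rt_def n_def
      by simp_all
    define H where "H = h powr \<alpha>"
    have H: "0 < H" using h by (simp add: H_def)
    note hH = min_le_powr[OF h \<alpha>, folded H_def]
    define EE where "EE = (P - Lam / 2 * (Kd\<^sup>2 + D\<^sup>2) + Q * M) * H"
    have two_kappa: "2 * \<kappa> = (M * (Rc + 2) + 3) * H" unfolding \<kappa>_def const_eqs H_def by simp
    have EE: "E1 * (1 / min 1 h0 + 6 / lam) * H + M * (E1 * 2 * (Rc + 2) / lam) * H \<le> EE"
      "E2 * (1 + h0) * H + \<kappa> * D\<^sup>2 \<le> EE" "0 \<le> EE"
    proof -
      have EE_eq: "EE = E2 * (1 + h0) * H + 3 / 2 * D\<^sup>2 * H + M * ((Rc + 2) / 2 * D\<^sup>2) * H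
          + (E1 * (1 / min 1 h0 + 6 / lam) * H + M * (E1 * 2 * (Rc + 2) / lam) * H)"
        unfolding EE_def P_def Q_def by (simp add: algebra_simps)
      have k: "\<kappa> * D\<^sup>2 = 3 / 2 * D\<^sup>2 * H + M * ((Rc + 2) / 2 * D\<^sup>2) * H"
      proof -
        have "\<kappa> = (M * (Rc + 2) + 3) * H / 2" using two_kappa by simp
        then show ?thesis by (simp only:) (simp add: field_simps)
      qed
      have 1: "0 \<le> E2 * (1 + h0) * H" "0 \<le> \<kappa> * D\<^sup>2" using E2 h0 H kappa_nonneg by auto
      have 2: "0 \<le> E1 * (1 / min 1 h0 + 6 / lam) * H" "0 \<le> M * (E1 * 2 * (Rc + 2) / lam) * H"
        using E1 h0 H M lam Rc by (auto intro!: mult_nonneg_nonneg add_nonneg_nonneg divide_nonneg_nonneg)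
      show "E1 * (1 / min 1 h0 + 6 / lam) * H + M * (E1 * 2 * (Rc + 2) / lam) * H \<le> EE"
        "E2 * (1 + h0) * H + \<kappa> * D\<^sup>2 \<le> EE" "0 \<le> EE"
        using EE_eq k 1 2 by linarith+
    qed
    have nodal: "\<bar>uh z - u z\<bar> \<le> EE" if z: "z \<in> N0" for z
    proof (cases "h \<le> h0 \<and> 2 * \<kappa> \<le> lam / 2")
      case False
      have coarse: "\<bar>uh z - u z\<bar> \<le> E1"
        unfolding E1_def using nodal_error_coarse[OF D m _ c1 z] m' by (simp add: const_eqs)
      have "1 \<le> (1 / min 1 h0 + 6 / lam) * H + M * (2 * (Rc + 2) / lam) * H"
      proof (cases "h \<le> h0")
        case True
        with False have "lam / 2 \<le> (M * (Rc + 2) + 3) * H" using two_kappa by simp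
        then have "1 \<le> 6 / lam * H + M * (2 * (Rc + 2) / lam) * H" using lam by (simp add: field_simps)
        moreover have "0 \<le> 1 / min 1 h0 * H" using h0 H by simp
        ultimately show ?thesis by (simp add: distrib_right)
      next
        case False
        then have "min 1 h0 \<le> H" using hH(3) by simp
        then have "1 \<le> 1 / min 1 h0 * H" using h0 by (simp add: field_simps)
        moreover have "0 \<le> 6 / lam * H" "0 \<le> M * (2 * (Rc + 2) / lam) * H" using lam H M Rc by auto
        ultimately show ?thesis unfolding distrib_right by linarith
      qed
      then have "E1 * 1 \<le> E1 * ((1 / min 1 h0 + 6 / lam) * H + M * (2 * (Rc + 2) / lam) * H)"
        using E1 by (intro mult_left_mono) auto
      also have "\<dots> = E1 * (1 / min 1 h0 + 6 / lam) * H + M * (E1 * 2 * (Rc + 2) / lam) * H"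
        by (simp add: algebra_simps)
      finally show ?thesis using coarse EE(1) by linarith
    next
      case True
      have "h * (R\<^sub>t + CARD('n)) \<le> r0"
        using True Rt n unfolding const_eqs h0_def n_def[symmetric] by (simp add: field_simps)
      then obtain z' where z': "z' \<in> N0" "cball z' (R\<^sub>t * h) \<subseteq> \<Omega>" using deep_node_ex[OF r0(2)] by blast
      have s: "0 < \<sigma>" using sigma_pos(1)[OF z'(1)] .
      have K: "0 < K" unfolding K_def using s assms(6) Fm by (intro mult_pos_pos divide_pos_pos) auto
      have "2 * Fm < (K * \<gamma> / (4 * \<sigma>)) ^ CARD('n)"
      proof -
        have "K * \<gamma> / (4 * \<sigma>) = 2 * Fm + 1" using s assms(6) by (simp add: K_def)
        moreover have "2 * Fm + 1 \<le> (2 * Fm + 1) ^ CARD('n)" using Fm by (intro self_le_power) auto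
        ultimately show ?thesis by simp
      qed
      then have big: "ennreal (F * (unit_ball_vol (CARD('n)) * h ^ CARD('n))) < emeasure lebesgue (cell L (mat (2 * K)))"
        using cell_big[OF z'(1) deepD(1)[OF z'(2)] K] by (simp add: const_eqs)
      have "\<bar>uh z - u z\<bar> \<le> (2 * Lam + 2 * K) * Re * (Rt * h) + 81 / 4 * K * (h * n)\<^sup>2 + \<kappa> * D\<^sup>2"
        using nodal_error_fine[OF _ Re K big D0 z] True unfolding const_eqs n_def by simp
      also have "\<dots> \<le> E2 * h + \<kappa> * D\<^sup>2"
      proof -
        have "81 / 4 * K * n\<^sup>2 * (h * h) \<le> 81 / 4 * K * n\<^sup>2 * (h0 * h)"
          using True K h by (intro mult_left_mono mult_right_mono) auto
        then show ?thesis by (simp add: E2_def power2_eq_square algebra_simps)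
      qed
      also have "\<dots> \<le> E2 * ((1 + h0) * H) + \<kappa> * D\<^sup>2"
      proof -
        have "h \<le> (1 + h0) * H"
        proof (cases "h \<le> 1")
          case h1: True
          have "1 * H \<le> (1 + h0) * H" using h0 H by (intro mult_right_mono) auto
          then show ?thesis using hH(1)[OF h1] by linarith
        next
          case False
          then have "h0 * 1 \<le> h0 * H" using hH(2) h0 by (intro mult_left_mono) auto
          then show ?thesis using True H by (simp add: algebra_simps)
        qed
        then show ?thesis using E2 by (simp add: mult_left_mono)
      qed
      also have "\<dots> \<le> EE" using EE(2) by (simp add: mult.assoc)
      finally show ?thesis .
    qed
    define d where "d = min (Kd * h) D"
    have d: "diameter T \<le> d" if T: "T \<in> \<T>" for T
    proof -
      have "diameter T \<le> D"
      proof (rule diameter_le)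
        show "T \<noteq> {} \<or> 0 \<le> D" using D(1) by simp
        fix x y assume "x \<in> T" "y \<in> T"
        then show "norm (x - y) \<le> D" using D(2)[of x y] T T_sub by (auto simp: dist_norm)
      qed
      then show ?thesis using mesh_diameter_le[OF T] by (simp add: d_def const_eqs)
    qed
    have dd: "d\<^sup>2 \<le> (Kd\<^sup>2 + D\<^sup>2) * H"
    proof (cases "h \<le> 1")
      case True
      have "d\<^sup>2 \<le> (Kd * h)\<^sup>2" using D(1) Kd h by (intro power_mono) (auto simp: d_def)
      also have "\<dots> = Kd\<^sup>2 * (h * h)" by (simp add: power2_eq_square)
      also have "\<dots> \<le> Kd\<^sup>2 * (1 * H)" using True h hH(1)[OF True] by (intro mult_left_mono mult_mono) auto
      also have "\<dots> \<le> (Kd\<^sup>2 + D\<^sup>2) * H" using H by (simp add: distrib_right)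
      finally show ?thesis .
    next
      case False
      have "d\<^sup>2 \<le> D\<^sup>2 * 1" using D(1) Kd h by (simp add: d_def power_mono)
      also have "\<dots> \<le> D\<^sup>2 * H" using False hH(2) by (intro mult_left_mono) auto
      also have "\<dots> \<le> (Kd\<^sup>2 + D\<^sup>2) * H" using H by (simp add: distrib_right)
      finally show ?thesis .
    qed
    have "Linf_norm (\<Union>\<T>) (\<lambda>x. u x - convex_envelope (N0 \<union> Nb) uh x) \<le> ereal (EE + Lam / 2 * d\<^sup>2)"
    proof (rule Linf_error[OF _ d])
      fix y assume "y \<in> N0 \<union> Nb"
      then show "\<bar>uh y - u y\<bar> \<le> EE" using nodal uh_Nb EE(3) by auto
    qed
    also have "\<dots> \<le> ereal (C * (M + lam) * H)"
    proof -
      have "Lam / 2 * d\<^sup>2 \<le> Lam / 2 * ((Kd\<^sup>2 + D\<^sup>2) * H)" using dd Lam by (intro mult_left_mono) auto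
      then have "EE + Lam / 2 * d\<^sup>2 \<le> (P + Q * M) * H" unfolding EE_def by (simp add: algebra_simps)
      also have "\<dots> \<le> (C * (M + lam)) * H"
      proof (rule mult_right_mono)
        have "C * (M + lam) = P / lam * M + P + Q * M + Q * lam"
          unfolding C_def using lam by (simp add: field_simps)
        moreover have "0 \<le> P / lam * M" "0 \<le> Q * lam" using P Q lam M by auto
        ultimately show "P + Q * M \<le> C * (M + lam)" by linarith
      qed (use H in simp)
      finally show ?thesis by simp
    qed
    also have "\<dots> = ereal C * (C2_holder_seminorm \<alpha> \<Omega> u + ereal lam) * ereal (h powr \<alpha>)"
      by (simp add: M_eq H_def)
    also have "\<dots> \<le> ereal C * (C2_holder_seminorm \<alpha> \<Omega> u + W2inf_seminorm \<Omega> u) * ereal (h powr \<alpha>)"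
    proof (intro ereal_mult_right_mono ereal_mult_left_mono add_left_mono)
      show "ereal lam \<le> W2inf_seminorm \<Omega> u"
        unfolding W2inf_seminorm_def
      proof (rule Linf_norm_ge[OF Om(1,2)])
        fix x assume x: "x \<in> \<Omega>"
        define v :: "real^'n" where "v = axis undefined 1"
        have v: "v \<bullet> v = 1" "norm v = 1" by (simp_all add: v_def inner_axis_axis)
        have "lam \<le> v \<bullet> (hessian u x *v v)" using hessian_bounds(1)[OF x, of v] v by simp
        also have "\<dots> \<le> norm v * norm (hessian u x *v v)" by (rule norm_cauchy_schwarz)
        also have "\<dots> \<le> norm (hessian u x)" using norm_matrix_vector_mult_le[of "hessian u x" v] v by simp
        finally show "lam \<le> norm (hessian u x)" .
      qed
    qed (use C H in \<open>auto simp: H_def\<close>)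
    finally show "Linf_norm (\<Union>\<T>) (\<lambda>x. u x - convex_envelope (N0 \<union> Nb) uh x)
        \<le> ereal C * (C2_holder_seminorm \<alpha> \<Omega> u + W2inf_seminorm \<Omega> u) * ereal (h powr \<alpha>)" .
  qed
qed

end
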